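(* Let $M(\phi,\xi,\eta,g_M)$ be a cosymplectic manifold, let $(N,g_N)$ be a Riemannian manifold, and let $F:M(\phi,\xi,\eta,g_M)\to(N,g_N)$ be an anti-invariant Riemannian submersion such that $(\ker F_* )^\perp=\phi(\ker F_* )\oplus\{\xi\}$. Then $F$ is harmonic if and only if $\operatorname{Trace}\,\phi\mathcal{T}_V=0$ for all $V\in\Gamma(\ker F_* )$.
   Context: An almost contact metric structure $(\phi,\xi,\eta,g)$ on a $(2m+1)$-dimensional manifold $M$ consists of a $(1,1)$-tensor field $\phi$, a vector field $\xi$, a 1-form $\eta$ and a Riemannian metric $g$ with $\phi^2=-I+\eta\otimes\xi$, $\phi\xi=0$, $\eta\circ\phi=0$, $\eta(\xi)=1$, $g(\phi X,\phi Y)=g(X,Y)-\eta(X)\eta(Y)$, $\eta(X)=g(X,\xi)$. It is cosymplectic if it is normal ($[\phi,\phi]+2d\eta\otimes\xi=0$) and both $\eta$ and $\Phi(X,Y)=g(X,\phi Y)$ are closed; the structure equation of a cosymplectic manifold is $(\nabla_X\phi)Y=0$, where $\nabla$ is the Levi-Civita connection of $g$, and then $\nabla_X\xi=0$. A Riemannian submersion $F:(M,g_M)\to(N,g_N)$ is a smooth surjective map of maximal rank whose differential $F_*$ preserves the lengths of horizontal vectors. Vectors in $\ker F_*$ are vertical and vectors in $(\ker F_* )^\perp$ are horizontal; $\mathcal{V}$ and $\mathcal{H}$ are the orthogonal projections on $\ker F_*$ and $(\ker F_* )^\perp$. $F$ is anti-invariant if $\phi(\ker F_* )\subseteq(\ker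 F_* )^\perp$. Here $\{\xi\}$ denotes the line distribution spanned by $\xi$. O'Neill's tensor $\mathcal{T}$: for vector fields $E,G$ on $M$, $\mathcal{T}_EG=\mathcal{H}\nabla_{\mathcal{V}E}\mathcal{V}G+\mathcal{V}\nabla_{\mathcal{V}E}\mathcal{H}G$. For vertical $V$, $\phi\mathcal{T}_V$ denotes the endomorphism $E\mapsto\phi(\mathcal{T}_VE)$. The second fundamental form of $F$ is $(\nabla F_* )(X,Y)=\nabla^F_XF_*(Y)-F_*(\nabla_XY)$, where $\nabla^F$ is the pullback connection. $F$ is harmonic if $\operatorname{trace}(\nabla F_* )=0$. *)

theory Defs
  imports "HOL-Analysis.Analysis"
begin

section \<open>Smooth maps between Euclidean spaces\<close>

primrec Ck_on :: "nat \<Rightarrow> ('a::real_normed_vector \<Rightarrow> 'b::real_normed_vector) \<Rightarrow> 'a set \<Rightarrow> bool" where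
  "Ck_on 0 f S \<longleftrightarrow> continuous_on S f"
| "Ck_on (Suc k) f S \<longleftrightarrow> (\<forall>x\<in>S. f differentiable (at x)) \<and>
     (\<forall>v. Ck_on k (\<lambda>x. frechet_derivative f (at x) v) S)"

text \<open>Only used for open sets.\<close>

definition smooth_on :: "'a::euclidean_space set \<Rightarrow> ('a \<Rightarrow> 'b::euclidean_space) \<Rightarrow> bool" where
  "smooth_on S f \<longleftrightarrow> (\<forall>k. Ck_on k f S)"


section \<open>Smooth manifolds\<close>

text \<open>
  The underlying set of a manifold is a whole type \<open>'p\<close>, and \<open>'e\<close> is the model space.
  A chart \<open>(U, c)\<close> is an open set with a homeomorphism from it onto an open subset of \<open>'e\<close>.
  The values of \<open>c\<close> outside \<open>U\<close> are irrelevant. An atlas need not be maximal.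
\<close>

type_synonym ('p, 'e) chart = "'p set \<times> ('p \<Rightarrow> 'e)"

definition chart_inv :: "('p, 'e) chart \<Rightarrow> 'e \<Rightarrow> 'p" where
  "chart_inv \<kappa> = inv_into (fst \<kappa>) (snd \<kappa>)"

definition smooth_atlas ::
  "('p::{t2_space,second_countable_topology}, 'e::euclidean_space) chart set \<Rightarrow> bool" where
  "smooth_atlas A \<longleftrightarrow>
     (\<forall>(U, c)\<in>A. open U \<and> open (c ` U) \<and> homeomorphism U (c ` U) c (chart_inv (U, c))) \<and>
     (\<Union>(U, c)\<in>A. U) = UNIV \<and>
     (\<forall>(U, c)\<in>A. \<forall>(V, d)\<in>A. smooth_on (c ` (U \<inter> V)) (d \<circ> chart_inv (U, c)))"

definition smooth_fun ::
  "('p, 'e::euclidean_space) chart set \<Rightarrow> 'p set \<Rightarrow> ('p \<Rightarrow> 'b::euclidean_space) \<Rightarrow> bool" where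
  "smooth_fun A W f \<longleftrightarrow> (\<forall>(U, c)\<in>A. smooth_on (c ` (U \<inter> W)) (f \<circ> chart_inv (U, c)))"

definition smooth_map ::
  "('p::topological_space, 'e::euclidean_space) chart set \<Rightarrow>
   ('q::topological_space, 'f::euclidean_space) chart set \<Rightarrow> ('p \<Rightarrow> 'q) \<Rightarrow> bool" where
  "smooth_map A B F \<longleftrightarrow> continuous_on UNIV F \<and> (\<forall>(V, d)\<in>B. smooth_fun A (F -` V) (d \<circ> F))"


section \<open>Tangent vectors\<close>

text \<open>
  One chart \<open>chart_at A p\<close> is chosen around every point \<open>p\<close>, and the tangent space at \<open>p\<close> is
  identified with the model space \<open>'e\<close> through it: \<open>v :: 'e\<close>, regarded as a tangent vector at \<open>p\<close>,
  is the vector with components \<open>v\<close> in \<open>chart_at A p\<close>. Its components in an arbitrary chart around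
  \<open>p\<close> are given by \<open>comps\<close> below, and the smoothness of a vector field is tested on those. A vector
  field is thus a function \<open>'p \<Rightarrow> 'e\<close>, and a (1,1)-tensor field is a function \<open>'p \<Rightarrow> 'e \<Rightarrow> 'e\<close>.
\<close>

definition chart_at :: "('p, 'e) chart set \<Rightarrow> 'p \<Rightarrow> ('p, 'e) chart" where
  "chart_at A p = (SOME \<kappa>. \<kappa> \<in> A \<and> p \<in> fst \<kappa>)"

definition dir_deriv ::
  "('p, 'e::euclidean_space) chart set \<Rightarrow> ('p \<Rightarrow> 'b::euclidean_space) \<Rightarrow> 'p \<Rightarrow> 'e \<Rightarrow> 'b" where
  "dir_deriv A f p v =
     frechet_derivative (f \<circ> chart_inv (chart_at A p)) (at (snd (chart_at A p) p)) v"

definition comps ::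
  "('p, 'e::euclidean_space) chart set \<Rightarrow> ('p, 'e) chart \<Rightarrow> 'p \<Rightarrow> 'e \<Rightarrow> 'e" where
  "comps A \<kappa> p v = dir_deriv A (snd \<kappa>) p v"

definition tangent_map ::
  "('p, 'e::euclidean_space) chart set \<Rightarrow> ('q, 'f::euclidean_space) chart set \<Rightarrow>
   ('p \<Rightarrow> 'q) \<Rightarrow> 'p \<Rightarrow> 'e \<Rightarrow> 'f" where
  "tangent_map A B F p v = dir_deriv A (snd (chart_at B (F p)) \<circ> F) p v"

text \<open>
  A section along \<open>F\<close> is a section of the pullback bundle \<open>F\<^sup>*TN\<close>: the value \<open>Y p\<close> is a tangent
  vector of the target at \<open>F p\<close>. Vector fields are the case where \<open>F\<close> is the identity.
\<close>

definition smooth_section_along ::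
  "('p, 'e::euclidean_space) chart set \<Rightarrow> ('q, 'f::euclidean_space) chart set \<Rightarrow>
   ('p \<Rightarrow> 'q) \<Rightarrow> 'p set \<Rightarrow> ('p \<Rightarrow> 'f) \<Rightarrow> bool" where
  "smooth_section_along A B F W Y \<longleftrightarrow>
     (\<forall>(V, d)\<in>B. smooth_fun A (W \<inter> F -` V) (\<lambda>p. comps B (V, d) (F p) (Y p)))"

definition smooth_field ::
  "('p, 'e::euclidean_space) chart set \<Rightarrow> 'p set \<Rightarrow> ('p \<Rightarrow> 'e) \<Rightarrow> bool" where
  "smooth_field A W X \<longleftrightarrow> smooth_section_along A A (\<lambda>p. p) W X"

text \<open>
  The local field through \<open>v\<close> at \<open>p\<close> whose components in the chart \<open>chart_at A p\<close> are constant. It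
  serves to evaluate, on a single tangent vector, an expression in a field that is tensorial in
  that field; any other local extension of \<open>v\<close> gives the same value.
\<close>

definition extension ::
  "('p, 'e::euclidean_space) chart set \<Rightarrow> 'p \<Rightarrow> 'e \<Rightarrow> 'p \<Rightarrow> 'e" where
  "extension A p v q =
     frechet_derivative (snd (chart_at A q) \<circ> chart_inv (chart_at A p))
       (at (snd (chart_at A p) q)) v"

text \<open>Computed in the components with respect to \<open>chart_at A p\<close>.\<close>

definition lie_bracket ::
  "('p, 'e::euclidean_space) chart set \<Rightarrow> ('p \<Rightarrow> 'e) \<Rightarrow> ('p \<Rightarrow> 'e) \<Rightarrow> 'p \<Rightarrow> 'e" where
  "lie_bracket A X Y p =
     dir_deriv A (\<lambda>q. comps A (chart_at A p) q (Y q)) p (X p) -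
     dir_deriv A (\<lambda>q. comps A (chart_at A p) q (X q)) p (Y p)"


section \<open>Tensor fields\<close>

definition endo_field ::
  "('p::topological_space, 'e::euclidean_space) chart set \<Rightarrow> ('p \<Rightarrow> 'e \<Rightarrow> 'e) \<Rightarrow> bool" where
  "endo_field A \<phi> \<longleftrightarrow> (\<forall>p. linear (\<phi> p)) \<and>
     (\<forall>W X. open W \<and> smooth_field A W X \<longrightarrow> smooth_field A W (\<lambda>p. \<phi> p (X p)))"

definition one_form ::
  "('p::topological_space, 'e::euclidean_space) chart set \<Rightarrow> ('p \<Rightarrow> 'e \<Rightarrow> real) \<Rightarrow> bool" where
  "one_form A \<omega> \<longleftrightarrow> (\<forall>p. linear (\<omega> p)) \<and>
     (\<forall>W X. open W \<and> smooth_field A W X \<longrightarrow> smooth_fun A W (\<lambda>p. \<omega> p (X p)))"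

definition riemannian_metric ::
  "('p::topological_space, 'e::euclidean_space) chart set \<Rightarrow> ('p \<Rightarrow> 'e \<Rightarrow> 'e \<Rightarrow> real) \<Rightarrow> bool" where
  "riemannian_metric A g \<longleftrightarrow>
     (\<forall>p. bilinear (g p) \<and> (\<forall>u v. g p u v = g p v u) \<and> (\<forall>v. v \<noteq> 0 \<longrightarrow> g p v v > 0)) \<and>
     (\<forall>W X Y. open W \<and> smooth_field A W X \<and> smooth_field A W Y \<longrightarrow>
        smooth_fun A W (\<lambda>p. g p (X p) (Y p)))"

text \<open>
  Exterior derivatives of 1-forms and 2-forms, evaluated on vector fields, with the normalising
  factors 1/2 and 1/3 for which normality reads \<open>[\<phi>,\<phi>] + 2 d\<eta> \<otimes> \<xi> = 0\<close>.
\<close>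

definition ext_deriv1 ::
  "('p, 'e::euclidean_space) chart set \<Rightarrow> ('p \<Rightarrow> 'e \<Rightarrow> real) \<Rightarrow>
   ('p \<Rightarrow> 'e) \<Rightarrow> ('p \<Rightarrow> 'e) \<Rightarrow> 'p \<Rightarrow> real" where
  "ext_deriv1 A \<omega> X Y p = (1/2) *
     (dir_deriv A (\<lambda>q. \<omega> q (Y q)) p (X p) - dir_deriv A (\<lambda>q. \<omega> q (X q)) p (Y p)
      - \<omega> p (lie_bracket A X Y p))"

definition ext_deriv2 ::
  "('p, 'e::euclidean_space) chart set \<Rightarrow> ('p \<Rightarrow> 'e \<Rightarrow> 'e \<Rightarrow> real) \<Rightarrow>
   ('p \<Rightarrow> 'e) \<Rightarrow> ('p \<Rightarrow> 'e) \<Rightarrow> ('p \<Rightarrow> 'e) \<Rightarrow> 'p \<Rightarrow> real" where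
  "ext_deriv2 A \<Omega> X Y Z p = (1/3) *
     (dir_deriv A (\<lambda>q. \<Omega> q (Y q) (Z q)) p (X p) + dir_deriv A (\<lambda>q. \<Omega> q (Z q) (X q)) p (Y p)
      + dir_deriv A (\<lambda>q. \<Omega> q (X q) (Y q)) p (Z p)
      - \<Omega> p (lie_bracket A X Y p) (Z p) - \<Omega> p (lie_bracket A Y Z p) (X p)
      - \<Omega> p (lie_bracket A Z X p) (Y p))"

definition closed1 ::
  "('p::topological_space, 'e::euclidean_space) chart set \<Rightarrow> ('p \<Rightarrow> 'e \<Rightarrow> real) \<Rightarrow> bool" where
  "closed1 A \<omega> \<longleftrightarrow>
     (\<forall>W X Y. open W \<and> smooth_field A W X \<and> smooth_field A W Y \<longrightarrow>
        (\<forall>p\<in>W. ext_deriv1 A \<omega> X Y p = 0))"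

definition closed2 ::
  "('p::topological_space, 'e::euclidean_space) chart set \<Rightarrow> ('p \<Rightarrow> 'e \<Rightarrow> 'e \<Rightarrow> real) \<Rightarrow> bool" where
  "closed2 A \<Omega> \<longleftrightarrow>
     (\<forall>W X Y Z. open W \<and> smooth_field A W X \<and> smooth_field A W Y \<and> smooth_field A W Z \<longrightarrow>
        (\<forall>p\<in>W. ext_deriv2 A \<Omega> X Y Z p = 0))"

text \<open>The Nijenhuis torsion \<open>[\<phi>,\<phi>](X,Y)\<close>.\<close>

definition nijenhuis ::
  "('p, 'e::euclidean_space) chart set \<Rightarrow> ('p \<Rightarrow> 'e \<Rightarrow> 'e) \<Rightarrow>
   ('p \<Rightarrow> 'e) \<Rightarrow> ('p \<Rightarrow> 'e) \<Rightarrow> 'p \<Rightarrow> 'e" where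
  "nijenhuis A \<phi> X Y p =
     \<phi> p (\<phi> p (lie_bracket A X Y p)) + lie_bracket A (\<lambda>q. \<phi> q (X q)) (\<lambda>q. \<phi> q (Y q)) p
     - \<phi> p (lie_bracket A (\<lambda>q. \<phi> q (X q)) Y p) - \<phi> p (lie_bracket A X (\<lambda>q. \<phi> q (Y q)) p)"


section \<open>Cosymplectic manifolds\<close>

definition almost_contact_metric ::
  "('p::topological_space, 'e::euclidean_space) chart set \<Rightarrow> ('p \<Rightarrow> 'e \<Rightarrow> 'e) \<Rightarrow> ('p \<Rightarrow> 'e) \<Rightarrow>
   ('p \<Rightarrow> 'e \<Rightarrow> real) \<Rightarrow> ('p \<Rightarrow> 'e \<Rightarrow> 'e \<Rightarrow> real) \<Rightarrow> bool" where
  "almost_contact_metric A \<phi> \<xi> \<eta> g \<longleftrightarrow>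
     endo_field A \<phi> \<and> smooth_field A UNIV \<xi> \<and> one_form A \<eta> \<and> riemannian_metric A g \<and>
     (\<forall>p v. \<phi> p (\<phi> p v) = - v + \<eta> p v *\<^sub>R \<xi> p) \<and>
     (\<forall>p. \<phi> p (\<xi> p) = 0) \<and>
     (\<forall>p v. \<eta> p (\<phi> p v) = 0) \<and>
     (\<forall>p. \<eta> p (\<xi> p) = 1) \<and>
     (\<forall>p u v. g p (\<phi> p u) (\<phi> p v) = g p u v - \<eta> p u * \<eta> p v) \<and>
     (\<forall>p v. \<eta> p v = g p v (\<xi> p))"

definition normal_structure ::
  "('p::topological_space, 'e::euclidean_space) chart set \<Rightarrow> ('p \<Rightarrow> 'e \<Rightarrow> 'e) \<Rightarrow> ('p \<Rightarrow> 'e) \<Rightarrow>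
   ('p \<Rightarrow> 'e \<Rightarrow> real) \<Rightarrow> bool" where
  "normal_structure A \<phi> \<xi> \<eta> \<longleftrightarrow>
     (\<forall>W X Y. open W \<and> smooth_field A W X \<and> smooth_field A W Y \<longrightarrow>
        (\<forall>p\<in>W. nijenhuis A \<phi> X Y p + (2 * ext_deriv1 A \<eta> X Y p) *\<^sub>R \<xi> p = 0))"

definition cosymplectic ::
  "('p::topological_space, 'e::euclidean_space) chart set \<Rightarrow> ('p \<Rightarrow> 'e \<Rightarrow> 'e) \<Rightarrow> ('p \<Rightarrow> 'e) \<Rightarrow>
   ('p \<Rightarrow> 'e \<Rightarrow> real) \<Rightarrow> ('p \<Rightarrow> 'e \<Rightarrow> 'e \<Rightarrow> real) \<Rightarrow> bool" where
  "cosymplectic A \<phi> \<xi> \<eta> g \<longleftrightarrow>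
     almost_contact_metric A \<phi> \<xi> \<eta> g \<and> normal_structure A \<phi> \<xi> \<eta> \<and>
     closed1 A \<eta> \<and> closed2 A (\<lambda>p u v. g p u (\<phi> p v))"


section \<open>Connections\<close>

text \<open>
  A connection on the bundle \<open>F\<^sup>*TN\<close>: \<open>D p v Y\<close> is the derivative at \<open>p\<close> of the section \<open>Y\<close> in the
  direction of the tangent vector \<open>v\<close>. It is only meaningful for sections \<open>Y\<close> that are smooth on
  a neighbourhood of \<open>p\<close>, and the last clause says that it depends on the germ of \<open>Y\<close> at \<open>p\<close> only.
\<close>

definition connection_along ::
  "('p::topological_space, 'e::euclidean_space) chart set \<Rightarrow>
   ('q, 'f::euclidean_space) chart set \<Rightarrow> ('p \<Rightarrow> 'q) \<Rightarrow>
   ('p \<Rightarrow> 'e \<Rightarrow> ('p \<Rightarrow> 'f) \<Rightarrow> 'f) \<Rightarrow> bool" where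
  "connection_along A B F D \<longleftrightarrow>
     (\<forall>W Y. open W \<and> smooth_section_along A B F W Y \<longrightarrow>
        (\<forall>p\<in>W. linear (\<lambda>v. D p v Y)) \<and>
        (\<forall>X. smooth_field A W X \<longrightarrow> smooth_section_along A B F W (\<lambda>p. D p (X p) Y)) \<and>
        (\<forall>Z. smooth_section_along A B F W Z \<longrightarrow>
           (\<forall>p\<in>W. \<forall>v. D p v (\<lambda>q. Y q + Z q) = D p v Y + D p v Z)) \<and>
        (\<forall>f::'p \<Rightarrow> real. smooth_fun A W f \<longrightarrow>
           (\<forall>p\<in>W. \<forall>v. D p v (\<lambda>q. f q *\<^sub>R Y q) = dir_deriv A f p v *\<^sub>R Y p + f p *\<^sub>R D p v Y)) \<and>
        (\<forall>Z. (\<forall>q\<in>W. Z q = Y q) \<longrightarrow> (\<forall>p\<in>W. \<forall>v. D p v Z = D p v Y)))"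

text \<open>Torsion-free metric connections on the tangent bundle.\<close>

definition levi_civita ::
  "('p::topological_space, 'e::euclidean_space) chart set \<Rightarrow> ('p \<Rightarrow> 'e \<Rightarrow> 'e \<Rightarrow> real) \<Rightarrow>
   ('p \<Rightarrow> 'e \<Rightarrow> ('p \<Rightarrow> 'e) \<Rightarrow> 'e) \<Rightarrow> bool" where
  "levi_civita A g D \<longleftrightarrow>
     connection_along A A (\<lambda>p. p) D \<and>
     (\<forall>W X Y. open W \<and> smooth_field A W X \<and> smooth_field A W Y \<longrightarrow>
        (\<forall>p\<in>W. D p (X p) Y - D p (Y p) X = lie_bracket A X Y p) \<and>
        (\<forall>p\<in>W. \<forall>v. dir_deriv A (\<lambda>q. g q (X q) (Y q)) p v =
           g p (D p v X) (Y p) + g p (X p) (D p v Y)))"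

text \<open>
  The pullback connection is the connection on \<open>F\<^sup>*TN\<close> determined by its values
  \<open>\<nabla>\<^sup>F\<^sub>v (Y \<circ> F) = \<nabla>\<^sup>N\<^bsub>F\<^sub>* v\<^esub> Y\<close> on the pulled back fields.
\<close>

definition pullback_connection ::
  "('p::topological_space, 'e::euclidean_space) chart set \<Rightarrow>
   ('q::topological_space, 'f::euclidean_space) chart set \<Rightarrow> ('p \<Rightarrow> 'q) \<Rightarrow>
   ('q \<Rightarrow> 'f \<Rightarrow> ('q \<Rightarrow> 'f) \<Rightarrow> 'f) \<Rightarrow> ('p \<Rightarrow> 'e \<Rightarrow> ('p \<Rightarrow> 'f) \<Rightarrow> 'f) \<Rightarrow> bool" where
  "pullback_connection A B F DN DF \<longleftrightarrow>
     connection_along A B F DF \<and>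
     (\<forall>V Y. open V \<and> smooth_field B V Y \<longrightarrow>
        (\<forall>p\<in>F -` V. \<forall>v. DF p v (\<lambda>q. Y (F q)) = DN (F p) (tangent_map A B F p v) Y))"


section \<open>Riemannian submersions\<close>

definition orth_compl :: "('e::euclidean_space \<Rightarrow> 'e \<Rightarrow> real) \<Rightarrow> 'e set \<Rightarrow> 'e set" where
  "orth_compl b S = {v. \<forall>w\<in>S. b v w = 0}"

definition orth_proj :: "('e::euclidean_space \<Rightarrow> 'e \<Rightarrow> real) \<Rightarrow> 'e set \<Rightarrow> 'e \<Rightarrow> 'e" where
  "orth_proj b S v = (THE w. w \<in> S \<and> v - w \<in> orth_compl b S)"

definition vertical ::
  "('p, 'e::euclidean_space) chart set \<Rightarrow> ('q, 'f::euclidean_space) chart set \<Rightarrow>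
   ('p \<Rightarrow> 'q) \<Rightarrow> 'p \<Rightarrow> 'e set" where
  "vertical A B F p = {v. tangent_map A B F p v = 0}"

definition horizontal ::
  "('p, 'e::euclidean_space) chart set \<Rightarrow> ('p \<Rightarrow> 'e \<Rightarrow> 'e \<Rightarrow> real) \<Rightarrow>
   ('q, 'f::euclidean_space) chart set \<Rightarrow> ('p \<Rightarrow> 'q) \<Rightarrow> 'p \<Rightarrow> 'e set" where
  "horizontal A g B F p = orth_compl (g p) (vertical A B F p)"

definition vert_proj ::
  "('p, 'e::euclidean_space) chart set \<Rightarrow> ('p \<Rightarrow> 'e \<Rightarrow> 'e \<Rightarrow> real) \<Rightarrow>
   ('q, 'f::euclidean_space) chart set \<Rightarrow> ('p \<Rightarrow> 'q) \<Rightarrow> 'p \<Rightarrow> 'e \<Rightarrow> 'e" where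
  "vert_proj A g B F p = orth_proj (g p) (vertical A B F p)"

definition hor_proj ::
  "('p, 'e::euclidean_space) chart set \<Rightarrow> ('p \<Rightarrow> 'e \<Rightarrow> 'e \<Rightarrow> real) \<Rightarrow>
   ('q, 'f::euclidean_space) chart set \<Rightarrow> ('p \<Rightarrow> 'q) \<Rightarrow> 'p \<Rightarrow> 'e \<Rightarrow> 'e" where
  "hor_proj A g B F p = orth_proj (g p) (horizontal A g B F p)"

definition riemannian_submersion ::
  "('p::topological_space, 'e::euclidean_space) chart set \<Rightarrow> ('p \<Rightarrow> 'e \<Rightarrow> 'e \<Rightarrow> real) \<Rightarrow>
   ('q::topological_space, 'f::euclidean_space) chart set \<Rightarrow> ('q \<Rightarrow> 'f \<Rightarrow> 'f \<Rightarrow> real) \<Rightarrow>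
   ('p \<Rightarrow> 'q) \<Rightarrow> bool" where
  "riemannian_submersion A gM B gN F \<longleftrightarrow>
     smooth_map A B F \<and> surj F \<and> (\<forall>p. surj (tangent_map A B F p)) \<and>
     (\<forall>p. \<forall>v\<in>horizontal A gM B F p.
        sqrt (gN (F p) (tangent_map A B F p v) (tangent_map A B F p v)) = sqrt (gM p v v))"

definition anti_invariant ::
  "('p, 'e::euclidean_space) chart set \<Rightarrow> ('p \<Rightarrow> 'e \<Rightarrow> 'e) \<Rightarrow> ('p \<Rightarrow> 'e \<Rightarrow> 'e \<Rightarrow> real) \<Rightarrow>
   ('q, 'f::euclidean_space) chart set \<Rightarrow> ('p \<Rightarrow> 'q) \<Rightarrow> bool" where
  "anti_invariant A \<phi> g B F \<longleftrightarrow> (\<forall>p. \<phi> p ` vertical A B F p \<subseteq> horizontal A g B F p)"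

definition is_direct_sum :: "'e::real_vector set \<Rightarrow> 'e set \<Rightarrow> 'e set \<Rightarrow> bool" where
  "is_direct_sum S S1 S2 \<longleftrightarrow> S = {u + w | u w. u \<in> S1 \<and> w \<in> S2} \<and> S1 \<inter> S2 = {0}"

text \<open>Smooth sections of the vertical distribution, defined on the whole manifold.\<close>

definition vertical_fields ::
  "('p, 'e::euclidean_space) chart set \<Rightarrow> ('q, 'f::euclidean_space) chart set \<Rightarrow>
   ('p \<Rightarrow> 'q) \<Rightarrow> ('p \<Rightarrow> 'e) set" where
  "vertical_fields A B F = {V. smooth_field A UNIV V \<and> (\<forall>p. V p \<in> vertical A B F p)}"

text \<open>O'Neill's tensor \<open>\<T>\<^sub>E G\<close> at \<open>p\<close>. It depends on \<open>E\<close> only through its value at \<open>p\<close>.\<close>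

definition oneill_T ::
  "('p, 'e::euclidean_space) chart set \<Rightarrow> ('p \<Rightarrow> 'e \<Rightarrow> 'e \<Rightarrow> real) \<Rightarrow>
   ('q, 'f::euclidean_space) chart set \<Rightarrow> ('p \<Rightarrow> 'q) \<Rightarrow>
   ('p \<Rightarrow> 'e \<Rightarrow> ('p \<Rightarrow> 'e) \<Rightarrow> 'e) \<Rightarrow> ('p \<Rightarrow> 'e) \<Rightarrow> ('p \<Rightarrow> 'e) \<Rightarrow> 'p \<Rightarrow> 'e" where
  "oneill_T A g B F D E G p =
     hor_proj A g B F p
       (D p (vert_proj A g B F p (E p)) (\<lambda>q. vert_proj A g B F q (G q))) +
     vert_proj A g B F p
       (D p (vert_proj A g B F p (E p)) (\<lambda>q. hor_proj A g B F q (G q)))"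

definition endo_trace :: "('e::euclidean_space \<Rightarrow> 'e) \<Rightarrow> real" where
  "endo_trace L = (\<Sum>b\<in>Basis. L b \<bullet> b)"

text \<open>The trace at \<open>p\<close> of the endomorphism \<open>\<phi>\<T>\<^sub>V\<close> of the tangent space.\<close>

definition trace_phi_T ::
  "('p, 'e::euclidean_space) chart set \<Rightarrow> ('p \<Rightarrow> 'e \<Rightarrow> 'e) \<Rightarrow> ('p \<Rightarrow> 'e \<Rightarrow> 'e \<Rightarrow> real) \<Rightarrow>
   ('q, 'f::euclidean_space) chart set \<Rightarrow> ('p \<Rightarrow> 'q) \<Rightarrow>
   ('p \<Rightarrow> 'e \<Rightarrow> ('p \<Rightarrow> 'e) \<Rightarrow> 'e) \<Rightarrow> ('p \<Rightarrow> 'e) \<Rightarrow> 'p \<Rightarrow> real" where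
  "trace_phi_T A \<phi> g B F D V p =
     endo_trace (\<lambda>e. \<phi> p (oneill_T A g B F D V (extension A p e) p))"


section \<open>Harmonic maps\<close>

definition second_fundamental_form ::
  "('p, 'e::euclidean_space) chart set \<Rightarrow> ('q, 'f::euclidean_space) chart set \<Rightarrow> ('p \<Rightarrow> 'q) \<Rightarrow>
   ('p \<Rightarrow> 'e \<Rightarrow> ('p \<Rightarrow> 'e) \<Rightarrow> 'e) \<Rightarrow> ('p \<Rightarrow> 'e \<Rightarrow> ('p \<Rightarrow> 'f) \<Rightarrow> 'f) \<Rightarrow>
   ('p \<Rightarrow> 'e) \<Rightarrow> ('p \<Rightarrow> 'e) \<Rightarrow> 'p \<Rightarrow> 'f" where
  "second_fundamental_form A B F DM DF X Y p =
     DF p (X p) (\<lambda>q. tangent_map A B F q (Y q)) - tangent_map A B F p (DM p (X p) Y)"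

definition orthonormal_basis :: "('e::euclidean_space \<Rightarrow> 'e \<Rightarrow> real) \<Rightarrow> 'e set \<Rightarrow> bool" where
  "orthonormal_basis b S \<longleftrightarrow> card S = DIM('e) \<and> (\<forall>u\<in>S. \<forall>v\<in>S. b u v = (if u = v then 1 else 0))"

text \<open>
  The trace of a (vector-valued) bilinear form with respect to a scalar product, which does not
  depend on the chosen orthonormal basis.
\<close>

definition metric_trace ::
  "('e::euclidean_space \<Rightarrow> 'e \<Rightarrow> real) \<Rightarrow> ('e \<Rightarrow> 'e \<Rightarrow> 'f::real_vector) \<Rightarrow> 'f" where
  "metric_trace b \<beta> = (\<Sum>e\<in>(SOME S. orthonormal_basis b S). \<beta> e e)"

definition harmonic ::
  "('p, 'e::euclidean_space) chart set \<Rightarrow> ('p \<Rightarrow> 'e \<Rightarrow> 'e \<Rightarrow> real) \<Rightarrow>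
   ('q, 'f::euclidean_space) chart set \<Rightarrow> ('p \<Rightarrow> 'q) \<Rightarrow>
   ('p \<Rightarrow> 'e \<Rightarrow> ('p \<Rightarrow> 'e) \<Rightarrow> 'e) \<Rightarrow> ('p \<Rightarrow> 'e \<Rightarrow> ('p \<Rightarrow> 'f) \<Rightarrow> 'f) \<Rightarrow> bool" where
  "harmonic A g B F DM DF \<longleftrightarrow>
     (\<forall>p. metric_trace (g p)
        (\<lambda>u v. second_fundamental_form A B F DM DF (extension A p u) (extension A p v) p) = 0)"

end

theory Submission
  imports Defs
begin

text \<open>
  The second fundamental form of \<open>F\<close> is symmetric, because \<open>\<nabla>\<^sup>F\<close> is torsion free, and hence tensorial.
  On horizontal vectors it vanishes: as a trilinear form paired with \<open>F\<^sub>*Z\<close> it is symmetric in the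
  first two and skew in the last two arguments. On vertical vectors it is \<open>- F\<^sub>*(\<T>\<^sub>U V)\<close>, so \<open>F\<close>
  is harmonic if and only if the mean curvature vector \<open>h = \<Sum> \<T>\<^sub>e e\<close> of the fibres is zero.

  On the other side, closedness of \<open>\<eta>\<close> and \<open>\<Phi>\<close> together with normality force \<open>\<nabla>\<phi> = 0\<close> and
  \<open>\<nabla>\<xi> = 0\<close>. Therefore \<open>g(\<T>\<^sub>U V, \<phi>W)\<close> is totally symmetric in vertical vectors (as for Lagrangian
  submanifolds), which gives \<open>Trace \<phi>\<T>\<^sub>V = - 2 g(h, \<phi>V)\<close>, and \<open>g(h, \<xi>) = 0\<close>. As the horizontal
  space is \<open>\<phi>(ker F\<^sub>*) \<oplus> {\<xi>}\<close>, the trace vanishes for all vertical fields if and only if \<open>h = 0\<close>;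
  bump functions extend any vertical vector to a global vertical field.
\<close>

section \<open>Calculus of \<open>Ck_on\<close> functions\<close>

text \<open>The factor -2 arises because \<open>\<T>\<^sub>V\<close> exchanges vertical and
  horizontal vectors and is skew, as is \<phi>: the vertical-to-horizontal and the
  horizontal-to-vertical halves of \<open>\<phi>\<T>\<^sub>V\<close> have the same trace, each equal
  to -g(h, \<phi>V). Tensors are evaluated on coordinate-constant extensions of single vectors,
  which are neither vertical nor horizontal away from the point. Identities such as g(\<phi>V, W) =
  0 are therefore differentiated for the projections of these fields, which presupposes that the
  projections are smooth. That follows from g_M(HX, E) = g_N(dF X, dF E), whose right side is
  visibly smooth; no frame of the vertical distribution is constructed. Likewise no orthonormal
  basis is adapted to the splitting: all traces use one arbitrary basis, and projections are moved
  across it by adjointness. The pullback connection is prescribed only on pulled back fields. Its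
  torsion and metric identities come from expanding sections in the pulled back coordinate
  frame.\<close>

abbreviation fderiv :: "('a::real_normed_vector \<Rightarrow> 'b::real_normed_vector) \<Rightarrow> 'a \<Rightarrow> 'a \<Rightarrow> 'b" where
  "fderiv f x \<equiv> frechet_derivative f (at x)"

lemma has_derivative_cong_open:
  assumes "open S" "x \<in> S" "\<And>y. y \<in> S \<Longrightarrow> f y = g y"
  shows "(f has_derivative D) (at x) \<longleftrightarrow> (g has_derivative D) (at x)"
  using assms has_derivative_transform_within_open[of f D x UNIV S g]
    has_derivative_transform_within_open[of g D x UNIV S f] by auto

lemma fderiv_cong_open:
  assumes "open S" "x \<in> S" "\<And>y. y \<in> S \<Longrightarrow> f y = g y"
  shows "fderiv f x = fderiv g x"
  unfolding frechet_derivative_def using has_derivative_cong_open[OF assms] by simp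

lemma differentiable_cong_open:
  assumes "open S" "x \<in> S" "\<And>y. y \<in> S \<Longrightarrow> f y = g y"
  shows "f differentiable (at x) \<longleftrightarrow> g differentiable (at x)"
  unfolding differentiable_def using has_derivative_cong_open[OF assms] by simp

lemma fderiv_eqI: "(f has_derivative D) (at x) \<Longrightarrow> fderiv f x = D"
  using frechet_derivative_at by fastforce

lemma has_fderiv: "f differentiable (at x) \<Longrightarrow> (f has_derivative fderiv f x) (at x)"
  by (simp add: frechet_derivative_works)

lemma linear_fderiv: "f differentiable (at x) \<Longrightarrow> linear (fderiv f x)"
  by (rule linear_frechet_derivative)

text \<open>On an open set the functions agree near each point, and a derivative at a point sees no
  more than that; so the hypothesis is inherited by the derivatives in the induction.\<close>

lemma Ck_on_cong:
  assumes "open S" "\<And>x. x \<in> S \<Longrightarrow> f x = g x"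
  shows "Ck_on k f S \<longleftrightarrow> Ck_on k g S"
  using assms(2)
proof (induction k arbitrary: f g)
  case 0
  then show ?case by (simp cong: continuous_on_cong)
next
  case (Suc k)
  have "Ck_on k (\<lambda>x. fderiv f x v) S \<longleftrightarrow> Ck_on k (\<lambda>x. fderiv g x v) S" for v
    by (rule Suc.IH) (metis Suc.prems assms(1) fderiv_cong_open)
  moreover have "f differentiable (at x) \<longleftrightarrow> g differentiable (at x)" if "x \<in> S" for x
    by (rule differentiable_cong_open[OF assms(1) that]) (use Suc.prems in auto)
  ultimately show ?case by simp
qed

lemma Ck_on_subset: "Ck_on k f S \<Longrightarrow> T \<subseteq> S \<Longrightarrow> Ck_on k f T"
  by (induction k arbitrary: f) (auto intro: continuous_on_subset)

lemma Ck_on_local: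
  assumes "\<And>x. x \<in> S \<Longrightarrow> \<exists>T. open T \<and> x \<in> T \<and> Ck_on k f T"
  shows "Ck_on k f S"
  using assms
proof (induction k arbitrary: f)
  case 0
  have "continuous (at x within S) f" if "x \<in> S" for x
  proof -
    obtain T where "open T" "x \<in> T" "continuous_on T f" using 0[OF \<open>x \<in> S\<close>] by auto
    then have "continuous (at x) f" by (simp add: continuous_on_eq_continuous_at)
    then show ?thesis by (rule continuous_at_imp_continuous_within)
  qed
  then show ?case by (simp add: continuous_on_eq_continuous_within)
next
  case (Suc k)
  have "Ck_on k (\<lambda>x. fderiv f x v) S" for v
  proof (rule Suc.IH)
    show "\<exists>T. open T \<and> x \<in> T \<and> Ck_on k (\<lambda>x. fderiv f x v) T" if "x \<in> S" for x
      using Suc.prems[OF that] by auto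
  qed
  moreover have "f differentiable (at x)" if "x \<in> S" for x
    using Suc.prems[OF that] by auto
  ultimately show ?case by simp
qed

lemma Ck_on_SucD: "Ck_on (Suc k) f S \<Longrightarrow> Ck_on k f S"
proof (induction k arbitrary: f)
  case 0
  then show ?case
    by (auto simp: differentiable_at_withinI intro!: differentiable_imp_continuous_on
        differentiable_at_imp_differentiable_on)
next
  case (Suc k)
  have "Ck_on k (\<lambda>x. fderiv f x v) S" for v
    by (rule Suc.IH) (use Suc.prems Ck_on.simps(2)[of "Suc k" f S] in blast)
  moreover have "f differentiable (at x)" if "x \<in> S" for x
    using Suc.prems that by simp
  ultimately show ?case by simp
qed

lemma Ck_on_const: "Ck_on k (\<lambda>x. c) S"
  by (induction k arbitrary: c) (auto simp: frechet_derivative_const)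

lemma Ck_on_bounded_linear: "bounded_linear L \<Longrightarrow> Ck_on k L S"
proof (cases k)
  case (Suc j)
  assume L: "bounded_linear L"
  have "fderiv L x = L" for x
    by (rule fderiv_eqI) (rule bounded_linear_imp_has_derivative[OF L])
  then show ?thesis using Suc by (auto simp: L Ck_on_const bounded_linear_imp_differentiable)
qed (auto simp: linear_continuous_on)

lemma Ck_on_add:
  assumes "open S" "Ck_on k f S" "Ck_on k g S"
  shows "Ck_on k (\<lambda>x. f x + g x) S"
  using assms(2,3)
proof (induction k arbitrary: f g)
  case (Suc k)
  have D: "((\<lambda>x. f x + g x) has_derivative (\<lambda>v. fderiv f x v + fderiv g x v)) (at x)"
    if "x \<in> S" for x
    using Suc.prems that by (intro has_derivative_add has_fderiv) auto
  have "Ck_on k (\<lambda>x. fderiv (\<lambda>x. f x + g x) x v) S" for v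
  proof -
    have "Ck_on k (\<lambda>x. fderiv f x v + fderiv g x v) S"
      using Suc by auto
    then show ?thesis
      by (rule Ck_on_cong[THEN iffD1, OF assms(1), rotated]) (simp add: fderiv_eqI[OF D])
  qed
  then show ?case using D by (auto simp: differentiable_def)
qed (auto intro: continuous_on_add)

lemma Ck_on_sum:
  assumes "open S" "\<And>i. i \<in> I \<Longrightarrow> Ck_on k (f i) S"
  shows "Ck_on k (\<lambda>x. \<Sum>i\<in>I. f i x) S"
  using assms(2) by (induction I rule: infinite_finite_induct) (auto intro: Ck_on_const Ck_on_add assms(1))

lemma Ck_on_bilinear:
  assumes "bounded_bilinear B" "open S" "Ck_on k f S" "Ck_on k g S"
  shows "Ck_on k (\<lambda>x. B (f x) (g x)) S"
  using assms(3,4)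
proof (induction k arbitrary: f g)
  case 0
  then show ?case using bounded_bilinear.continuous_on[OF assms(1)] by auto
next
  case (Suc k)
  have D: "((\<lambda>x. B (f x) (g x)) has_derivative
      (\<lambda>v. B (f x) (fderiv g x v) + B (fderiv f x v) (g x))) (at x)" if "x \<in> S" for x
    using Suc.prems that by (intro bounded_bilinear.FDERIV[OF assms(1)] has_fderiv) auto
  have "Ck_on k (\<lambda>x. fderiv (\<lambda>x. B (f x) (g x)) x v) S" for v
  proof -
    have "Ck_on k (\<lambda>x. B (f x) (fderiv g x v) + B (fderiv f x v) (g x)) S"
      using Suc.prems Ck_on_SucD[OF Suc.prems(1)] Ck_on_SucD[OF Suc.prems(2)]
      by (intro Ck_on_add Suc.IH assms(2)) auto
    then show ?thesis
      by (rule Ck_on_cong[THEN iffD1, OF assms(2), rotated]) (simp add: fderiv_eqI[OF D])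
  qed
  then show ?case using D by (auto simp: differentiable_def)
qed

text \<open>\<open>Ck_on\<close> differentiates in fixed directions only, while the chain rule
  applies the derivative of \<open>g\<close> to a direction that varies with \<open>x\<close>.
  Expanding that direction in the basis leaves products of scalar functions with derivatives of
  \<open>g\<close> in fixed directions.\<close>

lemma fderiv_compose_Basis:
  fixes f :: "'a::real_normed_vector \<Rightarrow> 'b::euclidean_space"
  assumes "f differentiable (at x)" "g differentiable (at (f x))"
  shows "fderiv (\<lambda>x. g (f x)) x v = (\<Sum>b\<in>Basis. (fderiv f x v \<bullet> b) *\<^sub>R fderiv g (f x) b)"
proof -
  interpret linear "fderiv g (f x)" by (rule linear_fderiv[OF assms(2)])
  have "fderiv (\<lambda>x. g (f x)) x v = fderiv g (f x) (fderiv f x v)"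
    using frechet_derivative_compose[OF assms] by (simp add: o_def)
  also have "fderiv f x v = (\<Sum>b\<in>Basis. (fderiv f x v \<bullet> b) *\<^sub>R b)"
    by (simp add: euclidean_representation)
  finally show ?thesis by (simp add: sum scale)
qed

text \<open>The induction keeps \<open>f\<close> and generalises over \<open>g\<close>: after the
  basis expansion of the chain rule, the only composites left are those of \<open>f\<close> with
  directional derivatives of \<open>g\<close>, of one order less.\<close>

lemma Ck_on_compose:
  fixes f :: "'a::euclidean_space \<Rightarrow> 'b::euclidean_space" and g :: "'b \<Rightarrow> 'c::euclidean_space"
  assumes "open S" "open T" "f ` S \<subseteq> T" "Ck_on k f S" "Ck_on k g T"
  shows "Ck_on k (\<lambda>x. g (f x)) S"
  using assms(4,5)
proof (induction k arbitrary: g)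
  case 0
  then show ?case using assms(3) by (auto intro: continuous_on_compose2)
next
  case (Suc k)
  have "Ck_on k (\<lambda>x. fderiv (\<lambda>x. g (f x)) x v) S" for v
  proof -
    have "Ck_on k (\<lambda>x. \<Sum>b\<in>Basis. (fderiv f x v \<bullet> b) *\<^sub>R fderiv g (f x) b) S"
    proof (intro Ck_on_sum Ck_on_bilinear[OF bounded_bilinear_scaleR] assms(1))
      fix b :: 'b
      show "Ck_on k (\<lambda>x. fderiv f x v \<bullet> b) S"
        using Suc.prems by (intro Ck_on_bilinear[OF bounded_bilinear_inner] assms(1) Ck_on_const) auto
      show "Ck_on k (\<lambda>x. fderiv g (f x) b) S"
        using Suc.prems Ck_on_SucD[OF Suc.prems(1)] by (intro Suc.IH) auto
    qed
    then show ?thesis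
      by (rule Ck_on_cong[THEN iffD1, OF assms(1), rotated])
        (use Suc.prems assms(3) in \<open>auto simp: fderiv_compose_Basis\<close>)
  qed
  moreover have "(\<lambda>x. g (f x)) differentiable (at x)" if "x \<in> S" for x
    using differentiable_chain_at[of f x g] Suc.prems assms(3) that by (auto simp: o_def)
  ultimately show ?case by auto
qed

text \<open>The derivative of 1/f involves only 1/f itself and the derivative of f, so the induction
  needs no other quotient.\<close>

lemma Ck_on_inverse:
  fixes f :: "'a::real_normed_vector \<Rightarrow> real"
  assumes "open S" "\<And>x. x \<in> S \<Longrightarrow> f x \<noteq> 0" "Ck_on k f S"
  shows "Ck_on k (\<lambda>x. inverse (f x)) S"
  using assms(3)
proof (induction k)
  case 0
  then show ?case using assms(2) by (auto intro: continuous_on_inverse)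
next
  case (Suc k)
  have D: "((\<lambda>x. inverse (f x)) has_derivative
      (\<lambda>v. - (inverse (f x) * fderiv f x v * inverse (f x)))) (at x)" if "x \<in> S" for x
    using Suc.prems that assms(2) by (intro Deriv.has_derivative_inverse has_fderiv) auto
  have I: "Ck_on k (\<lambda>x. inverse (f x)) S"
    using Suc Ck_on_SucD by blast
  have "Ck_on k (\<lambda>x. fderiv (\<lambda>x. inverse (f x)) x v) S" for v
  proof -
    have "Ck_on k (\<lambda>x. (-1) * (inverse (f x) * fderiv f x v * inverse (f x))) S"
      using Suc.prems
      by (intro Ck_on_bilinear[OF bounded_bilinear_mult] assms(1) I Ck_on_const) auto
    then show ?thesis
      by (rule Ck_on_cong[THEN iffD1, OF assms(1), rotated]) (simp add: fderiv_eqI[OF D])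
  qed
  then show ?case using D by (auto simp: differentiable_def)
qed

section \<open>Symmetry of second derivatives\<close>

lemma second_difference:
  fixes f :: "'a::real_normed_vector \<Rightarrow> real"
  assumes "0 < t" and sub: "\<And>s r. 0 \<le> s \<Longrightarrow> s \<le> t \<Longrightarrow> 0 \<le> r \<Longrightarrow> r \<le> t \<Longrightarrow> x + s *\<^sub>R u + r *\<^sub>R v \<in> S"
    and f: "\<And>y. y \<in> S \<Longrightarrow> f differentiable (at y)"
    and fu: "\<And>y. y \<in> S \<Longrightarrow> (\<lambda>y. fderiv f y u) differentiable (at y)"
  shows "\<exists>s r. 0 < s \<and> s < t \<and> 0 < r \<and> r < t \<and>
    f (x + t *\<^sub>R u + t *\<^sub>R v) - f (x + t *\<^sub>R u) - f (x + t *\<^sub>R v) + f x =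
    t * t * fderiv (\<lambda>y. fderiv f y u) (x + s *\<^sub>R u + r *\<^sub>R v) v"
proof -
  have D1: "((\<lambda>s. f (x + s *\<^sub>R u + r *\<^sub>R v)) has_derivative (\<lambda>h. h * fderiv f (x + s *\<^sub>R u + r *\<^sub>R v) u)) (at s)"
    if "0 \<le> s" "s \<le> t" "0 \<le> r" "r \<le> t" for s r
  proof -
    have "((\<lambda>s. x + s *\<^sub>R u + r *\<^sub>R v) has_derivative (\<lambda>h. h *\<^sub>R u)) (at s)"
      by (auto intro!: derivative_eq_intros)
    from diff_chain_at[OF this, of f, OF has_fderiv[OF f[OF sub[OF that]]]]
    show ?thesis
      using linear_scale[OF linear_fderiv[OF f[OF sub[OF that]]]] by (simp add: o_def)
  qed
  have D2: "((\<lambda>r. fderiv f (x + s *\<^sub>R u + r *\<^sub>R v) u) has_derivative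
      (\<lambda>h. h * fderiv (\<lambda>y. fderiv f y u) (x + s *\<^sub>R u + r *\<^sub>R v) v)) (at r)"
    if "0 \<le> s" "s \<le> t" "0 \<le> r" "r \<le> t" for s r
  proof -
    have "((\<lambda>r. x + s *\<^sub>R u + r *\<^sub>R v) has_derivative (\<lambda>h. h *\<^sub>R v)) (at r)"
      by (auto intro!: derivative_eq_intros)
    from diff_chain_at[OF this, of "\<lambda>y. fderiv f y u", OF has_fderiv[OF fu[OF sub[OF that]]]]
    show ?thesis
      using linear_scale[OF linear_fderiv[OF fu[OF sub[OF that]]]] by (simp add: o_def)
  qed
  \<comment> \<open>The increment in direction \<open>v\<close>, as a function of the position along
    \<open>u\<close>: \<open>G t - G 0\<close> is the second difference. The mean value theorem in
    \<open>s\<close>, then in \<open>r\<close>, turns it into the mixed derivative. The term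
    \<open>0 *\<^sub>R v\<close> puts both summands in the shape of \<open>D1\<close>.\<close>
  define G where "G s = f (x + s *\<^sub>R u + t *\<^sub>R v) - f (x + s *\<^sub>R u + 0 *\<^sub>R v)" for s
  have "(G has_derivative (\<lambda>h. h * fderiv f (x + s *\<^sub>R u + t *\<^sub>R v) u
      - h * fderiv f (x + s *\<^sub>R u + 0 *\<^sub>R v) u)) (at s within {0..t})" if "s \<in> {0..t}" for s
    unfolding G_def
    by (rule has_derivative_at_withinI, rule has_derivative_diff; rule D1)
      (use that assms(1) in simp_all)
  from mvt_simple[OF assms(1) this] obtain s where s: "0 < s" "s < t"
    and 1: "G t - G 0 = t * (fderiv f (x + s *\<^sub>R u + t *\<^sub>R v) u - fderiv f (x + s *\<^sub>R u + 0 *\<^sub>R v) u)"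
    by (auto simp: right_diff_distrib)
  have "((\<lambda>r. fderiv f (x + s *\<^sub>R u + r *\<^sub>R v) u) has_derivative
      (\<lambda>h. h * fderiv (\<lambda>y. fderiv f y u) (x + s *\<^sub>R u + r *\<^sub>R v) v)) (at r within {0..t})"
    if "r \<in> {0..t}" for r
    by (rule has_derivative_at_withinI, rule D2) (use that s in simp_all)
  from mvt_simple[OF assms(1) this] obtain r where "0 < r" "r < t" and
    2: "fderiv f (x + s *\<^sub>R u + t *\<^sub>R v) u - fderiv f (x + s *\<^sub>R u + 0 *\<^sub>R v) u =
      t * fderiv (\<lambda>y. fderiv f y u) (x + s *\<^sub>R u + r *\<^sub>R v) v" by auto
  with 1 s show ?thesis by (intro exI[of _ s] exI[of _ r]) (simp add: G_def)
qed

text \<open>The second difference is symmetric in \<open>u\<close> and \<open>v\<close>, so the two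
  mixed derivatives take a common value at points arbitrarily close to \<open>x\<close>. By
  continuity they cannot differ at \<open>x\<close>.\<close>

lemma second_derivative_symmetric_real:
  fixes f :: "'a::real_normed_vector \<Rightarrow> real"
  assumes "open S" "x \<in> S" "Ck_on 2 f S"
  shows "fderiv (\<lambda>y. fderiv f y u) x v = fderiv (\<lambda>y. fderiv f y v) x u"
proof (rule ccontr)
  define p where "p y = fderiv (\<lambda>y. fderiv f y u) y v" for y
  define q where "q y = fderiv (\<lambda>y. fderiv f y v) y u" for y
  assume "\<not> ?thesis"
  then have e: "dist (p x) (q x) / 2 > 0" by (simp add: p_def q_def)
  have C: "f differentiable (at y)" "(\<lambda>y. fderiv f y w) differentiable (at y)" if "y \<in> S" for y w
    using assms(3) that by (auto simp: numeral_2_eq_2)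
  have "continuous_on S p" "continuous_on S q"
    using assms(3) by (auto simp: numeral_2_eq_2 p_def q_def)
  then have "continuous (at x) p" "continuous (at x) q"
    using assms by (auto simp: continuous_on_eq_continuous_at)
  then have c: "\<exists>d>0. \<forall>y. dist y x < d \<longrightarrow> dist (h y) (h x) < dist (p x) (q x) / 2"
    if "h = p \<or> h = q" for h
    using e that unfolding continuous_at_eps_delta by blast
  obtain d1 where "d1 > 0" and d1: "\<And>y. dist y x < d1 \<Longrightarrow> dist (p y) (p x) < dist (p x) (q x) / 2"
    using c[of p] by blast
  obtain d2 where "d2 > 0" and d2: "\<And>y. dist y x < d2 \<Longrightarrow> dist (q y) (q x) < dist (p x) (q x) / 2"
    using c[of q] by blast
  obtain d3 where "d3 > 0" and d3: "\<And>y. dist y x < d3 \<Longrightarrow> y \<in> S"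
    using assms(1,2) by (meson open_dist)
  define d where "d = min d1 (min d2 d3)"
  have d: "d > 0" using \<open>d1 > 0\<close> \<open>d2 > 0\<close> \<open>d3 > 0\<close> by (simp add: d_def)
  \<comment> \<open>Small enough for the whole parallelogram spanned by \<open>t *\<^sub>R u\<close>
    and \<open>t *\<^sub>R v\<close> at \<open>x\<close> to stay within distance \<open>d\<close>;
    the summand 1 covers u = v = 0.\<close>
  define t where "t = d / (norm u + norm v + 1)"
  have nz: "norm u + norm v + 1 > 0" by (simp add: add_nonneg_pos)
  have t: "t > 0" using d nz by (simp add: t_def)
  have near: "dist (x + s *\<^sub>R u + r *\<^sub>R v) x < d" if "0 \<le> s" "s \<le> t" "0 \<le> r" "r \<le> t" for s r
  proof -
    have "dist (x + s *\<^sub>R u + r *\<^sub>R v) x \<le> s * norm u + r * norm v"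
      using that norm_triangle_ineq[of "s *\<^sub>R u" "r *\<^sub>R v"] by (simp add: dist_norm add.assoc)
    also have "\<dots> \<le> t * norm u + t * norm v"
      using that by (intro add_mono mult_right_mono) auto
    also have "\<dots> < t * (norm u + norm v + 1)" using t by (simp add: algebra_simps)
    also have "\<dots> = d" using nz by (simp add: t_def)
    finally show ?thesis .
  qed
  obtain s r where sr: "0 < s" "s < t" "0 < r" "r < t"
    and 1: "f (x + t *\<^sub>R u + t *\<^sub>R v) - f (x + t *\<^sub>R u) - f (x + t *\<^sub>R v) + f x
      = t * t * p (x + s *\<^sub>R u + r *\<^sub>R v)"
    unfolding p_def using second_difference[OF t, of x u v S f] near d3 C d_def by auto
  have near': "dist (x + s *\<^sub>R v + r *\<^sub>R u) x < d" if "0 \<le> s" "s \<le> t" "0 \<le> r" "r \<le> t" for s r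
    using near[of r s] that by (simp add: algebra_simps)
  obtain s' r' where sr': "0 < s'" "s' < t" "0 < r'" "r' < t"
    and 2: "f (x + t *\<^sub>R v + t *\<^sub>R u) - f (x + t *\<^sub>R v) - f (x + t *\<^sub>R u) + f x
      = t * t * q (x + s' *\<^sub>R v + r' *\<^sub>R u)"
    unfolding q_def using second_difference[OF t, of x v u S f] near' d3 C d_def by auto
  have "p (x + s *\<^sub>R u + r *\<^sub>R v) = q (x + s' *\<^sub>R v + r' *\<^sub>R u)"
    using 1 2 t by (simp add: algebra_simps)
  moreover have "dist (p (x + s *\<^sub>R u + r *\<^sub>R v)) (p x) < dist (p x) (q x) / 2"
    using near[of s r] sr d1 d_def by auto
  moreover have "dist (q (x + s' *\<^sub>R v + r' *\<^sub>R u)) (q x) < dist (p x) (q x) / 2"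
    using near'[of s' r'] sr' d2 d_def by auto
  ultimately show False by (smt (verit) dist_triangle_half_l dist_commute)
qed

lemma second_derivative_symmetric:
  fixes f :: "'a::euclidean_space \<Rightarrow> 'b::euclidean_space"
  assumes "open S" "x \<in> S" "Ck_on 2 f S"
  shows "fderiv (\<lambda>y. fderiv f y u) x v = fderiv (\<lambda>y. fderiv f y v) x u"
proof (rule euclidean_eqI)
  fix b :: 'b
  have C: "f differentiable (at y)" "(\<lambda>y. fderiv f y w) differentiable (at y)" if "y \<in> S" for y w
    using assms(3) that by (auto simp: numeral_2_eq_2)
  have d: "fderiv (\<lambda>y. h y \<bullet> b) y w = fderiv h y w \<bullet> b" if "h differentiable (at y)"
    for h :: "'a \<Rightarrow> 'b" and y w
    by (subst fderiv_eqI[OF has_derivative_inner_left[OF has_fderiv[OF that]]]) simp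
  have "fderiv (\<lambda>y. fderiv f y u) x v \<bullet> b = fderiv (\<lambda>y. fderiv (\<lambda>y. f y \<bullet> b) y u) x v" for u v
  proof -
    have "fderiv (\<lambda>y. fderiv f y u) x v \<bullet> b = fderiv (\<lambda>y. fderiv f y u \<bullet> b) x v"
      by (rule d[symmetric]) (rule C[OF assms(2)])
    also have "fderiv (\<lambda>y. fderiv f y u \<bullet> b) x = fderiv (\<lambda>y. fderiv (\<lambda>y. f y \<bullet> b) y u) x"
      by (rule fderiv_cong_open[OF assms(1,2)]) (simp add: d C)
    finally show ?thesis .
  qed
  moreover have "Ck_on 2 (\<lambda>y. f y \<bullet> b) S"
    by (intro Ck_on_bilinear[OF bounded_bilinear_inner] assms Ck_on_const)
  ultimately show "fderiv (\<lambda>y. fderiv f y u) x v \<bullet> b = fderiv (\<lambda>y. fderiv f y v) x u \<bullet> b"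
    using second_derivative_symmetric_real[OF assms(1,2)] by metis
qed

lemma smooth_on_cong:
  assumes "open S" "\<And>x. x \<in> S \<Longrightarrow> f x = g x"
  shows "smooth_on S f \<longleftrightarrow> smooth_on S g"
  unfolding smooth_on_def using Ck_on_cong[OF assms] by simp

lemma smooth_on_subset: "smooth_on S f \<Longrightarrow> T \<subseteq> S \<Longrightarrow> smooth_on T f"
  unfolding smooth_on_def using Ck_on_subset by blast

lemma smooth_on_local:
  assumes "\<And>x. x \<in> S \<Longrightarrow> \<exists>T. open T \<and> x \<in> T \<and> smooth_on T f"
  shows "smooth_on S f"
  unfolding smooth_on_def by (intro allI Ck_on_local) (metis assms smooth_on_def)

lemma smooth_on_const: "smooth_on S (\<lambda>x. c)"
  by (simp add: smooth_on_def Ck_on_const)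

lemma smooth_on_add:
  "open S \<Longrightarrow> smooth_on S f \<Longrightarrow> smooth_on S g \<Longrightarrow> smooth_on S (\<lambda>x. f x + g x)"
  by (simp add: smooth_on_def Ck_on_add)

lemma smooth_on_bilinear:
  "bounded_bilinear B \<Longrightarrow> open S \<Longrightarrow> smooth_on S f \<Longrightarrow> smooth_on S g \<Longrightarrow> smooth_on S (\<lambda>x. B (f x) (g x))"
  by (simp add: smooth_on_def Ck_on_bilinear)

lemma smooth_on_compose:
  "open S \<Longrightarrow> open T \<Longrightarrow> f ` S \<subseteq> T \<Longrightarrow> smooth_on S f \<Longrightarrow> smooth_on T g \<Longrightarrow> smooth_on S (\<lambda>x. g (f x))"
  using Ck_on_compose unfolding smooth_on_def by blast

lemma smooth_on_inverse:
  fixes f :: "'a::euclidean_space \<Rightarrow> real"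
  shows "open S \<Longrightarrow> (\<And>x. x \<in> S \<Longrightarrow> f x \<noteq> 0) \<Longrightarrow> smooth_on S f \<Longrightarrow> smooth_on S (\<lambda>x. inverse (f x))"
  by (simp add: smooth_on_def Ck_on_inverse)

lemma smooth_on_differentiable: "smooth_on S f \<Longrightarrow> x \<in> S \<Longrightarrow> f differentiable (at x)"
  unfolding smooth_on_def by (metis Ck_on.simps(2))

lemma smooth_on_fderiv: "smooth_on S f \<Longrightarrow> smooth_on S (\<lambda>x. fderiv f x v)"
  unfolding smooth_on_def by (metis Ck_on.simps(2))

section \<open>A bump function\<close>

text \<open>The family is closed under differentiation up to linear combinations.\<close>

definition flat :: "nat \<Rightarrow> real \<Rightarrow> real" where
  "flat n t = (if t \<le> 0 then 0 else inverse t ^ n * exp (- inverse t))"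

text \<open>With x = 1/t the right-hand limit is that of x^n / exp x at infinity; to the left of 0
  the function is constantly 0.\<close>

lemma flat_tendsto_0: "(flat n \<longlongrightarrow> 0) (at 0)"
proof -
  have "((\<lambda>x. x ^ n / exp x) \<longlongrightarrow> 0) (at_top :: real filter)" by (rule tendsto_power_div_exp_0)
  then have "((\<lambda>t. inverse t ^ n / exp (inverse t)) \<longlongrightarrow> 0) (at_right (0::real))"
    by (rule filterlim_compose[OF _ filterlim_inverse_at_top_right])
  then have "(flat n \<longlongrightarrow> 0) (at_right 0)"
    by (rule Lim_transform_eventually)
      (auto simp: flat_def eventually_at_filter exp_minus divide_inverse)
  moreover have "(flat n \<longlongrightarrow> 0) (at_left 0)"
    by (rule Lim_transform_eventually[of "\<lambda>_. 0"]) (auto simp: flat_def eventually_at_filter)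
  ultimately show ?thesis by (simp add: filterlim_at_split)
qed

lemma flat_has_derivative:
  "(flat n has_derivative (\<lambda>h. h * (flat (n + 2) t - real n * flat (n + 1) t))) (at t)"
proof -
  consider "t < 0" | "t > 0" | "t = 0" by linarith
  then have "(flat n has_field_derivative flat (n + 2) t - real n * flat (n + 1) t) (at t)"
  proof cases
    case 1
    then have "((\<lambda>_. 0) has_field_derivative 0) (at t)" by simp
    then have "(flat n has_field_derivative 0) (at t)"
      by (rule DERIV_cong_ev[THEN iffD1, rotated 3])
         (use 1 in \<open>auto simp: flat_def eventually_nhds intro!: exI[of _ "{..<0}"]\<close>)
    with 1 show ?thesis by (simp add: flat_def)
  next
    case 2
    \<comment> \<open>The power rule yields the truncated exponent \<open>n - Suc 0\<close>; for n =
      0 the factor \<open>real n\<close> removes the term.\<close>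
    have *: "real n * (- (inverse t ^ Suc (Suc 0)) * inverse t ^ (n - Suc 0)) = - real n * inverse t ^ (n + 1)"
      by (cases n) (auto simp: algebra_simps)
    have "((\<lambda>t. inverse t ^ n * exp (- inverse t)) has_field_derivative
      flat (n + 2) t - real n * flat (n + 1) t) (at t)"
            by (rule DERIV_cong[OF DERIV_mult[OF DERIV_power[OF DERIV_inverse]
              DERIV_fun_exp[OF DERIV_minus[OF DERIV_inverse]]]])
        (use 2 * in \<open>auto simp: flat_def algebra_simps\<close>)
    then show ?thesis
      by (rule DERIV_cong_ev[THEN iffD1, rotated 3])
         (use 2 in \<open>auto simp: flat_def eventually_nhds intro!: exI[of _ "{0<..}"]\<close>)
  next
    case 3
    \<comment> \<open>Away from 0 the difference quotient of \<open>flat n\<close> at 0 is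
      \<open>flat (n + 1)\<close>, so the derivative at 0 exists and is 0.\<close>
    have "((\<lambda>h. flat (n + 1) h) \<longlongrightarrow> 0) (at 0)" by (rule flat_tendsto_0)
    then have "((\<lambda>h. (flat n (0 + h) - flat n 0) / h) \<longlongrightarrow> 0) (at 0)"
      by (rule Lim_transform_eventually) (auto simp: flat_def eventually_at_filter divide_inverse)
    with 3 show ?thesis by (simp add: DERIV_def flat_def)
  qed
  then show ?thesis unfolding has_field_derivative_def
    by (rule has_derivative_eq_rhs) (simp add: fun_eq_iff)
qed

lemma Ck_on_flat: "Ck_on k (flat n) UNIV"
proof (induction k arbitrary: n)
  case 0
  then show ?case
    by (auto intro!: continuous_at_imp_continuous_on has_derivative_continuous flat_has_derivative)
next
  case (Suc k)
  have "Ck_on k (\<lambda>t. v * (flat (n + 2) t + (- real n) * flat (n + 1) t)) UNIV" for v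
    by (intro Ck_on_bilinear[OF bounded_bilinear_mult] Ck_on_add Ck_on_const Suc open_UNIV)
  then show ?case
    using flat_has_derivative by (auto simp: fderiv_eqI[OF flat_has_derivative] differentiable_def)
qed

lemma smooth_bump:
  fixes x0 :: "'a::euclidean_space"
  assumes "r > 0"
  obtains \<psi> :: "'a \<Rightarrow> real" where "smooth_on UNIV \<psi>" "\<psi> x0 = 1" "\<And>x. x \<notin> ball x0 r \<Longrightarrow> \<psi> x = 0"
proof
  \<comment> \<open>The argument r^2 - |x - x0|^2 is positive exactly on the ball, and
    \<open>flat 0\<close> vanishes on nonpositive arguments. The first factor normalises the value
    at the centre to 1.\<close>
  define \<psi> where "\<psi> x = inverse (flat 0 (r * r)) * flat 0 (r * r + (-1) * ((x + - x0) \<bullet> (x + - x0)))" for x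
  have "Ck_on k (\<lambda>x. r * r + (-1) * ((x + - x0) \<bullet> (x + - x0))) UNIV" for k
    by (intro Ck_on_add Ck_on_const Ck_on_bilinear[OF bounded_bilinear_mult]
        Ck_on_bilinear[OF bounded_bilinear_inner] Ck_on_bounded_linear bounded_linear_ident open_UNIV)
  from Ck_on_compose[OF open_UNIV open_UNIV subset_UNIV this Ck_on_flat]
  have "Ck_on k \<psi> UNIV" for k
    unfolding \<psi>_def by (intro Ck_on_bilinear[OF bounded_bilinear_mult] Ck_on_const open_UNIV)
  then show "smooth_on UNIV \<psi>" by (simp add: smooth_on_def)
  have "0 < r * r" using assms by simp
  then show "\<psi> x0 = 1" by (simp add: \<psi>_def flat_def)
  show "\<psi> x = 0" if "x \<notin> ball x0 r" for x
  proof -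
    have "r \<le> norm (x - x0)" using that by (simp add: dist_norm norm_minus_commute)
    then have "r * r \<le> norm (x - x0) * norm (x - x0)" using assms by (intro mult_mono) auto
    then have "r * r \<le> (x - x0) \<bullet> (x - x0)" by (simp add: dot_square_norm power2_eq_square)
    then show ?thesis by (simp add: \<psi>_def flat_def)
  qed
qed

section \<open>Charts, smooth functions and directional derivatives\<close>

locale smooth_manifold =
  fixes A :: "('p::{t2_space,second_countable_topology}, 'e::euclidean_space) chart set"
  assumes atlas: "smooth_atlas A"
begin

lemma chart:
  assumes "\<kappa> \<in> A"
  shows open_chart: "open (fst \<kappa>)"
    and open_chart_range: "open (snd \<kappa> ` fst \<kappa>)"
    and homeo_chart: "homeomorphism (fst \<kappa>) (snd \<kappa> ` fst \<kappa>) (snd \<kappa>) (chart_inv \<kappa>)"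
  using atlas assms by (auto simp: smooth_atlas_def)

lemma open_chart_image:
  assumes "\<kappa> \<in> A" "open W" "W \<subseteq> fst \<kappa>"
  shows "open (snd \<kappa> ` W)"
proof -
  have "openin (top_of_set (fst \<kappa>)) W"
    using openin_open_Int[OF assms(2), of "fst \<kappa>"] assms(3) by (simp add: Int_absorb1)
  then show ?thesis
    using homeomorphism_imp_open_map[OF homeo_chart[OF assms(1)]] open_chart_range[OF assms(1)]
      openin_open_trans by blast
qed

lemma chart_inv_chart: "\<kappa> \<in> A \<Longrightarrow> p \<in> fst \<kappa> \<Longrightarrow> chart_inv \<kappa> (snd \<kappa> p) = p"
  by (rule homeomorphism_apply1[OF homeo_chart])

lemma chart_at:
  shows chart_at_in: "chart_at A p \<in> A" and in_chart_at: "p \<in> fst (chart_at A p)"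
proof -
  have "p \<in> (\<Union>(U, c)\<in>A. U)" using atlas by (simp add: smooth_atlas_def)
  then have "\<exists>\<kappa>. \<kappa> \<in> A \<and> p \<in> fst \<kappa>" by force
  then have "chart_at A p \<in> A \<and> p \<in> fst (chart_at A p)"
    unfolding chart_at_def by (rule someI_ex)
  then show "chart_at A p \<in> A" "p \<in> fst (chart_at A p)" by auto
qed

lemma smooth_transition:
  "\<kappa> \<in> A \<Longrightarrow> \<kappa>' \<in> A \<Longrightarrow> smooth_on (snd \<kappa> ` (fst \<kappa> \<inter> fst \<kappa>')) (\<lambda>x. snd \<kappa>' (chart_inv \<kappa> x))"
  using atlas unfolding smooth_atlas_def by (force simp: o_def)

lemma smooth_fun_iff:
  "smooth_fun A W f \<longleftrightarrow> (\<forall>\<kappa>\<in>A. smooth_on (snd \<kappa> ` (fst \<kappa> \<inter> W)) (\<lambda>x. f (chart_inv \<kappa> x)))"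
  unfolding smooth_fun_def by (auto simp: o_def)

lemma smooth_fun_subset: "smooth_fun A W f \<Longrightarrow> W' \<subseteq> W \<Longrightarrow> smooth_fun A W' f"
  unfolding smooth_fun_iff by (meson Int_mono image_mono order_refl smooth_on_subset)

lemma open_chart_image_Int: "\<kappa> \<in> A \<Longrightarrow> open W \<Longrightarrow> open (snd \<kappa> ` (fst \<kappa> \<inter> W))"
  by (simp add: open_chart open_Int open_chart_image)

lemma smooth_fun_cong:
  assumes "open W" "\<And>p. p \<in> W \<Longrightarrow> f p = g p"
  shows "smooth_fun A W f \<longleftrightarrow> smooth_fun A W g"
proof -
  have "smooth_on (snd \<kappa> ` (fst \<kappa> \<inter> W)) (\<lambda>x. f (chart_inv \<kappa> x)) \<longleftrightarrow>
      smooth_on (snd \<kappa> ` (fst \<kappa> \<inter> W)) (\<lambda>x. g (chart_inv \<kappa> x))" if "\<kappa> \<in> A" for \<kappa>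
    by (rule smooth_on_cong[OF open_chart_image_Int[OF that assms(1)]])
      (use that assms in \<open>auto simp: chart_inv_chart\<close>)
  then show ?thesis by (auto simp: smooth_fun_iff)
qed

lemma smooth_fun_local:
  assumes "\<And>p. p \<in> W \<Longrightarrow> \<exists>W'. open W' \<and> p \<in> W' \<and> smooth_fun A W' f"
  shows "smooth_fun A W f"
  unfolding smooth_fun_iff
proof (intro ballI smooth_on_local)
  fix \<kappa> x assume \<kappa>: "\<kappa> \<in> A" and "x \<in> snd \<kappa> ` (fst \<kappa> \<inter> W)"
  then obtain p where p: "p \<in> fst \<kappa>" "p \<in> W" "x = snd \<kappa> p" by auto
  then obtain W' where "open W'" "p \<in> W'" "smooth_fun A W' f" using assms by blast
  then show "\<exists>T. open T \<and> x \<in> T \<and> smooth_on T (\<lambda>x. f (chart_inv \<kappa> x))"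
    using p \<kappa> open_chart_image_Int by (intro exI[of _ "snd \<kappa> ` (fst \<kappa> \<inter> W')"]) (auto simp: smooth_fun_iff)
qed

text \<open>Inside one chart domain a single coordinate expression suffices: any other one differs
  from it by composition with a transition map.\<close>

lemma smooth_fun_chartI:
  assumes "\<kappa> \<in> A" "open W" "W \<subseteq> fst \<kappa>" "smooth_on (snd \<kappa> ` W) (\<lambda>x. f (chart_inv \<kappa> x))"
  shows "smooth_fun A W f"
  unfolding smooth_fun_iff
proof
  fix \<kappa>' assume \<kappa>': "\<kappa>' \<in> A"
  have o: "open (snd \<kappa>' ` (fst \<kappa>' \<inter> W))" by (rule open_chart_image_Int[OF \<kappa>' assms(2)])
  have s: "smooth_on (snd \<kappa>' ` (fst \<kappa>' \<inter> W)) (\<lambda>x. snd \<kappa> (chart_inv \<kappa>' x))"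
    using smooth_transition[OF \<kappa>' assms(1)] assms(3) by (elim smooth_on_subset) auto
  have "smooth_on (snd \<kappa>' ` (fst \<kappa>' \<inter> W)) (\<lambda>x. f (chart_inv \<kappa> (snd \<kappa> (chart_inv \<kappa>' x))))"
    by (rule smooth_on_compose[OF o open_chart_image[OF assms(1-3)] _ s assms(4)])
      (auto simp: chart_inv_chart \<kappa>')
  then show "smooth_on (snd \<kappa>' ` (fst \<kappa>' \<inter> W)) (\<lambda>x. f (chart_inv \<kappa>' x))"
    by (rule smooth_on_cong[OF o, THEN iffD1, rotated])
      (use assms \<kappa>' in \<open>auto simp: chart_inv_chart subset_iff\<close>)
qed

lemma smooth_fun_chart: "\<kappa> \<in> A \<Longrightarrow> smooth_fun A (fst \<kappa>) (snd \<kappa>)"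
  by (simp add: smooth_fun_iff smooth_transition)

lemma smooth_fun_const: "smooth_fun A W (\<lambda>p. c)"
  by (simp add: smooth_fun_iff smooth_on_const)

lemma smooth_fun_add:
  "open W \<Longrightarrow> smooth_fun A W f \<Longrightarrow> smooth_fun A W g \<Longrightarrow> smooth_fun A W (\<lambda>p. f p + g p)"
  by (simp add: smooth_fun_iff smooth_on_add open_chart_image_Int)

lemma smooth_fun_bilinear:
  assumes "bounded_bilinear B" "open W" "smooth_fun A W f" "smooth_fun A W g"
  shows "smooth_fun A W (\<lambda>p. B (f p) (g p))"
  unfolding smooth_fun_iff
proof
  fix \<kappa> assume "\<kappa> \<in> A"
  with assms show "smooth_on (snd \<kappa> ` (fst \<kappa> \<inter> W)) (\<lambda>x. B (f (chart_inv \<kappa> x)) (g (chart_inv \<kappa> x)))"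
    unfolding smooth_fun_iff
    by (intro smooth_on_bilinear[OF assms(1) open_chart_image_Int]) auto
qed

lemmas smooth_fun_mult = smooth_fun_bilinear[OF bounded_bilinear_mult]
lemmas smooth_fun_scaleR = smooth_fun_bilinear[OF bounded_bilinear_scaleR]
lemmas smooth_fun_inner = smooth_fun_bilinear[OF bounded_bilinear_inner]

lemma smooth_fun_sum:
  assumes "open W" "\<And>i. i \<in> I \<Longrightarrow> smooth_fun A W (f i)"
  shows "smooth_fun A W (\<lambda>p. \<Sum>i\<in>I. f i p)"
  using assms(2)
  by (induction I rule: infinite_finite_induct) (auto intro: smooth_fun_const smooth_fun_add assms(1))

lemma smooth_fun_inverse:
  fixes f :: "'p \<Rightarrow> real"
  assumes "open W" "\<And>p. p \<in> W \<Longrightarrow> f p \<noteq> 0" "smooth_fun A W f"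
  shows "smooth_fun A W (\<lambda>p. inverse (f p))"
  unfolding smooth_fun_iff
proof
  fix \<kappa> assume "\<kappa> \<in> A"
  with assms show "smooth_on (snd \<kappa> ` (fst \<kappa> \<inter> W)) (\<lambda>x. inverse (f (chart_inv \<kappa> x)))"
    by (intro smooth_on_inverse open_chart_image_Int) (auto simp: smooth_fun_iff chart_inv_chart)
qed

lemma differentiable_chart:
  assumes "open W" "p \<in> W" "smooth_fun A W f" "\<kappa> \<in> A" "p \<in> fst \<kappa>"
  shows "(\<lambda>x. f (chart_inv \<kappa> x)) differentiable (at (snd \<kappa> p))"
  by (rule smooth_on_differentiable[of "snd \<kappa> ` (fst \<kappa> \<inter> W)"]) (use assms in \<open>auto simp: smooth_fun_iff\<close>)

lemma fderiv_chart_cong: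
  assumes "open W" "p \<in> W" "\<And>q. q \<in> W \<Longrightarrow> f q = g q" "\<kappa> \<in> A" "p \<in> fst \<kappa>"
  shows "fderiv (\<lambda>x. f (chart_inv \<kappa> x)) (snd \<kappa> p) = fderiv (\<lambda>x. g (chart_inv \<kappa> x)) (snd \<kappa> p)"
  by (rule fderiv_cong_open[of "snd \<kappa> ` (fst \<kappa> \<inter> W)"])
    (use assms in \<open>auto simp: chart_inv_chart open_chart_image_Int\<close>)

lemma dir_deriv_eq:
  "dir_deriv A f p v = fderiv (\<lambda>x. f (chart_inv (chart_at A p) x)) (snd (chart_at A p) p) v"
  by (simp add: dir_deriv_def o_def)

lemma dir_deriv_cong:
  assumes "open W" "p \<in> W" "\<And>q. q \<in> W \<Longrightarrow> f q = g q"
  shows "dir_deriv A f p v = dir_deriv A g p v"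
  unfolding dir_deriv_eq by (subst fderiv_chart_cong[OF assms chart_at]) auto

lemma linear_dir_deriv:
  assumes "open W" "p \<in> W" "smooth_fun A W f"
  shows "linear (dir_deriv A f p)"
  using linear_fderiv[OF differentiable_chart[OF assms chart_at]]
  by (simp add: dir_deriv_def[abs_def] o_def)

lemma dir_deriv_const: "dir_deriv A (\<lambda>q. c) p v = 0"
  by (simp add: dir_deriv_eq)

lemma dir_deriv_add:
  assumes "open W" "p \<in> W" "smooth_fun A W f" "smooth_fun A W g"
  shows "dir_deriv A (\<lambda>q. f q + g q) p v = dir_deriv A f p v + dir_deriv A g p v"
  unfolding dir_deriv_eq
  by (subst fderiv_eqI[OF has_derivative_add[OF has_fderiv has_fderiv]])
    (auto intro!: differentiable_chart[OF assms(1,2)] assms chart_at)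

lemma dir_deriv_bilinear:
  assumes "bounded_bilinear B" "open W" "p \<in> W" "smooth_fun A W f" "smooth_fun A W g"
  shows "dir_deriv A (\<lambda>q. B (f q) (g q)) p v = B (f p) (dir_deriv A g p v) + B (dir_deriv A f p v) (g p)"
  unfolding dir_deriv_eq
  by (subst fderiv_eqI[OF bounded_bilinear.FDERIV[OF assms(1) has_fderiv has_fderiv]])
    (auto intro!: differentiable_chart[OF assms(2,3)] assms chart_at simp: chart_inv_chart chart_at)

lemmas dir_deriv_mult = dir_deriv_bilinear[OF bounded_bilinear_mult]
lemmas dir_deriv_inner = dir_deriv_bilinear[OF bounded_bilinear_inner]

lemma dir_deriv_sum:
  assumes "open W" "p \<in> W" "\<And>i. i \<in> I \<Longrightarrow> smooth_fun A W (f i)"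
  shows "dir_deriv A (\<lambda>q. \<Sum>i\<in>I. f i q) p v = (\<Sum>i\<in>I. dir_deriv A (f i) p v)"
  using assms(3)
  by (induction I rule: infinite_finite_induct)
    (auto simp: dir_deriv_const dir_deriv_add[OF assms(1,2)] smooth_fun_sum[OF assms(1)])

text \<open>The two transition maps compose to the identity near the point, so by the chain rule
  their derivatives are mutually inverse. This makes \<open>extension\<close> and
  \<open>comps\<close> inverse to each other.\<close>

lemma transition_inverse:
  assumes "\<kappa> \<in> A" "\<kappa>' \<in> A" "p \<in> fst \<kappa>" "p \<in> fst \<kappa>'"
  shows "fderiv (\<lambda>x. snd \<kappa>' (chart_inv \<kappa> x)) (snd \<kappa> p)
    (fderiv (\<lambda>x. snd \<kappa> (chart_inv \<kappa>' x)) (snd \<kappa>' p) v) = v"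
proof -
  let ?f = "\<lambda>x. snd \<kappa> (chart_inv \<kappa>' x)" and ?g = "\<lambda>x. snd \<kappa>' (chart_inv \<kappa> x)"
  have f: "?f differentiable (at (snd \<kappa>' p))"
    by (rule differentiable_chart[OF open_chart _ smooth_fun_chart]) (use assms in auto)
  have "?g differentiable (at (snd \<kappa> p))"
    by (rule differentiable_chart[OF open_chart _ smooth_fun_chart]) (use assms in auto)
  then have g: "?g differentiable (at (?f (snd \<kappa>' p)))" using assms by (simp add: chart_inv_chart)
  have "fderiv (?g \<circ> ?f) (snd \<kappa>' p) = fderiv ?g (?f (snd \<kappa>' p)) \<circ> fderiv ?f (snd \<kappa>' p)"
    by (rule frechet_derivative_compose[OF f g])
  moreover have "fderiv (?g \<circ> ?f) (snd \<kappa>' p) = fderiv (\<lambda>x. x) (snd \<kappa>' p)"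
    by (rule fderiv_cong_open[of "snd \<kappa>' ` (fst \<kappa>' \<inter> fst \<kappa>)"])
      (use assms in \<open>auto simp: chart_inv_chart open_chart_image_Int open_chart\<close>)
  ultimately show ?thesis using assms by (simp add: fun_eq_iff chart_inv_chart)
qed

lemma comps_eq: "comps A \<kappa> p v = fderiv (\<lambda>x. snd \<kappa> (chart_inv (chart_at A p) x)) (snd (chart_at A p) p) v"
  by (simp add: comps_def dir_deriv_eq)

lemma linear_comps: "\<kappa> \<in> A \<Longrightarrow> p \<in> fst \<kappa> \<Longrightarrow> linear (comps A \<kappa> p)"
  unfolding comps_def[abs_def] by (rule linear_dir_deriv[OF open_chart _ smooth_fun_chart])

lemma comps_chart_at [simp]: "comps A (chart_at A p) p v = v"
proof -
  have "fderiv (\<lambda>x. snd (chart_at A p) (chart_inv (chart_at A p) x)) (snd (chart_at A p) p) = fderiv (\<lambda>x. x) (snd (chart_at A p) p)"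
    by (rule fderiv_cong_open[of "snd (chart_at A p) ` fst (chart_at A p)"])
      (use chart_at in \<open>auto simp: chart_inv_chart open_chart_range\<close>)
  then show ?thesis by (simp add: comps_eq)
qed

lemma comps_extension: "q \<in> fst (chart_at A p) \<Longrightarrow> comps A (chart_at A p) q (extension A p v q) = v"
  using transition_inverse[OF chart_at_in chart_at_in in_chart_at, of q p v]
  by (simp add: comps_eq extension_def o_def)

lemma extension_comps: "q \<in> fst (chart_at A p) \<Longrightarrow> extension A p (comps A (chart_at A p) q v) q = v"
  using transition_inverse[OF chart_at_in chart_at_in _ in_chart_at, of q p v]
  by (simp add: comps_eq extension_def o_def)

lemma linear_extension: "q \<in> fst (chart_at A p) \<Longrightarrow> linear (\<lambda>v. extension A p v q)"
  unfolding extension_def o_def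
  by (intro linear_fderiv differentiable_chart[OF open_chart _ smooth_fun_chart] chart_at) auto

lemma extension_self [simp]: "extension A p v p = v"
  using extension_comps[OF in_chart_at, of p v] by simp

lemma smooth_fun_fderiv:
  assumes "\<kappa> \<in> A" "open W" "W \<subseteq> fst \<kappa>" "smooth_fun A W f"
  shows "smooth_fun A W (\<lambda>q. fderiv (\<lambda>x. f (chart_inv \<kappa> x)) (snd \<kappa> q) v)"
proof (rule smooth_fun_chartI[OF assms(1-3)])
  have "snd \<kappa> ` W = snd \<kappa> ` (fst \<kappa> \<inter> W)" using assms(3) by auto
  then have "smooth_on (snd \<kappa> ` W) (\<lambda>x. fderiv (\<lambda>x. f (chart_inv \<kappa> x)) x v)"
    using assms(1,4) by (auto simp: smooth_fun_iff intro: smooth_on_fderiv)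
  then show "smooth_on (snd \<kappa> ` W) (\<lambda>x. fderiv (\<lambda>x. f (chart_inv \<kappa> x)) (snd \<kappa> (chart_inv \<kappa> x)) v)"
    by (rule smooth_on_cong[THEN iffD1, rotated 2])
      (use assms in \<open>auto simp: open_chart_image chart_inv_chart subset_iff\<close>)
qed

end

section \<open>Smooth maps and sections along them\<close>

locale smooth_manifold_map = M: smooth_manifold A + N: smooth_manifold B
  for A :: "('p::{t2_space,second_countable_topology}, 'e::euclidean_space) chart set"
    and B :: "('q::{t2_space,second_countable_topology}, 'f::euclidean_space) chart set" +
  fixes F :: "'p \<Rightarrow> 'q"
  assumes smooth: "smooth_map A B F"
begin

lemma open_preimage: "open V \<Longrightarrow> open (F -` V)"
  using smooth by (simp add: smooth_map_def open_vimage)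

lemma smooth_chart_map: "\<kappa> \<in> B \<Longrightarrow> smooth_fun A (F -` fst \<kappa>) (\<lambda>p. snd \<kappa> (F p))"
  using smooth by (force simp: smooth_map_def o_def)

lemma smooth_fun_map:
  assumes "open V" "smooth_fun B V f"
  shows "smooth_fun A (F -` V) (\<lambda>p. f (F p))"
proof (rule M.smooth_fun_local)
  fix p assume p: "p \<in> F -` V"
  let ?\<kappa> = "chart_at A p" and ?\<mu> = "chart_at B (F p)"
  let ?W = "fst ?\<kappa> \<inter> F -` (V \<inter> fst ?\<mu>)"
  have W: "open ?W" using assms(1)
    by (intro open_Int M.open_chart M.chart_at open_preimage N.open_chart N.chart_at)
  have o: "open (snd ?\<kappa> ` ?W)" "open (snd ?\<mu> ` (fst ?\<mu> \<inter> V))"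
    by (rule M.open_chart_image[OF M.chart_at_in W], simp)
      (rule N.open_chart_image_Int[OF N.chart_at_in assms(1)])
  have "smooth_fun A (F -` fst ?\<mu>) (\<lambda>p. snd ?\<mu> (F p))" by (rule smooth_chart_map) (rule N.chart_at)
  then have 1: "smooth_on (snd ?\<kappa> ` ?W) (\<lambda>x. snd ?\<mu> (F (chart_inv ?\<kappa> x)))"
    unfolding M.smooth_fun_iff by (auto intro: smooth_on_subset M.chart_at)
  have 2: "smooth_on (snd ?\<mu> ` (fst ?\<mu> \<inter> V)) (\<lambda>y. f (chart_inv ?\<mu> y))"
    using assms(2) by (auto simp: N.smooth_fun_iff N.chart_at)
  have "smooth_on (snd ?\<kappa> ` ?W) (\<lambda>x. f (chart_inv ?\<mu> (snd ?\<mu> (F (chart_inv ?\<kappa> x)))))"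
    by (rule smooth_on_compose[OF o _ 1 2]) (auto simp: M.chart_inv_chart M.chart_at)
  then have "smooth_on (snd ?\<kappa> ` ?W) (\<lambda>x. f (F (chart_inv ?\<kappa> x)))"
    by (rule smooth_on_cong[THEN iffD1, rotated 2])
      (use o in \<open>auto simp: M.chart_inv_chart M.chart_at N.chart_inv_chart N.chart_at\<close>)
  then have "smooth_fun A ?W (\<lambda>p. f (F p))"
    by (intro M.smooth_fun_chartI[OF M.chart_at_in W]) auto
  then show "\<exists>W'. open W' \<and> p \<in> W' \<and> smooth_fun A W' (\<lambda>p. f (F p))"
    using W p by (intro exI[of _ ?W]) (auto simp: M.chart_at N.chart_at)
qed

text \<open>The intermediate chart of the target is left arbitrary. The chosen chart gives the rule
  for \<open>tangent_map\<close>; the identity map with another chart gives the change of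
  coordinates.\<close>

lemma dir_deriv_chain:
  assumes "\<kappa> \<in> B" "F p \<in> fst \<kappa>" "open V" "F p \<in> V" "smooth_fun B V f"
  shows "dir_deriv A (\<lambda>q. f (F q)) p v =
    fderiv (\<lambda>y. f (chart_inv \<kappa> y)) (snd \<kappa> (F p)) (dir_deriv A (\<lambda>q. snd \<kappa> (F q)) p v)"
proof -
  let ?\<kappa> = "chart_at A p"
  let ?h = "\<lambda>x. snd \<kappa> (F (chart_inv ?\<kappa> x))" and ?g = "\<lambda>y. f (chart_inv \<kappa> y)"
  have e: "?h (snd ?\<kappa> p) = snd \<kappa> (F p)" by (simp add: M.chart_inv_chart M.chart_at)
  have h: "?h differentiable (at (snd ?\<kappa> p))"
    by (rule M.differentiable_chart[OF open_preimage[OF N.open_chart[OF assms(1)]] _ smooth_chart_map])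
      (use assms in \<open>auto simp: M.chart_at\<close>)
  have g: "?g differentiable (at (?h (snd ?\<kappa> p)))"
    unfolding e by (rule N.differentiable_chart[OF assms(3-5,1,2)])
  have "fderiv (\<lambda>x. f (F (chart_inv ?\<kappa> x))) (snd ?\<kappa> p) = fderiv (?g \<circ> ?h) (snd ?\<kappa> p)"
    unfolding o_def
    by (rule M.fderiv_chart_cong[OF open_preimage[OF N.open_chart[OF assms(1)]]])
      (use assms in \<open>auto simp: M.chart_at N.chart_inv_chart\<close>)
  then show ?thesis
    using frechet_derivative_compose[OF h g] by (simp add: M.dir_deriv_eq e)
qed

lemma tangent_map_eq: "tangent_map A B F p v = dir_deriv A (\<lambda>q. snd (chart_at B (F p)) (F q)) p v"
  by (simp add: tangent_map_def o_def)

lemma dir_deriv_map: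
  assumes "open V" "F p \<in> V" "smooth_fun B V f"
  shows "dir_deriv A (\<lambda>q. f (F q)) p v = dir_deriv B f (F p) (tangent_map A B F p v)"
  by (simp add: dir_deriv_chain[OF N.chart_at assms] N.dir_deriv_eq tangent_map_eq)

lemma comps_tangent_map:
  "\<kappa> \<in> B \<Longrightarrow> F p \<in> fst \<kappa> \<Longrightarrow> comps B \<kappa> (F p) (tangent_map A B F p v) = dir_deriv A (\<lambda>q. snd \<kappa> (F q)) p v"
  by (simp add: comps_def dir_deriv_map[OF N.open_chart _ N.smooth_fun_chart])

lemma linear_tangent_map: "linear (tangent_map A B F p)"
  unfolding tangent_map_eq[abs_def]
  by (rule M.linear_dir_deriv[OF open_preimage[OF N.open_chart] _ smooth_chart_map])
    (auto simp: N.chart_at)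

section \<open>Smooth sections along a map\<close>

lemma smooth_section_iff:
  "smooth_section_along A B F W Y \<longleftrightarrow>
    (\<forall>\<kappa>\<in>B. smooth_fun A (W \<inter> F -` fst \<kappa>) (\<lambda>p. comps B \<kappa> (F p) (Y p)))"
  unfolding smooth_section_along_def by auto

lemma smooth_section_subset:
  "smooth_section_along A B F W Y \<Longrightarrow> W' \<subseteq> W \<Longrightarrow> smooth_section_along A B F W' Y"
  unfolding smooth_section_iff by (meson Int_mono M.smooth_fun_subset order_refl)

lemma smooth_section_local:
  assumes "\<And>p. p \<in> W \<Longrightarrow> \<exists>W'. open W' \<and> p \<in> W' \<and> smooth_section_along A B F W' Y"
  shows "smooth_section_along A B F W Y"
  unfolding smooth_section_iff
proof (intro ballI M.smooth_fun_local)
  fix \<kappa> p assume \<kappa>: "\<kappa> \<in> B" and p: "p \<in> W \<inter> F -` fst \<kappa>"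
  then obtain W' where "open W'" "p \<in> W'" "smooth_section_along A B F W' Y" using assms by blast
  with \<kappa> p show "\<exists>W'. open W' \<and> p \<in> W' \<and> smooth_fun A W' (\<lambda>p. comps B \<kappa> (F p) (Y p))"
    by (intro exI[of _ "W' \<inter> F -` fst \<kappa>"]) (auto simp: smooth_section_iff open_preimage N.open_chart)
qed

lemma smooth_section_cong:
  assumes "open W" "\<And>p. p \<in> W \<Longrightarrow> Y p = Z p"
  shows "smooth_section_along A B F W Y \<longleftrightarrow> smooth_section_along A B F W Z"
proof -
  have "smooth_fun A (W \<inter> F -` fst \<kappa>) (\<lambda>p. comps B \<kappa> (F p) (Y p)) \<longleftrightarrow>
      smooth_fun A (W \<inter> F -` fst \<kappa>) (\<lambda>p. comps B \<kappa> (F p) (Z p))" if "\<kappa> \<in> B" for \<kappa>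
    by (rule M.smooth_fun_cong) (use that assms in \<open>auto simp: open_Int open_preimage N.open_chart\<close>)
  then show ?thesis by (simp add: smooth_section_iff)
qed

text \<open>Components in another chart arise from those in \<kappa> by the Jacobian of the
  transition map, whose entries are smooth on the target and hence smooth after composition with
  \<open>F\<close>.\<close>

lemma smooth_section_chartI:
  assumes "\<kappa> \<in> B" "open W" "F ` W \<subseteq> fst \<kappa>" "smooth_fun A W (\<lambda>p. comps B \<kappa> (F p) (Y p))"
  shows "smooth_section_along A B F W Y"
  unfolding smooth_section_iff
proof
  fix \<kappa>' assume \<kappa>': "\<kappa>' \<in> B"
  let ?W = "W \<inter> F -` fst \<kappa>'"
  \<comment> \<open>The \<open>b\<close>-th column of the Jacobian of the transition from \<kappa>
    to \<kappa>'.\<close>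
  define D where "D b y = fderiv (\<lambda>x. snd \<kappa>' (chart_inv \<kappa> x)) (snd \<kappa> y) b" for b y
  have W: "open ?W" using assms \<kappa>' by (auto simp: open_preimage N.open_chart)
  have "smooth_fun B (fst \<kappa> \<inter> fst \<kappa>') (D b)" for b
    unfolding D_def using assms(1) \<kappa>'
    by (intro N.smooth_fun_fderiv N.smooth_fun_subset[OF N.smooth_fun_chart]) (auto simp: N.open_chart)
  then have "smooth_fun A (F -` (fst \<kappa> \<inter> fst \<kappa>')) (\<lambda>p. D b (F p))" for b
    by (rule smooth_fun_map[rotated]) (use assms(1) \<kappa>' in \<open>auto simp: N.open_chart\<close>)
  then have "smooth_fun A ?W (\<lambda>p. D b (F p))" for b
    by (rule M.smooth_fun_subset) (use assms(3) in auto)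
  moreover have "smooth_fun A ?W (\<lambda>p. comps B \<kappa> (F p) (Y p))"
    using assms(4) by (rule M.smooth_fun_subset) auto
  ultimately have "smooth_fun A ?W (\<lambda>p. \<Sum>b\<in>Basis. (comps B \<kappa> (F p) (Y p) \<bullet> b) *\<^sub>R D b (F p))"
    by (intro M.smooth_fun_sum M.smooth_fun_scaleR M.smooth_fun_inner M.smooth_fun_const W)
  then show "smooth_fun A ?W (\<lambda>p. comps B \<kappa>' (F p) (Y p))"
  proof (rule M.smooth_fun_cong[OF W, THEN iffD1, rotated])
    fix p assume p: "p \<in> ?W"
    let ?v = "comps B \<kappa> (F p) (Y p)" and ?\<mu> = "chart_at B (F p)"
    let ?f = "\<lambda>x. snd \<kappa> (chart_inv ?\<mu> x)" and ?g = "\<lambda>x. snd \<kappa>' (chart_inv \<kappa> x)"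
    have Fp: "F p \<in> fst \<kappa>" "F p \<in> fst \<kappa>'" using p assms(3) by auto
    have f: "?f differentiable (at (snd ?\<mu> (F p)))"
      by (rule N.differentiable_chart[OF N.open_chart[OF assms(1)] _ N.smooth_fun_chart])
        (use Fp assms(1) N.chart_at in auto)
    have g: "?g differentiable (at (snd \<kappa> (F p)))"
      by (rule N.differentiable_chart[OF N.open_chart[OF \<kappa>'] _ N.smooth_fun_chart])
        (use Fp assms(1) \<kappa>' in auto)
    interpret linear "fderiv ?g (snd \<kappa> (F p))" by (rule linear_fderiv[OF g])
    have "(\<Sum>b\<in>Basis. (?v \<bullet> b) *\<^sub>R D b (F p)) = fderiv ?g (snd \<kappa> (F p)) (\<Sum>b\<in>Basis. (?v \<bullet> b) *\<^sub>R b)"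
      by (simp add: D_def sum scale)
    also have "\<dots> = fderiv ?g (snd \<kappa> (F p)) ?v" by (simp add: euclidean_representation)
    also have "\<dots> = (fderiv ?g (?f (snd ?\<mu> (F p))) \<circ> fderiv ?f (snd ?\<mu> (F p))) (Y p)"
      by (simp add: N.comps_eq N.chart_inv_chart N.chart_at)
    also have "\<dots> = fderiv (?g \<circ> ?f) (snd ?\<mu> (F p)) (Y p)"
      using frechet_derivative_compose[OF f, of ?g] g by (simp add: N.chart_inv_chart N.chart_at)
    also have "fderiv (?g \<circ> ?f) (snd ?\<mu> (F p)) = fderiv (\<lambda>x. snd \<kappa>' (chart_inv ?\<mu> x)) (snd ?\<mu> (F p))"
      unfolding o_def
      by (rule N.fderiv_chart_cong[OF N.open_chart[OF assms(1)]])
        (use Fp assms(1) in \<open>auto simp: N.chart_at N.chart_inv_chart\<close>)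
    finally show "(\<Sum>b\<in>Basis. (?v \<bullet> b) *\<^sub>R D b (F p)) = comps B \<kappa>' (F p) (Y p)"
      by (simp add: N.comps_eq)
  qed
qed

lemma smooth_section_add:
  assumes "open W" "smooth_section_along A B F W Y" "smooth_section_along A B F W Z"
  shows "smooth_section_along A B F W (\<lambda>p. Y p + Z p)"
  unfolding smooth_section_iff
proof
  fix \<kappa> assume \<kappa>: "\<kappa> \<in> B"
  have W: "open (W \<inter> F -` fst \<kappa>)" using assms(1) \<kappa> by (auto simp: open_preimage N.open_chart)
  have "smooth_fun A (W \<inter> F -` fst \<kappa>) (\<lambda>p. comps B \<kappa> (F p) (Y p) + comps B \<kappa> (F p) (Z p))"
    using assms \<kappa> by (intro M.smooth_fun_add W) (auto simp: smooth_section_iff)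
  then show "smooth_fun A (W \<inter> F -` fst \<kappa>) (\<lambda>p. comps B \<kappa> (F p) (Y p + Z p))"
    by (rule M.smooth_fun_cong[OF W, THEN iffD1, rotated]) (simp add: linear_add[OF N.linear_comps[OF \<kappa>]])
qed

lemma smooth_section_scaleR:
  assumes "open W" "smooth_fun A W f" "smooth_section_along A B F W Y"
  shows "smooth_section_along A B F W (\<lambda>p. f p *\<^sub>R Y p)"
  unfolding smooth_section_iff
proof
  fix \<kappa> assume \<kappa>: "\<kappa> \<in> B"
  have W: "open (W \<inter> F -` fst \<kappa>)" using assms(1) \<kappa> by (auto simp: open_preimage N.open_chart)
  have "smooth_fun A (W \<inter> F -` fst \<kappa>) (\<lambda>p. f p *\<^sub>R comps B \<kappa> (F p) (Y p))"
    using assms \<kappa> M.smooth_fun_subset[OF assms(2)]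
    by (intro M.smooth_fun_scaleR W) (auto simp: smooth_section_iff)
  then show "smooth_fun A (W \<inter> F -` fst \<kappa>) (\<lambda>p. comps B \<kappa> (F p) (f p *\<^sub>R Y p))"
    by (rule M.smooth_fun_cong[OF W, THEN iffD1, rotated]) (simp add: linear_scale[OF N.linear_comps[OF \<kappa>]])
qed

lemma smooth_section_zero: "open W \<Longrightarrow> smooth_section_along A B F W (\<lambda>p. 0)"
  unfolding smooth_section_iff
proof
  fix \<kappa> assume \<kappa>: "\<kappa> \<in> B" and "open W"
  then have W: "open (W \<inter> F -` fst \<kappa>)" by (auto simp: open_preimage N.open_chart)
  show "smooth_fun A (W \<inter> F -` fst \<kappa>) (\<lambda>p. comps B \<kappa> (F p) 0)"
    by (rule M.smooth_fun_cong[OF W, THEN iffD1, rotated, OF M.smooth_fun_const[of _ 0]])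
      (simp add: linear_0[OF N.linear_comps[OF \<kappa>]])
qed

lemma smooth_section_sum:
  assumes "open W" "\<And>i. i \<in> I \<Longrightarrow> smooth_section_along A B F W (Y i)"
  shows "smooth_section_along A B F W (\<lambda>p. \<Sum>i\<in>I. Y i p)"
  using assms(2)
  by (induction I rule: infinite_finite_induct) (auto intro: smooth_section_zero smooth_section_add assms(1))

end

context smooth_manifold
begin

text \<open>Vector fields are sections along the identity, so this instance transfers all facts on
  sections to them.\<close>

lemma smooth_map_id: "smooth_map A A (\<lambda>p. p)"
  unfolding smooth_map_def using smooth_fun_chart by (force simp: o_def)

interpretation self: smooth_manifold_map A A "\<lambda>p. p"
  by unfold_locales (rule smooth_map_id)

lemma dir_deriv_comps:
  assumes "\<kappa> \<in> A" "p \<in> fst \<kappa>" "open W" "p \<in> W" "smooth_fun A W f"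
  shows "dir_deriv A f p v = fderiv (\<lambda>y. f (chart_inv \<kappa> y)) (snd \<kappa> p) (comps A \<kappa> p v)"
  using self.dir_deriv_chain[OF assms] by (simp add: comps_def)

lemma smooth_field_iff:
  "smooth_field A W X \<longleftrightarrow> (\<forall>\<kappa>\<in>A. smooth_fun A (W \<inter> fst \<kappa>) (\<lambda>p. comps A \<kappa> p (X p)))"
  using self.smooth_section_iff by (simp add: smooth_field_def)

lemma smooth_field_subset: "smooth_field A W X \<Longrightarrow> W' \<subseteq> W \<Longrightarrow> smooth_field A W' X"
  unfolding smooth_field_def by (rule self.smooth_section_subset)

lemma smooth_field_local:
  "(\<And>p. p \<in> W \<Longrightarrow> \<exists>W'. open W' \<and> p \<in> W' \<and> smooth_field A W' X) \<Longrightarrow> smooth_field A W X"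
  unfolding smooth_field_def by (rule self.smooth_section_local)

lemma smooth_field_cong:
  "open W \<Longrightarrow> (\<And>p. p \<in> W \<Longrightarrow> X p = Y p) \<Longrightarrow> smooth_field A W X \<longleftrightarrow> smooth_field A W Y"
  unfolding smooth_field_def by (rule self.smooth_section_cong)

lemma smooth_field_chartI:
  "\<kappa> \<in> A \<Longrightarrow> open W \<Longrightarrow> W \<subseteq> fst \<kappa> \<Longrightarrow> smooth_fun A W (\<lambda>p. comps A \<kappa> p (X p)) \<Longrightarrow> smooth_field A W X"
  unfolding smooth_field_def by (rule self.smooth_section_chartI) auto

lemma smooth_field_add:
  "open W \<Longrightarrow> smooth_field A W X \<Longrightarrow> smooth_field A W Y \<Longrightarrow> smooth_field A W (\<lambda>p. X p + Y p)"
  unfolding smooth_field_def by (rule self.smooth_section_add)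

lemma smooth_field_scaleR:
  "open W \<Longrightarrow> smooth_fun A W f \<Longrightarrow> smooth_field A W X \<Longrightarrow> smooth_field A W (\<lambda>p. f p *\<^sub>R X p)"
  unfolding smooth_field_def by (rule self.smooth_section_scaleR)

lemma smooth_field_zero: "open W \<Longrightarrow> smooth_field A W (\<lambda>p. 0)"
  unfolding smooth_field_def by (rule self.smooth_section_zero)

lemma smooth_field_sum:
  "open W \<Longrightarrow> (\<And>i. i \<in> I \<Longrightarrow> smooth_field A W (X i)) \<Longrightarrow> smooth_field A W (\<lambda>p. \<Sum>i\<in>I. X i p)"
  unfolding smooth_field_def by (rule self.smooth_section_sum)

lemma smooth_field_uminus: "open W \<Longrightarrow> smooth_field A W X \<Longrightarrow> smooth_field A W (\<lambda>p. - X p)"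
  using smooth_field_scaleR[OF _ smooth_fun_const, of W X "-1"] by simp

lemma smooth_field_diff:
  "open W \<Longrightarrow> smooth_field A W X \<Longrightarrow> smooth_field A W Y \<Longrightarrow> smooth_field A W (\<lambda>p. X p - Y p)"
  using smooth_field_add[OF _ _ smooth_field_uminus, of W X Y] by simp

lemma smooth_extension: "smooth_field A (fst (chart_at A p)) (extension A p v)"
proof (rule smooth_field_chartI[OF chart_at_in open_chart[OF chart_at_in] order_refl])
  show "smooth_fun A (fst (chart_at A p)) (\<lambda>q. comps A (chart_at A p) q (extension A p v q))"
    by (rule smooth_fun_cong[THEN iffD1, rotated 2, OF smooth_fun_const[of _ v]])
      (simp_all add: comps_extension open_chart chart_at)
qed

text \<open>In a chart the derivative is the sum of the components of X times the partial
  derivatives of f, a finite sum of products of smooth functions.\<close>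

lemma smooth_fun_dir_deriv:
  assumes W: "open W" and f: "smooth_fun A W f" and X: "smooth_field A W X"
  shows "smooth_fun A W (\<lambda>p. dir_deriv A f p (X p))"
proof (rule smooth_fun_local)
  fix p assume p: "p \<in> W"
  let ?\<kappa> = "chart_at A p"
  let ?W = "W \<inter> fst ?\<kappa>"
  have W': "open ?W" using W by (simp add: open_Int open_chart chart_at)
  have "smooth_fun A ?W (\<lambda>q. fderiv (\<lambda>x. f (chart_inv ?\<kappa> x)) (snd ?\<kappa> q) b)" for b
    by (rule smooth_fun_fderiv[OF chart_at_in W']) (use smooth_fun_subset[OF f] in auto)
  then have "smooth_fun A ?W (\<lambda>q. \<Sum>b\<in>Basis. (comps A ?\<kappa> q (X q) \<bullet> b) *\<^sub>R
      fderiv (\<lambda>x. f (chart_inv ?\<kappa> x)) (snd ?\<kappa> q) b)"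
    using X by (intro smooth_fun_sum smooth_fun_scaleR smooth_fun_inner smooth_fun_const W')
      (auto simp: smooth_field_iff chart_at)
  then have "smooth_fun A ?W (\<lambda>p. dir_deriv A f p (X p))"
  proof (rule smooth_fun_cong[OF W', THEN iffD1, rotated])
    fix q assume q: "q \<in> ?W"
    let ?L = "fderiv (\<lambda>x. f (chart_inv ?\<kappa> x)) (snd ?\<kappa> q)" and ?v = "comps A ?\<kappa> q (X q)"
    interpret linear ?L
      by (rule linear_fderiv differentiable_chart[OF W])+ (use q f chart_at in auto)
    have "(\<Sum>b\<in>Basis. (?v \<bullet> b) *\<^sub>R ?L b) = ?L (\<Sum>b\<in>Basis. (?v \<bullet> b) *\<^sub>R b)" by (simp add: sum scale)
    then show "(\<Sum>b\<in>Basis. (?v \<bullet> b) *\<^sub>R ?L b) = dir_deriv A f q (X q)"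
      using dir_deriv_comps[OF chart_at_in _ W _ f, of q p] q by (simp add: euclidean_representation)
  qed
  then show "\<exists>W'. open W' \<and> p \<in> W' \<and> smooth_fun A W' (\<lambda>p. dir_deriv A f p (X p))"
    using W' p chart_at by auto
qed

end

lemma (in smooth_manifold_map) smooth_tangent_map:
  assumes W: "open W" and X: "smooth_field A W X"
  shows "smooth_section_along A B F W (\<lambda>p. tangent_map A B F p (X p))"
  unfolding smooth_section_iff
proof
  fix \<kappa> assume \<kappa>: "\<kappa> \<in> B"
  have W': "open (W \<inter> F -` fst \<kappa>)" using W \<kappa> by (auto simp: open_preimage N.open_chart)
  have "smooth_fun A (W \<inter> F -` fst \<kappa>) (\<lambda>p. dir_deriv A (\<lambda>q. snd \<kappa> (F q)) p (X p))"
    using W' M.smooth_fun_subset[OF smooth_chart_map[OF \<kappa>]] M.smooth_field_subset[OF X]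
    by (intro M.smooth_fun_dir_deriv) auto
  then show "smooth_fun A (W \<inter> F -` fst \<kappa>) (\<lambda>p. comps B \<kappa> (F p) (tangent_map A B F p (X p)))"
    by (rule M.smooth_fun_cong[OF W', THEN iffD1, rotated]) (auto simp: comps_tangent_map[OF \<kappa>])
qed

context smooth_manifold
begin

text \<open>\<open>lie_bracket\<close> is computed in one chart; here it becomes the commutator of
  derivations. Both iterated derivatives contain the Hessian of f applied to X and Y, and these
  terms cancel by symmetry of second derivatives.\<close>

lemma dir_deriv_lie_bracket:
  fixes f :: "'p \<Rightarrow> 'b::euclidean_space"
  assumes W: "open W" "p \<in> W" and f: "smooth_fun A W f"
    and X: "smooth_field A W X" and Y: "smooth_field A W Y"
  shows "dir_deriv A f p (lie_bracket A X Y p) =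
    dir_deriv A (\<lambda>q. dir_deriv A f q (Y q)) p (X p) - dir_deriv A (\<lambda>q. dir_deriv A f q (X q)) p (Y p)"
proof -
  let ?\<kappa> = "chart_at A p"
  let ?W = "W \<inter> fst ?\<kappa>"
  let ?f = "\<lambda>x. f (chart_inv ?\<kappa> x)"
  have W': "open ?W" "p \<in> ?W" using W by (simp_all add: open_Int open_chart chart_at)
  have sd: "smooth_fun A ?W (\<lambda>q. fderiv ?f (snd ?\<kappa> q) b)" for b
    by (rule smooth_fun_fderiv[OF chart_at_in W'(1)]) (use smooth_fun_subset[OF f] in auto)
  have C: "Ck_on 2 ?f (snd ?\<kappa> ` (fst ?\<kappa> \<inter> W))"
    using f by (simp add: smooth_fun_iff smooth_on_def chart_at)
  have dd: "dir_deriv A (\<lambda>q. fderiv ?f (snd ?\<kappa> q) b) p u = fderiv (\<lambda>x. fderiv ?f x b) (snd ?\<kappa> p) u" for b u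
    unfolding dir_deriv_eq
    by (rule fderiv_cong_open[of "snd ?\<kappa> ` fst ?\<kappa>", THEN fun_cong])
      (use chart_at in \<open>auto simp: chart_inv_chart open_chart_range\<close>)
  interpret L: linear "fderiv ?f (snd ?\<kappa> p)"
    by (rule linear_fderiv differentiable_chart[OF W])+ (use f chart_at in auto)
  \<comment> \<open>Product rule for the sum of components of Y times partial derivatives of f: a
    Hessian term plus the derivative of f along the derivative of the components.\<close>
  have main: "dir_deriv A (\<lambda>q. dir_deriv A f q (Y q)) p u =
     (\<Sum>b\<in>Basis. (Y p \<bullet> b) *\<^sub>R fderiv (\<lambda>x. fderiv ?f x b) (snd ?\<kappa> p) u) +
     dir_deriv A f p (dir_deriv A (\<lambda>q. comps A ?\<kappa> q (Y q)) p u)"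
    if Y: "smooth_field A W Y" for Y u
  proof -
    have sY: "smooth_fun A ?W (\<lambda>q. comps A ?\<kappa> q (Y q))" using Y by (simp add: smooth_field_iff chart_at)
    have sYb: "smooth_fun A ?W (\<lambda>q. comps A ?\<kappa> q (Y q) \<bullet> b)" for b
      by (intro smooth_fun_inner W' sY smooth_fun_const)
    have "dir_deriv A (\<lambda>q. dir_deriv A f q (Y q)) p u =
        dir_deriv A (\<lambda>q. \<Sum>b\<in>Basis. (comps A ?\<kappa> q (Y q) \<bullet> b) *\<^sub>R fderiv ?f (snd ?\<kappa> q) b) p u"
    proof (rule dir_deriv_cong[OF W'])
      fix q assume q: "q \<in> ?W"
      let ?L = "fderiv ?f (snd ?\<kappa> q)" and ?v = "comps A ?\<kappa> q (Y q)"
      interpret linear ?L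
        by (rule linear_fderiv differentiable_chart[OF W(1)])+ (use q f chart_at in auto)
      have "(\<Sum>b\<in>Basis. (?v \<bullet> b) *\<^sub>R ?L b) = ?L (\<Sum>b\<in>Basis. (?v \<bullet> b) *\<^sub>R b)" by (simp add: sum scale)
      then show "dir_deriv A f q (Y q) = (\<Sum>b\<in>Basis. (?v \<bullet> b) *\<^sub>R ?L b)"
        using dir_deriv_comps[OF chart_at_in _ W(1) _ f, of q p] q by (simp add: euclidean_representation)
    qed
    also have "\<dots> = (\<Sum>b\<in>Basis. (Y p \<bullet> b) *\<^sub>R fderiv (\<lambda>x. fderiv ?f x b) (snd ?\<kappa> p) u
        + (dir_deriv A (\<lambda>q. comps A ?\<kappa> q (Y q)) p u \<bullet> b) *\<^sub>R fderiv ?f (snd ?\<kappa> p) b)"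
      by (subst dir_deriv_sum[OF W'])
        (auto intro!: smooth_fun_scaleR W' sYb sd sum.cong
          simp: dir_deriv_bilinear[OF bounded_bilinear_scaleR W' sYb sd] dd
            dir_deriv_inner[OF W' sY smooth_fun_const] dir_deriv_const)
    also have "\<dots> = (\<Sum>b\<in>Basis. (Y p \<bullet> b) *\<^sub>R fderiv (\<lambda>x. fderiv ?f x b) (snd ?\<kappa> p) u) +
       fderiv ?f (snd ?\<kappa> p) (\<Sum>b\<in>Basis. (dir_deriv A (\<lambda>q. comps A ?\<kappa> q (Y q)) p u \<bullet> b) *\<^sub>R b)"
      by (simp add: sum.distrib L.sum L.scale)
    finally show ?thesis by (simp add: euclidean_representation dir_deriv_eq)
  qed
  have sym: "(\<Sum>b\<in>Basis. (v \<bullet> b) *\<^sub>R fderiv (\<lambda>x. fderiv ?f x b) (snd ?\<kappa> p) u) =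
      fderiv (\<lambda>x. fderiv ?f x u) (snd ?\<kappa> p) v" for u v
  proof -
    have o: "open (snd ?\<kappa> ` (fst ?\<kappa> \<inter> W))" "snd ?\<kappa> p \<in> snd ?\<kappa> ` (fst ?\<kappa> \<inter> W)"
      using W chart_at by (auto intro: open_chart_image_Int)
    have "(\<lambda>x. fderiv ?f x u) differentiable (at (snd ?\<kappa> p))"
      using C o(2) by (auto simp: numeral_2_eq_2)
    then interpret D: linear "fderiv (\<lambda>x. fderiv ?f x u) (snd ?\<kappa> p)" by (rule linear_fderiv)
    have "(\<Sum>b\<in>Basis. (v \<bullet> b) *\<^sub>R fderiv (\<lambda>x. fderiv ?f x b) (snd ?\<kappa> p) u)
      = (\<Sum>b\<in>Basis. (v \<bullet> b) *\<^sub>R fderiv (\<lambda>x. fderiv ?f x u) (snd ?\<kappa> p) b)"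
      using second_derivative_symmetric[OF o C] by simp
    also have "\<dots> = fderiv (\<lambda>x. fderiv ?f x u) (snd ?\<kappa> p) (\<Sum>b\<in>Basis. (v \<bullet> b) *\<^sub>R b)"
      by (simp add: D.sum D.scale)
    finally show ?thesis by (simp add: euclidean_representation)
  qed
  have "fderiv (\<lambda>x. fderiv ?f x (X p)) (snd ?\<kappa> p) (Y p) = fderiv (\<lambda>x. fderiv ?f x (Y p)) (snd ?\<kappa> p) (X p)"
    by (rule second_derivative_symmetric[OF _ _ C])
      (use W chart_at in \<open>auto intro: open_chart_image_Int\<close>)
  then show ?thesis
    unfolding main[OF X] main[OF Y] sym lie_bracket_def
    by (simp add: linear_diff[OF linear_dir_deriv[OF W f]])
qed

text \<open>A Euclidean bump function is transported by the chart and extended by 0. The closed set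
  K inside the chart domain makes this smooth: the domain and the complement of K are open, cover
  everything, and carry smooth restrictions.\<close>

lemma exists_bump:
  obtains \<beta> :: "'p \<Rightarrow> real" and K where "smooth_fun A UNIV \<beta>" "\<beta> p = 1"
    "closed K" "K \<subseteq> fst (chart_at A p)" "\<And>q. q \<notin> K \<Longrightarrow> \<beta> q = 0"
proof -
  let ?\<kappa> = "chart_at A p"
  let ?U = "fst ?\<kappa>" and ?x = "snd ?\<kappa> p"
  have "open (snd ?\<kappa> ` ?U)" "?x \<in> snd ?\<kappa> ` ?U" using chart_at by (auto intro: open_chart_range)
  then obtain r where r: "r > 0" "cball ?x r \<subseteq> snd ?\<kappa> ` ?U"
    by (meson open_contains_cball)
  obtain \<psi> where \<psi>: "smooth_on UNIV \<psi>" "\<psi> ?x = 1" "\<And>x. x \<notin> ball ?x r \<Longrightarrow> \<psi> x = (0::real)"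
    using smooth_bump[OF r(1)] by metis
  define K where "K = chart_inv ?\<kappa> ` cball ?x r"
  have "continuous_on (snd ?\<kappa> ` ?U) (chart_inv ?\<kappa>)"
    using homeo_chart[OF chart_at_in] by (simp add: homeomorphism_def)
  \<comment> \<open>Compactness of the closed ball is what counts: in a Hausdorff space K is then
    closed in the whole manifold, not merely in the chart domain.\<close>
  then have "compact K"
    unfolding K_def using r(2) by (intro compact_continuous_image compact_cball) (rule continuous_on_subset)
  then have "closed K" by (rule compact_imp_closed)
  have KU: "K \<subseteq> ?U"
    unfolding K_def using r(2) chart_inv_chart[OF chart_at_in] by (force simp: subset_iff)
  define \<beta> where "\<beta> q = (if q \<in> ?U then \<psi> (snd ?\<kappa> q) else 0)" for q
  have out: "\<beta> q = 0" if "q \<notin> K" for q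
  proof (cases "q \<in> ?U")
    case True
    then have "snd ?\<kappa> q \<notin> cball ?x r"
      using that chart_inv_chart[OF chart_at_in True] unfolding K_def by (metis imageI)
    then have "snd ?\<kappa> q \<notin> ball ?x r" by auto
    then show ?thesis by (simp add: \<beta>_def \<psi>)
  qed (simp add: \<beta>_def)
  have 1: "smooth_fun A ?U \<beta>"
  proof (rule smooth_fun_chartI[OF chart_at_in open_chart[OF chart_at_in] order_refl])
    show "smooth_on (snd ?\<kappa> ` ?U) (\<lambda>x. \<beta> (chart_inv ?\<kappa> x))"
      by (rule smooth_on_cong[THEN iffD1, rotated 2, OF smooth_on_subset[OF \<psi>(1)]])
        (auto simp: open_chart_range chart_at \<beta>_def chart_inv_chart)
  qed
  have 2: "smooth_fun A (- K) \<beta>"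
    by (rule smooth_fun_cong[THEN iffD1, rotated 2, OF smooth_fun_const[of _ 0]])
      (use out \<open>closed K\<close> in auto)
  have "smooth_fun A UNIV \<beta>"
  proof (rule smooth_fun_local)
    fix q
    show "\<exists>W'. open W' \<and> q \<in> W' \<and> smooth_fun A W' \<beta>"
      using 1 2 KU \<open>closed K\<close> open_chart[OF chart_at_in] by (cases "q \<in> K") auto
  qed
  moreover have "\<beta> p = 1" using chart_at by (simp add: \<beta>_def \<psi>)
  ultimately show ?thesis using that out \<open>closed K\<close> KU by blast
qed

end

section \<open>Positive definite forms\<close>

locale inner_form =
  fixes g :: "'e::euclidean_space \<Rightarrow> 'e \<Rightarrow> real"
  assumes bilinear: "bilinear g" and sym: "g u v = g v u" and pos: "v \<noteq> 0 \<Longrightarrow> g v v > 0"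
begin

lemmas form_simps = bilinear_ladd[OF bilinear] bilinear_radd[OF bilinear] bilinear_lmul[OF bilinear]
  bilinear_rmul[OF bilinear] bilinear_lneg[OF bilinear] bilinear_rneg[OF bilinear]
  bilinear_lzero[OF bilinear] bilinear_rzero[OF bilinear] bilinear_lsub[OF bilinear]
  bilinear_rsub[OF bilinear]

lemma linear_form: "linear (g u)" "linear (\<lambda>v. g v u)"
  using bilinear by (auto simp: bilinear_def)

lemma form_sum: "g u (\<Sum>i\<in>I. f i) = (\<Sum>i\<in>I. g u (f i))" "g (\<Sum>i\<in>I. f i) u = (\<Sum>i\<in>I. g (f i) u)"
  using linear_sum[OF linear_form(1)[of u]] linear_sum[OF linear_form(2)[of u]] by auto

lemma form_eq_0: "g v v = 0 \<longleftrightarrow> v = 0"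
  using pos[of v] by (cases "v = 0") (auto simp: form_simps)

lemma orthogonal_independent:
  assumes "\<And>u v. u \<in> S \<Longrightarrow> v \<in> S \<Longrightarrow> u \<noteq> v \<Longrightarrow> g u v = 0" "0 \<notin> S"
  shows "independent S"
  unfolding dependent_def
proof safe
  fix u assume u: "u \<in> S" "u \<in> span (S - {u})"
  have "g u w = 0" if "w \<in> span (S - {u})" for w
    using that by (induction rule: span_induct_alt) (use u(1) assms in \<open>auto simp: form_simps\<close>)
  then have "g u u = 0" using u(2) by simp
  then show False using form_eq_0[of u] u(1) assms(2) by auto
qed

text \<open>An infinite set has \<open>card\<close> 0, whereas \<open>DIM('e)\<close> is
  positive.\<close>

lemma orthonormal_basis_finite: "orthonormal_basis g S \<Longrightarrow> finite S"
  unfolding orthonormal_basis_def by (metis DIM_positive card.infinite less_irrefl)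

text \<open>An orthonormal set is independent, so one with \<open>DIM('e)\<close> elements spans.
  The difference \<open>w\<close> of the two sides is orthogonal to the set, hence to
  itself.\<close>

lemma orthonormal_basis_expansion:
  assumes "orthonormal_basis g S"
  shows "v = (\<Sum>e\<in>S. g v e *\<^sub>R e)"
proof -
  have on: "\<And>u v. u \<in> S \<Longrightarrow> v \<in> S \<Longrightarrow> g u v = (if u = v then 1 else 0)" and "card S = DIM('e)"
    using assms by (auto simp: orthonormal_basis_def)
  have fin: "finite S" by (rule orthonormal_basis_finite[OF assms])
  have "0 \<notin> S" using on[of 0 0] by (auto simp: form_simps)
  then have "independent S" using on by (intro orthogonal_independent) auto
  then have sp: "UNIV \<subseteq> span S"
    using \<open>card S = DIM('e)\<close> by (intro card_ge_dim_independent) (auto simp: dim_UNIV)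
  define w where "w = v - (\<Sum>e\<in>S. g v e *\<^sub>R e)"
  have wS: "g w e = 0" if "e \<in> S" for e
    using that fin by (simp add: w_def form_simps form_sum on sum.delta' if_distrib cong: if_cong)
  have "g w u = 0" if "u \<in> span S" for u
    using that by (induction rule: span_induct_alt) (auto simp: form_simps wS)
  then have "g w w = 0" using sp by auto
  then show ?thesis by (simp add: form_eq_0 w_def)
qed

text \<open>Normalising pointwise reduces this to the orthonormal case. The two square roots
  recombine into one reciprocal, so the coefficients are smooth for smooth frames without any
  smoothness of square roots.\<close>

lemma orthogonal_expansion:
  fixes E :: "'e \<Rightarrow> 'e"
  assumes orth: "\<And>a b. a \<in> Basis \<Longrightarrow> b \<in> Basis \<Longrightarrow> a \<noteq> b \<Longrightarrow> g (E a) (E b) = 0"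
    and nz: "\<And>b. b \<in> Basis \<Longrightarrow> E b \<noteq> 0"
  shows "\<exists>S. orthonormal_basis g S" and "v = (\<Sum>b\<in>Basis. (g v (E b) * inverse (g (E b) (E b))) *\<^sub>R E b)"
proof -
  define N where "N b = inverse (sqrt (g (E b) (E b))) *\<^sub>R E b" for b
  have gp: "g (E b) (E b) > 0" if "b \<in> Basis" for b using pos nz that by auto
  have NN: "g (N a) (N b) = (if a = b then 1 else 0)" if "a \<in> Basis" "b \<in> Basis" for a b
    using gp[OF that(1)] orth[OF that] by (cases "a = b") (auto simp: N_def form_simps field_simps)
  then have inj: "inj_on N Basis" by (metis inj_onI zero_neq_one)
  have on: "orthonormal_basis g (N ` Basis)"
    unfolding orthonormal_basis_def using NN inj by (auto simp: card_image dest: inj_onD)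
  then show "\<exists>S. orthonormal_basis g S" by blast
  have "v = (\<Sum>b\<in>Basis. g v (N b) *\<^sub>R N b)"
    using orthonormal_basis_expansion[OF on, of v] by (simp add: sum.reindex[OF inj])
  also have "\<dots> = (\<Sum>b\<in>Basis. (g v (E b) * inverse (g (E b) (E b))) *\<^sub>R E b)"
  proof (rule sum.cong[OF refl])
    fix b :: 'e assume "b \<in> Basis"
    then have "g (E b) (E b) > 0" by (rule gp)
    then have "inverse (sqrt (g (E b) (E b))) * inverse (sqrt (g (E b) (E b))) = inverse (g (E b) (E b))"
      by (simp flip: inverse_mult_distrib)
    then show "g v (N b) *\<^sub>R N b = (g v (E b) * inverse (g (E b) (E b))) *\<^sub>R E b"
      by (simp add: N_def form_simps)
  qed
  finally show "v = (\<Sum>b\<in>Basis. (g v (E b) * inverse (g (E b) (E b))) *\<^sub>R E b)" .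
qed

section \<open>Orthogonal complements and projections\<close>

lemma subspace_orth_compl: "subspace (orth_compl g K)"
  by (auto simp: subspace_def orth_compl_def form_simps)

lemma orth_compl_Int: "v \<in> K \<Longrightarrow> v \<in> orth_compl g K \<Longrightarrow> v = 0"
  using form_eq_0 by (auto simp: orth_compl_def)

text \<open>The operator \<open>T\<close> represents the form by the Euclidean inner product and
  carries the complement with respect to \<open>g\<close> onto the Euclidean one. Its injectivity
  gives the dimension of the complement; since the intersection with K is trivial, the sum is the
  whole space.\<close>

lemma orth_decomposition:
  assumes K: "subspace K"
  shows "\<exists>w\<in>K. v - w \<in> orth_compl g K"
proof -
  define T where "T w = (\<Sum>b\<in>Basis. g w b *\<^sub>R b)" for w
  have T: "u \<bullet> T w = g w u" for w u
  proof -
    have "u \<bullet> T w = (\<Sum>b\<in>Basis. g w ((u \<bullet> b) *\<^sub>R b))"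
      by (simp add: T_def inner_sum_right form_simps mult.commute)
    also have "\<dots> = g w u" by (simp flip: form_sum add: euclidean_representation)
    finally show ?thesis .
  qed
  have lin: "linear T" by (rule linearI) (simp_all add: T_def form_simps sum.distrib scaleR_add_left scaleR_sum_right)
  have inj: "inj T"
    by (rule linear_injective_0[OF lin, THEN iffD2]) (metis T form_eq_0 inner_zero_right)
  have surj: "surj T" by (rule linear_inj_imp_surj[OF lin inj])
  let ?C = "orth_compl g K"
  have "T ` ?C = {y \<in> UNIV. \<forall>x\<in>K. orthogonal x y}"
  proof safe
    fix y assume "\<forall>x\<in>K. orthogonal x y"
    moreover obtain w where "y = T w" using surj by blast
    ultimately show "y \<in> T ` ?C" by (intro image_eqI[of _ T w]) (auto simp: orth_compl_def orthogonal_def T)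
  qed (auto simp: orth_compl_def orthogonal_def T)
  then have "dim ?C + dim K = DIM('e)"
    using dim_subspace_orthogonal_to_vectors[OF K subspace_UNIV subset_UNIV]
      dim_image_eq[OF lin inj_on_subset[OF inj subset_UNIV], of ?C] by (simp add: dim_UNIV)
  moreover have "K \<inter> ?C = {0}"
    using orth_compl_Int subspace_0[OF K] subspace_0[OF subspace_orth_compl] by blast
  ultimately have "dim {x + y |x y. x \<in> K \<and> y \<in> ?C} = DIM('e)"
    using dim_sums_Int[OF K subspace_orth_compl[of K]] by simp
  then have "span {x + y |x y. x \<in> K \<and> y \<in> ?C} = UNIV" by (simp add: dim_eq_full)
  then have "{x + y |x y. x \<in> K \<and> y \<in> ?C} = UNIV"
    using span_eq_iff[THEN iffD2, OF subspace_sums[OF K subspace_orth_compl[of K]]] by simp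
  then obtain x y where "v = x + y" "x \<in> K" "y \<in> ?C" by blast
  then show ?thesis by (intro bexI[of _ x]) auto
qed

text \<open>Two candidates differ by a vector that is both in K and orthogonal to K, so the
  description in \<open>orth_proj\<close> is unique.\<close>

lemma orth_proj_eqI:
  assumes K: "subspace K" and w: "w \<in> K" "v - w \<in> orth_compl g K"
  shows "orth_proj g K v = w"
  unfolding orth_proj_def
proof (rule the_equality)
  fix u assume u: "u \<in> K \<and> v - u \<in> orth_compl g K"
  have "u - w \<in> K" using K u w subspace_diff by blast
  moreover have "(v - w) - (v - u) \<in> orth_compl g K"
    using u w subspace_diff[OF subspace_orth_compl] by blast
  ultimately have "u - w = 0" by (intro orth_compl_Int) auto
  then show "u = w" by simp
qed (use w in simp)

lemma orth_proj:
  assumes "subspace K"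
  shows "orth_proj g K v \<in> K" "v - orth_proj g K v \<in> orth_compl g K"
  using orth_decomposition[OF assms, of v] orth_proj_eqI[OF assms] by auto

lemma orth_proj_compl:
  assumes K: "subspace K"
  shows "orth_proj g (orth_compl g K) v = v - orth_proj g K v"
  by (rule orth_proj_eqI[OF subspace_orth_compl orth_proj(2)[OF K]])
    (use orth_proj(1)[OF K, of v] sym in \<open>auto simp: orth_compl_def\<close>)

lemma linear_orth_proj:
  assumes K: "subspace K"
  shows "linear (orth_proj g K)"
proof (rule linearI)
  fix u v :: 'e and c :: real
  show "orth_proj g K (u + v) = orth_proj g K u + orth_proj g K v"
    by (rule orth_proj_eqI[OF K])
      (use orth_proj[OF K] subspace_add[OF K] subspace_add[OF subspace_orth_compl orth_proj(2)[OF K] orth_proj(2)[OF K]] in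
        \<open>auto simp: add_diff_add\<close>)
  show "orth_proj g K (c *\<^sub>R v) = c *\<^sub>R orth_proj g K v"
    by (rule orth_proj_eqI[OF K])
      (use orth_proj[OF K] subspace_scale[OF K] subspace_scale[OF subspace_orth_compl orth_proj(2)[OF K]] in
        \<open>auto simp flip: scaleR_diff_right\<close>)
qed

lemma orth_proj_self_adjoint:
  assumes K: "subspace K"
  shows "g (orth_proj g K u) v = g u (orth_proj g K v)"
proof -
  have "g (u - orth_proj g K u) (orth_proj g K v) = 0" "g (v - orth_proj g K v) (orth_proj g K u) = 0"
    using orth_proj[OF K] by (auto simp: orth_compl_def)
  then show ?thesis using sym by (simp add: form_simps)
qed

text \<open>
  Lets traces be split along projections without choosing a basis adapted to the splitting.
\<close>

lemma adjoint_transfer: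
  fixes \<beta> :: "'e \<Rightarrow> 'e \<Rightarrow> 'v::real_vector"
  assumes S: "orthonormal_basis g S"
    and lin1: "\<And>v. linear (\<lambda>u. \<beta> u v)" and lin2: "\<And>u. linear (\<beta> u)"
    and adj: "\<And>u v. g (K u) v = g u (K' v)"
  shows "(\<Sum>e\<in>S. \<beta> e (K e)) = (\<Sum>e\<in>S. \<beta> (K' e) e)"
proof -
  have "(\<Sum>e\<in>S. \<beta> e (K e)) = (\<Sum>e\<in>S. \<Sum>d\<in>S. g (K e) d *\<^sub>R \<beta> e d)"
  proof (rule sum.cong[OF refl])
    fix e
    have "\<beta> e (K e) = \<beta> e (\<Sum>d\<in>S. g (K e) d *\<^sub>R d)"
      using orthonormal_basis_expansion[OF S, of "K e"] by simp
    then show "\<beta> e (K e) = (\<Sum>d\<in>S. g (K e) d *\<^sub>R \<beta> e d)"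
      by (simp add: linear_sum[OF lin2] linear_scale[OF lin2])
  qed
  also have "\<dots> = (\<Sum>d\<in>S. \<Sum>e\<in>S. g (K' d) e *\<^sub>R \<beta> e d)"
    by (subst sum.swap) (simp add: adj sym[of "K' _"])
  also have "\<dots> = (\<Sum>d\<in>S. \<beta> (K' d) d)"
  proof (rule sum.cong[OF refl])
    fix d
    have "\<beta> (K' d) d = \<beta> (\<Sum>e\<in>S. g (K' d) e *\<^sub>R e) d"
      using orthonormal_basis_expansion[OF S, of "K' d"] by simp
    then show "(\<Sum>e\<in>S. g (K' d) e *\<^sub>R \<beta> e d) = \<beta> (K' d) d"
      by (simp add: linear_sum[OF lin1] linear_scale[OF lin1])
  qed
  finally show ?thesis .
qed

text \<open>\<open>endo_trace\<close> refers to the Euclidean basis of the model space, which is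
  unrelated to the metric. Expanding each basis vector in \<open>S\<close> and interchanging the
  sums reassembles \<open>L e\<close>.\<close>

lemma endo_trace_orthonormal:
  assumes S: "orthonormal_basis g S" and L: "linear L"
  shows "endo_trace L = (\<Sum>e\<in>S. g (L e) e)"
proof -
  have "endo_trace L = (\<Sum>b\<in>Basis. \<Sum>e\<in>S. g b e * (L e \<bullet> b))"
    unfolding endo_trace_def
  proof (rule sum.cong[OF refl])
    fix b :: 'e
    have "L b = L (\<Sum>e\<in>S. g b e *\<^sub>R e)" using orthonormal_basis_expansion[OF S, of b] by simp
    then show "L b \<bullet> b = (\<Sum>e\<in>S. g b e * (L e \<bullet> b))"
      by (simp add: linear_sum[OF L] linear_scale[OF L] inner_sum_left)
  qed
  also have "\<dots> = (\<Sum>e\<in>S. g (\<Sum>b\<in>Basis. (L e \<bullet> b) *\<^sub>R b) e)"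
    by (subst sum.swap) (simp add: form_sum form_simps mult.commute)
  finally show ?thesis by (simp add: euclidean_representation)
qed

end

section \<open>Riemannian manifolds\<close>

locale riemannian_manifold = smooth_manifold A
  for A :: "('p::{t2_space,second_countable_topology}, 'e::euclidean_space) chart set" +
  fixes g :: "'p \<Rightarrow> 'e \<Rightarrow> 'e \<Rightarrow> real"
  assumes metric: "riemannian_metric A g"
begin

sublocale g: inner_form "g p" for p
  using metric by unfold_locales (auto simp: riemannian_metric_def)

lemma smooth_metric:
  "open W \<Longrightarrow> smooth_field A W X \<Longrightarrow> smooth_field A W Y \<Longrightarrow> smooth_fun A W (\<lambda>p. g p (X p) (Y p))"
  using metric by (auto simp: riemannian_metric_def)

text \<open>Gram--Schmidt without normalisation, so that only division is needed.\<close>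

lemma orthogonal_frame_aux:
  fixes p :: 'p
  defines "U \<equiv> fst (chart_at A p)"
  assumes "finite T" "T \<subseteq> Basis"
  shows "\<exists>E :: 'e \<Rightarrow> 'p \<Rightarrow> 'e. (\<forall>b\<in>T. smooth_field A U (E b)) \<and> (\<forall>q\<in>U. (\<forall>b\<in>T. E b q \<noteq> 0) \<and>
    (\<forall>a\<in>T. \<forall>b\<in>T. a \<noteq> b \<longrightarrow> g q (E a q) (E b q) = 0) \<and>
    (\<forall>b\<in>T. E b q \<in> span ((\<lambda>b. extension A p b q) ` T)))"
  using assms(2,3)
proof (induction T)
  case (insert c T)
  have U: "open U" unfolding U_def by (rule open_chart[OF chart_at_in])
  obtain E :: "'e \<Rightarrow> 'p \<Rightarrow> 'e" where E: "\<forall>b\<in>T. smooth_field A U (E b)" "\<forall>q\<in>U. (\<forall>b\<in>T. E b q \<noteq> 0) \<and>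
    (\<forall>a\<in>T. \<forall>b\<in>T. a \<noteq> b \<longrightarrow> g q (E a q) (E b q) = 0) \<and>
    (\<forall>b\<in>T. E b q \<in> span ((\<lambda>b. extension A p b q) ` T))"
    using insert.IH insert.prems by auto
  have sm: "\<And>b. b \<in> T \<Longrightarrow> smooth_field A U (E b)"
    and nz: "\<And>q b. q \<in> U \<Longrightarrow> b \<in> T \<Longrightarrow> E b q \<noteq> 0"
    and orth: "\<And>q a b. q \<in> U \<Longrightarrow> a \<in> T \<Longrightarrow> b \<in> T \<Longrightarrow> a \<noteq> b \<Longrightarrow> g q (E a q) (E b q) = 0"
    and sp: "\<And>q b. q \<in> U \<Longrightarrow> b \<in> T \<Longrightarrow> E b q \<in> span ((\<lambda>b. extension A p b q) ` T)"
    using E by blast+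
  \<comment> \<open>The Gram-Schmidt coefficients; \<open>Z\<close> is the coordinate field in
    direction \<open>c\<close> minus its projection on the fields found so far.\<close>
  define r where "r q a = g q (extension A p c q) (E a q) * inverse (g q (E a q) (E a q))" for q a
  define Z where "Z q = extension A p c q - (\<Sum>a\<in>T. r q a *\<^sub>R E a q)" for q
  have ext: "smooth_field A U (extension A p b)" for b unfolding U_def by (rule smooth_extension)
  have sZ: "smooth_field A U Z"
    unfolding Z_def r_def
    by (intro smooth_field_diff smooth_field_sum smooth_field_scaleR smooth_fun_mult
        smooth_fun_inverse smooth_metric sm ext U) (use nz g.form_eq_0 in auto)
  have comb: "(\<Sum>a\<in>T. r q a *\<^sub>R E a q) \<in> span ((\<lambda>b. extension A p b q) ` T)" if "q \<in> U" for q
    using sp[OF that] by (intro span_sum span_scale)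
  \<comment> \<open>The span clause of the induction is there for this step: a zero of Z would place
    \<open>c\<close> in the span of \<open>T\<close>, because taking components undoes
    \<open>extension\<close>.\<close>
  have Znz: "Z q \<noteq> 0" if q: "q \<in> U" for q
  proof
    assume "Z q = 0"
    then have "extension A p c q \<in> span ((\<lambda>b. extension A p b q) ` T)"
      using comb[OF q] by (simp add: Z_def)
    moreover have lin: "linear (\<lambda>b. extension A p b q)" using q U_def linear_extension by auto
    ultimately obtain x where "x \<in> span T" "extension A p c q = extension A p x q"
      using linear_span_image[OF lin, of T] by auto
    then have "c \<in> span T" using comps_extension[of q p] q U_def by metis
    moreover have "independent (insert c T)" using insert.prems independent_Basis independent_mono by blast
    ultimately show False using insert.hyps(2) by (simp add: independent_insert)
  qed
  have Zorth: "g q (Z q) (E b q) = 0" if q: "q \<in> U" and b: "b \<in> T" for q b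
  proof -
    have "(\<Sum>a\<in>T. g q (extension A p c q) (E a q) * inverse (g q (E a q) (E a q)) * g q (E a q) (E b q))
       = (\<Sum>a\<in>T. if a = b then g q (extension A p c q) (E b q) else 0)"
      using orth[OF q _ b] nz[OF q b] by (intro sum.cong) (auto simp: g.form_eq_0)
    then show ?thesis
      using b insert.hyps(1) by (simp add: Z_def r_def g.form_simps g.form_sum)
  qed
  have Zsp: "Z q \<in> span ((\<lambda>b. extension A p b q) ` insert c T)" if "q \<in> U" for q
    unfolding Z_def
    by (rule span_diff[OF span_base subsetD[OF span_mono comb[OF that]]]) auto
  have Esp: "E b q \<in> span ((\<lambda>b. extension A p b q) ` insert c T)" if "q \<in> U" "b \<in> T" for q b
    by (rule subsetD[OF span_mono sp[OF that]]) auto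
  have Zorth': "g q (E b q) (Z q) = 0" if "q \<in> U" "b \<in> T" for q b
    using Zorth[OF that] by (simp add: g.sym)
  show ?case
  proof (intro exI[of _ "E(c := Z)"] conjI ballI impI)
    fix b assume "b \<in> insert c T"
    then show "smooth_field A U ((E(c := Z)) b)" using sm sZ by auto
  next
    fix q b assume "q \<in> U" "b \<in> insert c T"
    then show "(E(c := Z)) b q \<noteq> 0" "(E(c := Z)) b q \<in> span ((\<lambda>b. extension A p b q) ` insert c T)"
      using nz Znz Esp Zsp by (cases "b = c"; force)+
  next
    fix q a b assume "q \<in> U" "a \<in> insert c T" "b \<in> insert c T" "a \<noteq> b"
    then show "g q ((E(c := Z)) a q) ((E(c := Z)) b q) = 0"
      using orth Zorth Zorth' by (cases "a = c"; cases "b = c") auto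
  qed
qed auto

lemma orthogonal_frame:
  obtains E :: "'e \<Rightarrow> 'p \<Rightarrow> 'e" where "\<And>b. b \<in> Basis \<Longrightarrow> smooth_field A (fst (chart_at A p)) (E b)"
    "\<And>q b. q \<in> fst (chart_at A p) \<Longrightarrow> b \<in> Basis \<Longrightarrow> E b q \<noteq> 0"
    "\<And>q a b. q \<in> fst (chart_at A p) \<Longrightarrow> a \<in> Basis \<Longrightarrow> b \<in> Basis \<Longrightarrow> a \<noteq> b \<Longrightarrow> g q (E a q) (E b q) = 0"
  using orthogonal_frame_aux[OF finite_Basis order_refl, of p] that by blast

lemma exists_orthonormal_basis: "\<exists>S. orthonormal_basis (g p) S"
proof -
  obtain E :: "'e \<Rightarrow> 'p \<Rightarrow> 'e" where "\<And>q b. q \<in> fst (chart_at A p) \<Longrightarrow> b \<in> Basis \<Longrightarrow> E b q \<noteq> 0"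
    "\<And>q a b. q \<in> fst (chart_at A p) \<Longrightarrow> a \<in> Basis \<Longrightarrow> b \<in> Basis \<Longrightarrow> a \<noteq> b \<Longrightarrow> g q (E a q) (E b q) = 0"
    using orthogonal_frame by metis
  then show ?thesis
    using in_chart_at by (intro g.orthogonal_expansion(1)[of p "\<lambda>b. E b p"]) auto
qed

end

section \<open>Connections\<close>

locale connection = smooth_manifold_map A B F
  for A :: "('p::{t2_space,second_countable_topology}, 'e::euclidean_space) chart set"
    and B :: "('q::{t2_space,second_countable_topology}, 'f::euclidean_space) chart set"
    and F :: "'p \<Rightarrow> 'q" +
  fixes D :: "'p \<Rightarrow> 'e \<Rightarrow> ('p \<Rightarrow> 'f) \<Rightarrow> 'f"
  assumes connection: "connection_along A B F D"
begin

context
  fixes W :: "'p set" and p :: 'p and Y :: "'p \<Rightarrow> 'f"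
  assumes W: "open W" "p \<in> W" and Y: "smooth_section_along A B F W Y"
begin

lemmas D_rules = connection[unfolded connection_along_def, THEN spec[of _ W], THEN spec[of _ Y],
    THEN mp, OF conjI[OF W(1) Y]]

lemma linear_D: "linear (\<lambda>v. D p v Y)"
  using D_rules[THEN conjunct1] W(2) by blast

lemma D_add:
  "smooth_section_along A B F W Z \<Longrightarrow> D p v (\<lambda>q. Y q + Z q) = D p v Y + D p v Z"
  using D_rules[THEN conjunct2, THEN conjunct2, THEN conjunct1] W(2) by blast

lemma D_mult:
  "smooth_fun A W f \<Longrightarrow> D p v (\<lambda>q. f q *\<^sub>R Y q) = dir_deriv A f p v *\<^sub>R Y p + f p *\<^sub>R D p v Y"
  using D_rules[THEN conjunct2, THEN conjunct2, THEN conjunct2, THEN conjunct1] W(2) by blast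

lemma D_cong: "(\<And>q. q \<in> W \<Longrightarrow> Z q = Y q) \<Longrightarrow> D p v Z = D p v Y"
  using D_rules[THEN conjunct2, THEN conjunct2, THEN conjunct2, THEN conjunct2] W(2) by blast

lemma D_scale: "D p v (\<lambda>q. c *\<^sub>R Y q) = c *\<^sub>R D p v Y"
  using D_mult[OF M.smooth_fun_const] by (simp add: M.dir_deriv_const)

end

text \<open>Locality replaces Z by the global zero section, and the zero section is 0 times
  itself.\<close>

lemma D_zero:
  assumes "open W" "p \<in> W" "\<And>q. q \<in> W \<Longrightarrow> Z q = 0"
  shows "D p v Z = 0"
proof -
  have "D p v Z = D p v (\<lambda>q. 0)"
    by (rule D_cong[OF assms(1,2) smooth_section_zero]) (use assms in auto)
  also have "\<dots> = 0"
    using D_scale[OF open_UNIV UNIV_I smooth_section_zero, of p v 0] by simp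
  finally show ?thesis .
qed

lemma D_sum:
  assumes "open W" "p \<in> W" "\<And>i. i \<in> I \<Longrightarrow> smooth_section_along A B F W (Y i)"
  shows "D p v (\<lambda>q. \<Sum>i\<in>I. Y i q) = (\<Sum>i\<in>I. D p v (Y i))"
  using assms(3)
  by (induction I rule: infinite_finite_induct)
    (auto simp: D_zero[OF assms(1,2)] D_add[OF assms(1,2)] smooth_section_sum[OF assms(1)])

end

locale levi_civita_manifold = riemannian_manifold A g
  for A :: "('p::{t2_space,second_countable_topology}, 'e::euclidean_space) chart set"
    and g :: "'p \<Rightarrow> 'e \<Rightarrow> 'e \<Rightarrow> real" +
  fixes D :: "'p \<Rightarrow> 'e \<Rightarrow> ('p \<Rightarrow> 'e) \<Rightarrow> 'e"
  assumes levi_civita: "levi_civita A g D"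
begin

sublocale nabla: connection A A "\<lambda>p. p" D
  using levi_civita smooth_map_id by unfold_locales (auto simp: levi_civita_def)

context
  fixes W :: "'p set" and p :: 'p and Y :: "'p \<Rightarrow> 'e"
  assumes W: "open W" "p \<in> W" and Y: "smooth_field A W Y"
begin

lemmas linear_nabla = nabla.linear_D[OF W Y[unfolded smooth_field_def]]
lemmas nabla_add = nabla.D_add[OF W Y[unfolded smooth_field_def], folded smooth_field_def]
lemmas nabla_mult = nabla.D_mult[OF W Y[unfolded smooth_field_def]]
lemmas nabla_scale = nabla.D_scale[OF W Y[unfolded smooth_field_def]]
lemmas nabla_cong = nabla.D_cong[OF W Y[unfolded smooth_field_def]]

lemma nabla_uminus: "D p v (\<lambda>q. - Y q) = - D p v Y"
  using nabla_scale[of v "-1"] by simp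

lemma torsion_free: "smooth_field A W X \<Longrightarrow> D p (X p) Y - D p (Y p) X = lie_bracket A X Y p"
  using levi_civita W Y unfolding levi_civita_def by blast

lemma metric_connection:
  "smooth_field A W X \<Longrightarrow>
    dir_deriv A (\<lambda>q. g q (X q) (Y q)) p v = g p (D p v X) (Y p) + g p (X p) (D p v Y)"
  using levi_civita W Y unfolding levi_civita_def by blast

end

end

section \<open>Cosymplectic manifolds\<close>

locale cosymplectic_manifold = levi_civita_manifold A g D
  for A :: "('p::{t2_space,second_countable_topology}, 'e::euclidean_space) chart set"
    and g :: "'p \<Rightarrow> 'e \<Rightarrow> 'e \<Rightarrow> real" and D :: "'p \<Rightarrow> 'e \<Rightarrow> ('p \<Rightarrow> 'e) \<Rightarrow> 'e" +
  fixes \<phi> :: "'p \<Rightarrow> 'e \<Rightarrow> 'e" and \<xi> :: "'p \<Rightarrow> 'e" and \<eta> :: "'p \<Rightarrow> 'e \<Rightarrow> real"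
  assumes cosymplectic: "cosymplectic A \<phi> \<xi> \<eta> g"
begin

lemma acm: "almost_contact_metric A \<phi> \<xi> \<eta> g"
  using cosymplectic by (simp add: cosymplectic_def)

lemma linear_phi: "linear (\<phi> p)"
  using acm by (simp add: almost_contact_metric_def endo_field_def)

lemmas phi_simps = linear_add[OF linear_phi] linear_diff[OF linear_phi] linear_scale[OF linear_phi]
  linear_neg[OF linear_phi] linear_0[OF linear_phi]

lemma eta_eq: "\<eta> p v = g p v (\<xi> p)"
  and phi_phi: "\<phi> p (\<phi> p v) = - v + g p v (\<xi> p) *\<^sub>R \<xi> p"
  and phi_xi: "\<phi> p (\<xi> p) = 0"
  and g_phi_xi: "g p (\<phi> p v) (\<xi> p) = 0"
  and g_xi_xi: "g p (\<xi> p) (\<xi> p) = 1"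
  and g_phi_phi: "g p (\<phi> p u) (\<phi> p v) = g p u v - g p u (\<xi> p) * g p v (\<xi> p)"
  using acm by (auto simp: almost_contact_metric_def)

lemma phi_skew: "g p (\<phi> p u) v = - g p u (\<phi> p v)"
proof -
  have "g p (\<phi> p u) v = g p (\<phi> p (\<phi> p u)) (\<phi> p v)"
    using g_phi_phi[of p "\<phi> p u" v] by (simp add: g_phi_xi)
  also have "\<dots> = - g p u (\<phi> p v)"
    using g_phi_xi[of p v] by (simp add: phi_phi g.form_simps g.sym[of p "\<xi> p"])
  finally show ?thesis .
qed

lemma smooth_phi: "open W \<Longrightarrow> smooth_field A W X \<Longrightarrow> smooth_field A W (\<lambda>q. \<phi> q (X q))"
  using acm by (simp add: almost_contact_metric_def endo_field_def)

lemma smooth_xi: "smooth_field A W \<xi>"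
  using acm smooth_field_subset[of UNIV \<xi> W] by (simp add: almost_contact_metric_def)

section \<open>Covariant derivatives of \<phi> and \<xi>\<close>

context
  fixes W :: "'p set" and p :: 'p
  assumes W: "open W" "p \<in> W"
begin

text \<open>This is g((\<nabla>_X \<phi>)Y, Z) at p. Pairing with Z turns all the structure
  equations into linear relations between real numbers.\<close>

definition nabla_phi :: "('p \<Rightarrow> 'e) \<Rightarrow> ('p \<Rightarrow> 'e) \<Rightarrow> ('p \<Rightarrow> 'e) \<Rightarrow> real" where
  "nabla_phi X Y Z = g p (D p (X p) (\<lambda>q. \<phi> q (Y q)) - \<phi> p (D p (X p) Y)) (Z p)"

definition nabla_xi :: "('p \<Rightarrow> 'e) \<Rightarrow> ('p \<Rightarrow> 'e) \<Rightarrow> real" where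
  "nabla_xi X Y = g p (D p (X p) \<xi>) (Y p)"

text \<open>With vanishing torsion and a metric connection, twice the exterior derivative of \<eta>
  on (X, Y) is g(\<nabla>_X \<xi>, Y) - g(\<nabla>_Y \<xi>, X), and \<eta> is closed.\<close>

lemma nabla_xi_sym:
  assumes X: "smooth_field A W X" and Y: "smooth_field A W Y"
  shows "nabla_xi X Y = nabla_xi Y X"
proof -
  have "ext_deriv1 A \<eta> X Y p = 0"
    using cosymplectic X Y W unfolding cosymplectic_def closed1_def by blast
  then have "dir_deriv A (\<lambda>q. g q (Y q) (\<xi> q)) p (X p) - dir_deriv A (\<lambda>q. g q (X q) (\<xi> q)) p (Y p)
     - g p (D p (X p) Y - D p (Y p) X) (\<xi> p) = 0"
    by (simp add: ext_deriv1_def eta_eq torsion_free[OF W Y X])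
  then show ?thesis
    by (simp add: metric_connection[OF W smooth_xi] X Y nabla_xi_def g.form_simps g.sym[of p _ "D p _ \<xi>"])
qed

text \<open>Differentiate g(\<phi>Y, Z) = - g(Y, \<phi>Z): the covariant derivative of a skew
  endomorphism is skew.\<close>

lemma nabla_phi_skew:
  assumes Y: "smooth_field A W Y" and Z: "smooth_field A W Z"
  shows "nabla_phi X Y Z = - nabla_phi X Z Y"
proof -
  note sY = smooth_phi[OF W(1) Y] and sZ = smooth_phi[OF W(1) Z]
  have "(\<lambda>q. g q (\<phi> q (Y q)) (Z q)) = (\<lambda>q. (-1) * g q (Y q) (\<phi> q (Z q)))" by (simp add: phi_skew)
  then have "dir_deriv A (\<lambda>q. g q (\<phi> q (Y q)) (Z q)) p (X p) = - dir_deriv A (\<lambda>q. g q (Y q) (\<phi> q (Z q))) p (X p)"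
    using dir_deriv_mult[OF W smooth_fun_const smooth_metric[OF W(1) Y sZ], of "-1" "X p"]
    by (simp add: dir_deriv_const)
  then have "g p (D p (X p) (\<lambda>q. \<phi> q (Y q))) (Z p) + g p (\<phi> p (Y p)) (D p (X p) Z) =
      - (g p (D p (X p) Y) (\<phi> p (Z p)) + g p (Y p) (D p (X p) (\<lambda>q. \<phi> q (Z q))))"
    by (simp only: metric_connection[OF W Z sY] metric_connection[OF W sZ Y])
  then show ?thesis
    by (simp add: nabla_phi_def g.form_simps phi_skew g.sym[of p "Y p"])
qed

text \<open>Closedness of \<Phi> in covariant form: the brackets cancel the derivatives of the
  arguments, leaving a cyclic sum of terms in \<nabla>\<phi>. Skewness puts each term in the order
  stated.\<close>

lemma nabla_phi_cyclic:
  assumes X: "smooth_field A W X" and Y: "smooth_field A W Y" and Z: "smooth_field A W Z"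
  shows "nabla_phi X Y Z + nabla_phi Y Z X + nabla_phi Z X Y = 0"
proof -
  note s = X Y Z smooth_phi[OF W(1) X] smooth_phi[OF W(1) Y] smooth_phi[OF W(1) Z]
  have "ext_deriv2 A (\<lambda>p u v. g p u (\<phi> p v)) X Y Z p = 0"
    using cosymplectic X Y Z W unfolding cosymplectic_def closed2_def by blast
  then have "nabla_phi X Z Y + nabla_phi Y X Z + nabla_phi Z Y X = 0"
    by (simp add: ext_deriv2_def metric_connection[OF W] s nabla_phi_def g.form_simps phi_skew
        flip: torsion_free[OF W]) (simp add: g.sym)
  then show ?thesis
    using nabla_phi_skew[OF X Y, of Z] nabla_phi_skew[OF Y Z, of X] nabla_phi_skew[OF Z X, of Y] by simp
qed

text \<open>As \<eta> is closed, normality means that the torsion [\<phi>,\<phi>] vanishes. Written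
  with \<nabla>, [\<phi>,\<phi>](Y,Z) is (\<nabla>_{\<phi>Y} \<phi>)Z - (\<nabla>_{\<phi>Z} \<phi>)Y
  + \<phi>((\<nabla>_Z \<phi>)Y - (\<nabla>_Y \<phi>)Z). It is paired with \<phi>X so that
  compatibility of g and \<phi> removes the outer \<phi>.\<close>

lemma nabla_phi_normal:
  assumes X: "smooth_field A W X" and Y: "smooth_field A W Y" and Z: "smooth_field A W Z"
  shows "nabla_phi (\<lambda>q. \<phi> q (Y q)) Z (\<lambda>q. \<phi> q (X q)) - nabla_phi (\<lambda>q. \<phi> q (Z q)) Y (\<lambda>q. \<phi> q (X q))
    + (nabla_phi Z Y X - g p (X p) (\<xi> p) * nabla_phi Z Y \<xi>)
    - (nabla_phi Y Z X - g p (X p) (\<xi> p) * nabla_phi Y Z \<xi>) = 0"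
proof -
  note s = Y Z smooth_phi[OF W(1) Y] smooth_phi[OF W(1) Z]
  have "ext_deriv1 A \<eta> Y Z p = 0" "nijenhuis A \<phi> Y Z p + (2 * ext_deriv1 A \<eta> Y Z p) *\<^sub>R \<xi> p = 0"
    using cosymplectic Y Z W unfolding cosymplectic_def closed1_def normal_structure_def by blast+
  then have "nijenhuis A \<phi> Y Z p = 0" by simp
  then have "g p (nijenhuis A \<phi> Y Z p) (\<phi> p (X p)) = 0" by (simp add: g.form_simps)
  then show ?thesis
    by (simp add: nijenhuis_def nabla_phi_def g.form_simps g_phi_phi g_phi_xi phi_simps s algebra_simps
        flip: torsion_free[OF W])
qed

text \<open>The covariant derivative of \<phi>^2 = -I + \<eta> \<otimes> \<xi>, paired with Z;
  skewness of \<phi> moves it from (\<nabla>_X \<phi>)Y onto Z.\<close>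

lemma nabla_phi_phi:
  assumes Y: "smooth_field A W Y"
  shows "nabla_phi X (\<lambda>q. \<phi> q (Y q)) Z = nabla_phi X Y (\<lambda>q. \<phi> q (Z q))
    + nabla_xi X Y * g p (Z p) (\<xi> p) + g p (Y p) (\<xi> p) * nabla_xi X Z"
proof -
  note sY = smooth_metric[OF W(1) Y smooth_xi]
  have "D p (X p) (\<lambda>q. \<phi> q (\<phi> q (Y q))) = D p (X p) (\<lambda>q. - Y q + g q (Y q) (\<xi> q) *\<^sub>R \<xi> q)"
    by (simp add: phi_phi)
  also have "\<dots> = - D p (X p) Y + D p (X p) (\<lambda>q. g q (Y q) (\<xi> q) *\<^sub>R \<xi> q)"
    by (rule trans[OF nabla_add[OF W smooth_field_uminus[OF W(1) Y] smooth_field_scaleR[OF W(1) sY smooth_xi]]])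
      (simp add: nabla_uminus[OF W Y])
  also have "D p (X p) (\<lambda>q. g q (Y q) (\<xi> q) *\<^sub>R \<xi> q) =
     (g p (D p (X p) Y) (\<xi> p) + g p (Y p) (D p (X p) \<xi>)) *\<^sub>R \<xi> p + g p (Y p) (\<xi> p) *\<^sub>R D p (X p) \<xi>"
    by (simp add: nabla_mult[OF W smooth_xi sY] metric_connection[OF W smooth_xi Y])
  finally have 1: "g p (D p (X p) (\<lambda>q. \<phi> q (\<phi> q (Y q)))) (Z p) = - g p (D p (X p) Y) (Z p) +
      (g p (D p (X p) Y) (\<xi> p) + g p (Y p) (D p (X p) \<xi>)) * g p (\<xi> p) (Z p) +
      g p (Y p) (\<xi> p) * g p (D p (X p) \<xi>) (Z p)"
    by (simp only: g.form_simps add.assoc real_scaleR_def)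
  have 2: "g p (Y p) (D p (X p) \<xi>) = g p (D p (X p) \<xi>) (Y p)" "g p (\<xi> p) (Z p) = g p (Z p) (\<xi> p)"
    by (rule g.sym)+
  show ?thesis
    unfolding nabla_phi_def nabla_xi_def g.form_simps 1 2
      phi_skew[of p "D p (X p) (\<lambda>q. \<phi> q (Y q))"] g_phi_phi real_scaleR_def
    by (simp add: algebra_simps)
qed

text \<open>From \<phi>\<xi> = 0 one has (\<nabla>_X \<phi>)\<xi> = - \<phi> \<nabla>_X
  \<xi>.\<close>

lemma nabla_phi_xi: "nabla_phi X \<xi> Z = nabla_xi X (\<lambda>q. \<phi> q (Z q))"
  by (simp add: nabla_phi_def nabla_xi_def phi_xi nabla.D_zero[OF W] g.form_simps phi_skew)

text \<open>
  Pairing normality with \<open>\<phi>X\<close> and eliminating every \<open>\<phi>\<close>-argument by the cyclic identities for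
  \<open>(X, \<phi>Y, \<phi>Z)\<close> and \<open>(X, Y, Z)\<close> leaves twice the term in question.
\<close>

lemma nabla_phi_0:
  assumes X: "smooth_field A W X" and Y: "smooth_field A W Y" and Z: "smooth_field A W Z"
  shows "nabla_phi X Y Z = 0"
proof -
  let ?X = "\<lambda>q. \<phi> q (X q)" and ?Y = "\<lambda>q. \<phi> q (Y q)" and ?Z = "\<lambda>q. \<phi> q (Z q)"
  note s = X Y Z smooth_phi[OF W(1) X] smooth_phi[OF W(1) Y] smooth_phi[OF W(1) Z] smooth_xi
  have xi: "nabla_phi U V \<xi> = - nabla_xi U (\<lambda>q. \<phi> q (V q))" if "smooth_field A W V" for U V
    using nabla_phi_skew[OF that smooth_xi, of U] by (simp add: nabla_phi_xi)
  have ZZ: "nabla_phi X Y (\<lambda>q. \<phi> q (?Z q)) = - nabla_phi X Y Z + g p (Z p) (\<xi> p) * nabla_phi X Y \<xi>"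
    by (simp add: nabla_phi_def phi_phi g.form_simps)
  have eta: "g p (?X p) (\<xi> p) = 0" "g p (?Z p) (\<xi> p) = 0" "g p (?Y p) (\<xi> p) = 0" by (simp_all add: g_phi_xi)
  define x y z where "x = g p (X p) (\<xi> p)" and "y = g p (Y p) (\<xi> p)" and "z = g p (Z p) (\<xi> p)"
  have sy: "nabla_xi ?Y Z = nabla_xi Z ?Y" "nabla_xi ?Z Y = nabla_xi Y ?Z"
    "nabla_xi ?Y X = nabla_xi X ?Y" "nabla_xi ?Z X = nabla_xi X ?Z"
    using nabla_xi_sym s by auto
  have 1: "nabla_phi ?Y Z ?X - nabla_phi ?Z Y ?X + (nabla_phi Z Y X + x * nabla_xi Z ?Y)
      - (nabla_phi Y Z X + x * nabla_xi Y ?Z) = 0"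
    using nabla_phi_normal[OF X Y Z] by (simp add: xi s x_def)
  have 2: "nabla_phi X ?Y ?Z + nabla_phi ?Y ?Z X + nabla_phi ?Z X ?Y = 0"
    by (rule nabla_phi_cyclic) (rule s)+
  have 3: "nabla_phi ?Y ?Z X = nabla_phi ?Y Z ?X + nabla_xi Z ?Y * x + z * nabla_xi X ?Y"
    using nabla_phi_phi[OF Z, of ?Y X] by (simp add: sy x_def z_def)
  have 4: "nabla_phi ?Z X ?Y = - (nabla_phi ?Z Y ?X + nabla_xi Y ?Z * x + y * nabla_xi X ?Z)"
    using nabla_phi_phi[OF Y, of ?Z X] nabla_phi_skew[OF X s(5), of ?Z] by (simp add: sy x_def y_def)
  have 5: "nabla_phi X ?Y ?Z = - nabla_phi X Y Z - z * nabla_xi X ?Y + y * nabla_xi X ?Z"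
    using nabla_phi_phi[OF Y, of X ?Z] by (simp add: ZZ xi Y eta y_def z_def)
  have 6: "nabla_phi Z Y X = - nabla_phi Z X Y" by (rule nabla_phi_skew[OF Y X])
  have 7: "nabla_phi X Y Z + nabla_phi Y Z X + nabla_phi Z X Y = 0" by (rule nabla_phi_cyclic[OF X Y Z])
  \<comment> \<open>Inserting 3, 4 and 5 into 2 cancels the terms with \<open>y\<close> and
    \<open>z\<close>; comparison with 1, together with 6, gives
    \<open>nabla_phi X Y Z = nabla_phi Y Z X + nabla_phi Z X Y\<close>. By 7 the right side is also
    the negative of the left.\<close>
  show ?thesis using 1 2 3 4 5 6 7 by (simp add: algebra_simps)
qed

end

lemma nabla_phi_eq:
  assumes W: "open W" "p \<in> W" and Y: "smooth_field A W Y"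
  shows "D p u (\<lambda>q. \<phi> q (Y q)) = \<phi> p (D p u Y)"
proof -
  let ?W = "W \<inter> fst (chart_at A p)"
  have W': "open ?W" "p \<in> ?W" using W by (auto simp: chart_at open_chart)
  have e: "smooth_field A ?W (extension A p v)" for v
    by (rule smooth_field_subset[OF smooth_extension]) auto
  have "g p (D p u (\<lambda>q. \<phi> q (Y q)) - \<phi> p (D p u Y)) w = 0" for w
    using nabla_phi_0[OF W' e smooth_field_subset[OF Y] e, of u w] by (simp add: nabla_phi_def[OF W'])
  from g.form_eq_0[THEN iffD1, OF this] show ?thesis by simp
qed

text \<open>Differentiating \<phi>\<xi> = 0 gives \<phi>(\<nabla>\<xi>) = 0, so \<nabla>\<xi> is a
  multiple of \<xi>; it is orthogonal to \<xi> because \<xi> has constant length.\<close>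

lemma nabla_xi_eq: "D p u \<xi> = 0"
proof -
  have "D p u (\<lambda>q. \<phi> q (\<xi> q)) = 0" by (simp add: phi_xi nabla.D_zero[OF open_UNIV])
  then have "\<phi> p (D p u \<xi>) = 0" using nabla_phi_eq[OF open_UNIV UNIV_I smooth_xi] by simp
  then have "D p u \<xi> = g p (D p u \<xi>) (\<xi> p) *\<^sub>R \<xi> p" using phi_phi[of p "D p u \<xi>"] by (simp add: phi_simps)
  moreover have "g p (D p u \<xi>) (\<xi> p) = 0"
    using metric_connection[OF open_UNIV UNIV_I smooth_xi smooth_xi, of p u]
    by (simp add: g_xi_xi dir_deriv_const g.sym)
  ultimately show ?thesis by simp
qed

end

section \<open>The pullback connection\<close>

locale pullback_of_levi_civita = connection A B F DF + N: levi_civita_manifold B gN DN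
  for A :: "('p::{t2_space,second_countable_topology}, 'e::euclidean_space) chart set"
    and B :: "('q::{t2_space,second_countable_topology}, 'f::euclidean_space) chart set"
    and F :: "'p \<Rightarrow> 'q" and DF :: "'p \<Rightarrow> 'e \<Rightarrow> ('p \<Rightarrow> 'f) \<Rightarrow> 'f"
    and gN :: "'q \<Rightarrow> 'f \<Rightarrow> 'f \<Rightarrow> real" and DN :: "'q \<Rightarrow> 'f \<Rightarrow> ('q \<Rightarrow> 'f) \<Rightarrow> 'f" +
  assumes pullback: "pullback_connection A B F DN DF"
begin

lemma pullback_field:
  assumes "open V" "F p \<in> V" "smooth_field B V Y"
  shows "DF p v (\<lambda>q. Y (F q)) = DN (F p) (tangent_map A B F p v) Y"
  using pullback assms unfolding pullback_connection_def by blast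

lemma smooth_pullback_field:
  assumes "open V" "smooth_field B V Y"
  shows "smooth_section_along A B F (F -` V) (\<lambda>q. Y (F q))"
  unfolding smooth_section_iff
proof
  fix \<kappa> assume \<kappa>: "\<kappa> \<in> B"
  have "smooth_fun B (V \<inter> fst \<kappa>) (\<lambda>q. comps B \<kappa> q (Y q))"
    using assms(2) \<kappa> by (simp add: N.smooth_field_iff)
  then have "smooth_fun A (F -` (V \<inter> fst \<kappa>)) (\<lambda>p. comps B \<kappa> (F p) (Y (F p)))"
    by (rule smooth_fun_map[rotated]) (use assms(1) \<kappa> in \<open>auto simp: N.open_chart\<close>)
  then show "smooth_fun A (F -` V \<inter> F -` fst \<kappa>) (\<lambda>p. comps B \<kappa> (F p) (Y (F p)))"
    by (simp add: vimage_Int)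
qed

context
  fixes W :: "'p set" and p :: 'p
  assumes W: "open W" "p \<in> W"
begin

text \<open>The part of \<open>W\<close> over which the coordinate frame of the target around
  \<open>F p\<close> can be pulled back.\<close>

definition "W0 = W \<inter> F -` fst (chart_at B (F p))"

lemma W0: "open W0" "p \<in> W0" "W0 \<subseteq> W" "\<And>q. q \<in> W0 \<Longrightarrow> F q \<in> fst (chart_at B (F p))"
  using W by (auto simp: W0_def open_preimage N.open_chart N.chart_at)

lemma frame_expansion:
  assumes "q \<in> W0"
  shows "Y = (\<Sum>b\<in>Basis. (comps B (chart_at B (F p)) (F q) Y \<bullet> b) *\<^sub>R extension B (F p) b (F q))"
proof -
  have q: "F q \<in> fst (chart_at B (F p))" by (rule W0(4)[OF assms])
  interpret linear "\<lambda>v. extension B (F p) v (F q)" by (rule N.linear_extension[OF q])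
  have "Y = extension B (F p) (\<Sum>b\<in>Basis. (comps B (chart_at B (F p)) (F q) Y \<bullet> b) *\<^sub>R b) (F q)"
    by (simp add: euclidean_representation N.extension_comps[OF q])
  then show ?thesis by (simp only: sum scale)
qed

lemma smooth_frame: "smooth_section_along A B F W0 (\<lambda>q. extension B (F p) b (F q))"
  by (rule smooth_section_subset[OF smooth_pullback_field[OF N.open_chart[OF N.chart_at_in] N.smooth_extension]])
    (auto simp: W0_def)

lemma smooth_comps:
  assumes "smooth_section_along A B F W Y"
  shows "smooth_fun A W0 (\<lambda>q. comps B (chart_at B (F p)) (F q) (Y q))"
  using assms N.chart_at by (auto simp: smooth_section_iff W0_def)

lemma smooth_comp:
  assumes "smooth_section_along A B F W Y"
  shows "smooth_fun A W0 (\<lambda>q. comps B (chart_at B (F p)) (F q) (Y q) \<bullet> b)"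
  by (rule M.smooth_fun_inner[OF W0(1) smooth_comps[OF assms] M.smooth_fun_const])

lemma dir_deriv_comp:
  assumes "smooth_section_along A B F W Y"
  shows "dir_deriv A (\<lambda>q. comps B (chart_at B (F p)) (F q) (Y q) \<bullet> b) p v =
    dir_deriv A (\<lambda>q. comps B (chart_at B (F p)) (F q) (Y q)) p v \<bullet> b"
  by (simp add: M.dir_deriv_inner[OF W0(1,2) smooth_comps[OF assms] M.smooth_fun_const] M.dir_deriv_const)

lemma DF_frame: "DF p v (\<lambda>q. extension B (F p) b (F q)) =
    DN (F p) (tangent_map A B F p v) (extension B (F p) b)"
  by (rule pullback_field[OF N.open_chart[OF N.chart_at_in] N.in_chart_at N.smooth_extension])

text \<open>The pullback connection in coordinates: the derivative of the components plus the
  Christoffel terms of the target. The frame consists of pulled back fields, where the connection is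
  prescribed; the Leibniz rule does the rest.\<close>

lemma DF_eq:
  assumes Y: "smooth_section_along A B F W Y"
  shows "DF p v Y = dir_deriv A (\<lambda>q. comps B (chart_at B (F p)) (F q) (Y q)) p v +
    (\<Sum>b\<in>Basis. (Y p \<bullet> b) *\<^sub>R DN (F p) (tangent_map A B F p v) (extension B (F p) b))"
proof -
  let ?y = "\<lambda>q. comps B (chart_at B (F p)) (F q) (Y q)"
  have sm: "smooth_section_along A B F W0 (\<lambda>q. (?y q \<bullet> b) *\<^sub>R extension B (F p) b (F q))" for b
    by (rule smooth_section_scaleR[OF W0(1) smooth_comp[OF Y] smooth_frame])
  have "DF p v Y = DF p v (\<lambda>q. \<Sum>b\<in>Basis. (?y q \<bullet> b) *\<^sub>R extension B (F p) b (F q))"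
    by (rule D_cong[OF W0(1,2) smooth_section_sum[OF W0(1) sm]]) (rule frame_expansion)
  also have "\<dots> = (\<Sum>b\<in>Basis. DF p v (\<lambda>q. (?y q \<bullet> b) *\<^sub>R extension B (F p) b (F q)))"
    by (rule D_sum[OF W0(1,2) sm])
  also have "\<dots> = (\<Sum>b\<in>Basis. (dir_deriv A ?y p v \<bullet> b) *\<^sub>R b +
      (Y p \<bullet> b) *\<^sub>R DN (F p) (tangent_map A B F p v) (extension B (F p) b))"
    by (rule sum.cong[OF refl])
      (simp add: D_mult[OF W0(1,2) smooth_frame smooth_comp[OF Y]] dir_deriv_comp[OF Y] DF_frame)
  finally show ?thesis by (simp add: sum.distrib euclidean_representation)
qed

text \<open>Metric compatibility is obtained one slot at a time. With a frame field in the first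
  slot, expanding Z leaves the Gram matrix of the frame, a function pulled back from the target,
  where the connection is metric.\<close>

lemma smooth_metric_frame:
  assumes Z: "smooth_section_along A B F W Z"
  shows "smooth_fun A W0 (\<lambda>q. gN (F q) (extension B (F p) a (F q)) (Z q))"
    and "dir_deriv A (\<lambda>q. gN (F q) (extension B (F p) a (F q)) (Z q)) p v =
      gN (F p) (DN (F p) (tangent_map A B F p v) (extension B (F p) a)) (Z p) + gN (F p) a (DF p v Z)"
proof -
  let ?z = "\<lambda>q. comps B (chart_at B (F p)) (F q) (Z q)"
  let ?U = "fst (chart_at B (F p))" and ?G = "\<lambda>b y. gN y (extension B (F p) a y) (extension B (F p) b y)"
  let ?S = "\<lambda>q. \<Sum>b\<in>Basis. (?z q \<bullet> b) * ?G b (F q)"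
  have U: "open ?U" "F p \<in> ?U" by (auto simp: N.open_chart N.chart_at)
  have e: "smooth_field B ?U (extension B (F p) b)" for b by (rule N.smooth_extension)
  have G: "smooth_fun B ?U (?G b)" for b
    by (rule N.smooth_metric[OF U(1) e e])
  have GF: "smooth_fun A W0 (\<lambda>q. ?G b (F q))" for b
    by (rule M.smooth_fun_subset[OF smooth_fun_map[OF U(1) G]]) (auto simp: W0_def)
  have smooth_summand: "smooth_fun A W0 (\<lambda>q. (?z q \<bullet> b) * ?G b (F q))" for b
    by (rule M.smooth_fun_mult[OF W0(1) smooth_comp[OF Z] GF])
  have eq: "gN (F q) (extension B (F p) a (F q)) (Z q) = ?S q" if "q \<in> W0" for q
    by (subst frame_expansion[OF that, of "Z q"]) (simp add: N.g.form_sum N.g.form_simps)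
  have S: "smooth_fun A W0 ?S" by (rule M.smooth_fun_sum[OF W0(1) smooth_summand])
  show "smooth_fun A W0 (\<lambda>q. gN (F q) (extension B (F p) a (F q)) (Z q))"
    by (rule M.smooth_fun_cong[OF W0(1), THEN iffD2, OF _ S]) (rule eq)
  let ?D = "\<lambda>b. DN (F p) (tangent_map A B F p v) (extension B (F p) b)"
  have "dir_deriv A (\<lambda>q. gN (F q) (extension B (F p) a (F q)) (Z q)) p v = dir_deriv A ?S p v"
    by (rule M.dir_deriv_cong[OF W0(1,2)]) (rule eq)
  also have "\<dots> = (\<Sum>b\<in>Basis. (Z p \<bullet> b) * (gN (F p) (?D a) b + gN (F p) a (?D b)) +
      (dir_deriv A ?z p v \<bullet> b) * gN (F p) a b)"
    by (simp add: M.dir_deriv_sum[OF W0(1,2) smooth_summand] M.dir_deriv_mult[OF W0(1,2) smooth_comp[OF Z] GF]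
        dir_deriv_comp[OF Z] dir_deriv_map[OF U G] N.metric_connection[OF U e e])
  also have "\<dots> = gN (F p) (?D a) (\<Sum>b\<in>Basis. (Z p \<bullet> b) *\<^sub>R b) +
      gN (F p) a ((\<Sum>b\<in>Basis. (dir_deriv A ?z p v \<bullet> b) *\<^sub>R b) + (\<Sum>b\<in>Basis. (Z p \<bullet> b) *\<^sub>R ?D b))"
    by (simp add: N.g.form_sum N.g.form_simps sum.distrib algebra_simps)
  also have "\<dots> = gN (F p) (?D a) (Z p) + gN (F p) a (DF p v Z)"
    by (simp add: euclidean_representation DF_eq[OF Z])
  finally show "dir_deriv A (\<lambda>q. gN (F q) (extension B (F p) a (F q)) (Z q)) p v =
      gN (F p) (?D a) (Z p) + gN (F p) a (DF p v Z)" .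
qed

lemma smooth_metric_along_aux:
  assumes Y: "smooth_section_along A B F W Y" and Z: "smooth_section_along A B F W Z"
  shows "smooth_fun A W0 (\<lambda>q. gN (F q) (Y q) (Z q))"
    and "dir_deriv A (\<lambda>q. gN (F q) (Y q) (Z q)) p v = gN (F p) (DF p v Y) (Z p) + gN (F p) (Y p) (DF p v Z)"
proof -
  let ?y = "\<lambda>q. comps B (chart_at B (F p)) (F q) (Y q)"
  let ?e = "\<lambda>b q. extension B (F p) b (F q)"
  let ?S = "\<lambda>q. \<Sum>b\<in>Basis. (?y q \<bullet> b) * gN (F q) (?e b q) (Z q)"
  have smooth_summand: "smooth_fun A W0 (\<lambda>q. (?y q \<bullet> b) * gN (F q) (?e b q) (Z q))" for b
    by (rule M.smooth_fun_mult[OF W0(1) smooth_comp[OF Y] smooth_metric_frame(1)[OF Z]])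
  have eq: "gN (F q) (Y q) (Z q) = ?S q" if "q \<in> W0" for q
    by (subst frame_expansion[OF that, of "Y q"]) (simp add: N.g.form_sum N.g.form_simps)
  have S: "smooth_fun A W0 ?S" by (rule M.smooth_fun_sum[OF W0(1) smooth_summand])
  show "smooth_fun A W0 (\<lambda>q. gN (F q) (Y q) (Z q))"
    by (rule M.smooth_fun_cong[OF W0(1), THEN iffD2, OF _ S]) (rule eq)
  let ?D = "\<lambda>b. DN (F p) (tangent_map A B F p v) (extension B (F p) b)"
  have "dir_deriv A (\<lambda>q. gN (F q) (Y q) (Z q)) p v = dir_deriv A ?S p v"
    by (rule M.dir_deriv_cong[OF W0(1,2)]) (rule eq)
  also have "\<dots> = (\<Sum>b\<in>Basis. (Y p \<bullet> b) * (gN (F p) (?D b) (Z p) + gN (F p) b (DF p v Z)) +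
      (dir_deriv A ?y p v \<bullet> b) * gN (F p) b (Z p))"
    by (simp add: M.dir_deriv_sum[OF W0(1,2) smooth_summand] dir_deriv_comp[OF Y] smooth_metric_frame(2)[OF Z]
        M.dir_deriv_mult[OF W0(1,2) smooth_comp[OF Y] smooth_metric_frame(1)[OF Z]])
  also have "\<dots> = gN (F p) ((\<Sum>b\<in>Basis. (dir_deriv A ?y p v \<bullet> b) *\<^sub>R b) + (\<Sum>b\<in>Basis. (Y p \<bullet> b) *\<^sub>R ?D b)) (Z p)
      + gN (F p) (\<Sum>b\<in>Basis. (Y p \<bullet> b) *\<^sub>R b) (DF p v Z)"
    by (simp add: N.g.form_sum N.g.form_simps sum.distrib algebra_simps)
  also have "\<dots> = gN (F p) (DF p v Y) (Z p) + gN (F p) (Y p) (DF p v Z)"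
    by (simp add: euclidean_representation DF_eq[OF Y])
  finally show "dir_deriv A (\<lambda>q. gN (F q) (Y q) (Z q)) p v =
    gN (F p) (DF p v Y) (Z p) + gN (F p) (Y p) (DF p v Z)" .
qed

text \<open>Coordinate fields have constant components and hence commute; vanishing torsion then
  gives the symmetry of the Christoffel symbols.\<close>

lemma DN_frame_sym:
  "DN (F p) a (extension B (F p) b) = DN (F p) b (extension B (F p) a)"
proof -
  let ?U = "fst (chart_at B (F p))"
  have U: "open ?U" "F p \<in> ?U" by (auto simp: N.open_chart N.chart_at)
  have const: "dir_deriv B (\<lambda>q. comps B (chart_at B (F p)) q (extension B (F p) c q)) (F p) v = 0" for c v
    using N.dir_deriv_cong[OF U, of "\<lambda>q. comps B (chart_at B (F p)) q (extension B (F p) c q)" "\<lambda>q. c" v]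
    by (simp add: N.comps_extension N.dir_deriv_const)
  have "DN (F p) a (extension B (F p) b) - DN (F p) b (extension B (F p) a) =
      lie_bracket B (extension B (F p) a) (extension B (F p) b) (F p)"
    using N.torsion_free[OF U N.smooth_extension N.smooth_extension] by simp
  also have "\<dots> = 0" by (simp add: lie_bracket_def const)
  finally show ?thesis by simp
qed

text \<open>In the coordinate formula the Christoffel terms are symmetric and cancel. The remaining
  derivatives are iterated derivatives of the coordinate functions of F, whose commutator is the
  derivative along the Lie bracket.\<close>

lemma DF_torsion_free:
  assumes X: "smooth_field A W X" and Y: "smooth_field A W Y"
  shows "DF p (X p) (\<lambda>q. tangent_map A B F q (Y q)) - DF p (Y p) (\<lambda>q. tangent_map A B F q (X q)) =
    tangent_map A B F p (lie_bracket A X Y p)"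
proof -
  let ?f = "\<lambda>q. snd (chart_at B (F p)) (F q)"
  have comp: "dir_deriv A (\<lambda>q. comps B (chart_at B (F p)) (F q) (tangent_map A B F q (Z q))) p v =
      dir_deriv A (\<lambda>q. dir_deriv A ?f q (Z q)) p v" for Z v
    by (rule M.dir_deriv_cong[OF W0(1,2)]) (simp add: comps_tangent_map N.chart_at W0(4))
  have f: "smooth_fun A W0 ?f"
    by (rule M.smooth_fun_subset[OF smooth_chart_map]) (auto simp: N.chart_at W0_def)
  have lie: "tangent_map A B F p (lie_bracket A X Y p) =
      dir_deriv A (\<lambda>q. dir_deriv A ?f q (Y q)) p (X p) - dir_deriv A (\<lambda>q. dir_deriv A ?f q (X q)) p (Y p)"
    unfolding tangent_map_eq
    by (rule M.dir_deriv_lie_bracket[OF W0(1,2) f]) (rule M.smooth_field_subset[OF _ W0(3)], rule X Y)+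
  have lin: "linear (\<lambda>v. DN (F p) v (extension B (F p) b))" for b
    by (rule N.linear_nabla[OF N.open_chart[OF N.chart_at_in] N.in_chart_at N.smooth_extension])
  have expand: "DN (F p) v (extension B (F p) b) = (\<Sum>a\<in>Basis. (v \<bullet> a) *\<^sub>R DN (F p) a (extension B (F p) b))" for v b
  proof -
    have "DN (F p) v (extension B (F p) b) = DN (F p) (\<Sum>a\<in>Basis. (v \<bullet> a) *\<^sub>R a) (extension B (F p) b)"
      by (simp add: euclidean_representation)
    then show ?thesis by (simp only: linear_sum[OF lin] linear_scale[OF lin])
  qed
  have swap: "(\<Sum>b\<in>Basis. (u \<bullet> b) *\<^sub>R DN (F p) v (extension B (F p) b)) =
      (\<Sum>b\<in>Basis. (v \<bullet> b) *\<^sub>R DN (F p) u (extension B (F p) b))" for u v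
    unfolding expand[of v] expand[of u] scaleR_sum_right
    by (subst sum.swap) (intro sum.cong refl, subst DN_frame_sym, simp add: mult.commute)
  show ?thesis
    unfolding DF_eq[OF smooth_tangent_map[OF W(1) X]] DF_eq[OF smooth_tangent_map[OF W(1) Y]] comp lie
    by (simp add: swap[of "tangent_map A B F p (X p)"])
qed

end

lemma smooth_metric_along:
  assumes "open W" "smooth_section_along A B F W Y" "smooth_section_along A B F W Z"
  shows "smooth_fun A W (\<lambda>q. gN (F q) (Y q) (Z q))"
proof (rule M.smooth_fun_local)
  fix p assume "p \<in> W"
  then show "\<exists>W'. open W' \<and> p \<in> W' \<and> smooth_fun A W' (\<lambda>q. gN (F q) (Y q) (Z q))"
    using W0(1,2)[OF assms(1)] smooth_metric_along_aux(1)[OF assms(1) _ assms(2,3)]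
    by (intro exI[of _ "W0 W p"]) simp
qed

lemmas DF_metric = smooth_metric_along_aux(2)

end

section \<open>Riemannian submersions\<close>

locale riemannian_submersion_setting = M: levi_civita_manifold A gM DM +
  pullback_of_levi_civita A B F DF gN DN
  for A :: "('p::{t2_space,second_countable_topology}, 'e::euclidean_space) chart set"
    and gM :: "'p \<Rightarrow> 'e \<Rightarrow> 'e \<Rightarrow> real" and DM :: "'p \<Rightarrow> 'e \<Rightarrow> ('p \<Rightarrow> 'e) \<Rightarrow> 'e"
    and B :: "('q::{t2_space,second_countable_topology}, 'f::euclidean_space) chart set"
    and F :: "'p \<Rightarrow> 'q" and DF :: "'p \<Rightarrow> 'e \<Rightarrow> ('p \<Rightarrow> 'f) \<Rightarrow> 'f"
    and gN :: "'q \<Rightarrow> 'f \<Rightarrow> 'f \<Rightarrow> real" and DN :: "'q \<Rightarrow> 'f \<Rightarrow> ('q \<Rightarrow> 'f) \<Rightarrow> 'f" +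
  assumes submersion: "riemannian_submersion A gM B gN F"
begin

abbreviation L where "L \<equiv> tangent_map A B F"
abbreviation P where "P \<equiv> vert_proj A gM B F"
abbreviation H where "H \<equiv> hor_proj A gM B F"
abbreviation ext where "ext \<equiv> extension A"
abbreviation chart_dom where "chart_dom p \<equiv> fst (chart_at A p)"

lemmas L_simps = linear_add[OF linear_tangent_map] linear_diff[OF linear_tangent_map]
  linear_scale[OF linear_tangent_map] linear_neg[OF linear_tangent_map] linear_0[OF linear_tangent_map]

lemma subspace_vertical: "subspace (vertical A B F p)"
  by (auto simp: subspace_def vertical_def L_simps)

lemma L_P [simp]: "L p (P p v) = 0"
  using M.g.orth_proj(1)[OF subspace_vertical, of p p v] by (simp add: vert_proj_def vertical_def)

lemma H_eq: "H p v = v - P p v"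
  by (simp add: hor_proj_def horizontal_def M.g.orth_proj_compl subspace_vertical vert_proj_def)

lemma L_H [simp]: "L p (H p v) = L p v"
  by (simp add: H_eq L_simps)

lemma linear_P: "linear (P p)"
  unfolding vert_proj_def by (rule M.g.linear_orth_proj[OF subspace_vertical])

lemma linear_H: "linear (H p)"
  unfolding H_eq[abs_def] by (intro linear_compose_sub linear_P linear_ident)

lemmas proj_simps = linear_add[OF linear_P] linear_diff[OF linear_P] linear_scale[OF linear_P]
  linear_0[OF linear_P] linear_neg[OF linear_P]
  linear_add[OF linear_H] linear_diff[OF linear_H] linear_scale[OF linear_H]
  linear_0[OF linear_H] linear_neg[OF linear_H]

lemma P_vertical: "L p v = 0 \<Longrightarrow> P p v = v"
  unfolding vert_proj_def
  by (rule M.g.orth_proj_eqI[OF subspace_vertical])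
    (auto simp: vertical_def orth_compl_def M.g.form_simps)

lemma P_P [simp]: "P p (P p v) = P p v" by (rule P_vertical) simp

lemma H_P [simp]: "H p (P p v) = 0" by (simp add: H_eq)

lemma P_H [simp]: "P p (H p v) = 0" by (simp add: H_eq proj_simps)

lemma H_H [simp]: "H p (H p v) = H p v" by (subst H_eq) simp

lemma P_adjoint: "gM p (P p u) v = gM p u (P p v)"
  unfolding vert_proj_def by (rule M.g.orth_proj_self_adjoint[OF subspace_vertical])

lemma H_adjoint: "gM p (H p u) v = gM p u (H p v)"
  by (simp add: H_eq M.g.form_simps P_adjoint)

lemma P_plus_H: "P p v + H p v = v" by (simp add: H_eq)

lemma horizontal_iff: "v \<in> horizontal A gM B F p \<longleftrightarrow> P p v = 0"
proof
  assume "v \<in> horizontal A gM B F p"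
  then show "P p v = 0"
    unfolding vert_proj_def horizontal_def
    by (intro M.g.orth_proj_eqI[OF subspace_vertical]) (auto simp: subspace_0[OF subspace_vertical])
next
  assume "P p v = 0"
  then show "v \<in> horizontal A gM B F p"
    using M.g.orth_proj(2)[OF subspace_vertical, of v p p] by (simp add: vert_proj_def horizontal_def)
qed

text \<open>Polarisation of the preservation of lengths. Since the differential kills vertical
  parts, the formula holds for arbitrary vectors once one of them is projected.\<close>

lemma isometry_horizontal: "gN (F p) (L p u) (L p v) = gM p (H p u) v"
proof -
  have sq: "gN (F p) (L p w) (L p w) = gM p (H p w) (H p w)" for w
  proof -
    have "H p w \<in> horizontal A gM B F p" by (simp add: horizontal_iff)
    then have "sqrt (gN (F p) (L p (H p w)) (L p (H p w))) = sqrt (gM p (H p w) (H p w))"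
      using submersion unfolding riemannian_submersion_def by blast
    then show ?thesis by simp
  qed
  have "gN (F p) (L p u) (L p v) = gM p (H p u) (H p v)"
    using sq[of "u + v"] sq[of u] sq[of v] N.g.sym[of "F p" "L p u" "L p v"] M.g.sym[of p "H p u" "H p v"]
    by (simp add: L_simps proj_simps N.g.form_simps M.g.form_simps)
  also have "\<dots> = gM p (H p u) v" using H_adjoint[of p "H p u" v] by simp
  finally show ?thesis .
qed

text \<open>In a local orthogonal frame the coefficients of HX are g_M(HX, E_b) / g_M(E_b, E_b). The
  numerator equals g_N(dF X, dF E_b), in which no projection occurs any more.\<close>

lemma smooth_H:
  assumes W: "open W" and X: "smooth_field A W X"
  shows "smooth_field A W (\<lambda>q. H q (X q))"
proof (rule M.smooth_field_local)
  fix p assume p: "p \<in> W"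
  let ?W = "W \<inter> chart_dom p"
  have W': "open ?W" "p \<in> ?W" using W p by (auto simp: M.open_chart M.chart_at)
  obtain E :: "'e \<Rightarrow> 'p \<Rightarrow> 'e" where sm: "\<And>b. b \<in> Basis \<Longrightarrow> smooth_field A (chart_dom p) (E b)"
    and nz: "\<And>q b. q \<in> chart_dom p \<Longrightarrow> b \<in> Basis \<Longrightarrow> E b q \<noteq> 0"
    and orth: "\<And>q a b. q \<in> chart_dom p \<Longrightarrow> a \<in> Basis \<Longrightarrow> b \<in> Basis \<Longrightarrow> a \<noteq> b \<Longrightarrow> gM q (E a q) (E b q) = 0"
    using M.orthogonal_frame by metis
  have smE: "smooth_field A ?W (E b)" if "b \<in> Basis" for b
    by (rule M.smooth_field_subset[OF sm[OF that]]) auto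
  have smX: "smooth_field A ?W X" by (rule M.smooth_field_subset[OF X]) auto
  have "smooth_field A ?W (\<lambda>q. \<Sum>b\<in>Basis. (gN (F q) (L q (X q)) (L q (E b q)) *
      inverse (gM q (E b q) (E b q))) *\<^sub>R E b q)"
    by (intro M.smooth_field_sum M.smooth_field_scaleR M.smooth_fun_mult M.smooth_fun_inverse
        M.smooth_metric smooth_metric_along smooth_tangent_map smE smX W')
      (use nz M.g.form_eq_0 in auto)
  then have "smooth_field A ?W (\<lambda>q. H q (X q))"
  proof (rule M.smooth_field_cong[OF W'(1), THEN iffD1, rotated])
    fix q assume q: "q \<in> ?W"
    show "(\<Sum>b\<in>Basis. (gN (F q) (L q (X q)) (L q (E b q)) *
      inverse (gM q (E b q) (E b q))) *\<^sub>R E b q) = H q (X q)"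
      unfolding isometry_horizontal
      by (rule M.g.orthogonal_expansion(2)[symmetric]) (use q orth nz in auto)
  qed
  then show "\<exists>W'. open W' \<and> p \<in> W' \<and> smooth_field A W' (\<lambda>q. H q (X q))" using W' by blast
qed

lemma smooth_P:
  assumes W: "open W" and X: "smooth_field A W X"
  shows "smooth_field A W (\<lambda>q. P q (X q))"
  using M.smooth_field_diff[OF W X smooth_H[OF W X]] by (simp add: H_eq)

lemma chart_dom: "open (chart_dom p)" "p \<in> chart_dom p" by (auto simp: M.open_chart M.chart_at)

lemma smooth_proj_ext:
  "smooth_field A (chart_dom p) (\<lambda>q. P q (ext p v q))" "smooth_field A (chart_dom p) (\<lambda>q. H q (ext p v q))"
  by (rule smooth_P smooth_H, rule chart_dom, rule M.smooth_extension)+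

section \<open>The second fundamental form and the mean curvature of the fibres\<close>

abbreviation sff where "sff \<equiv> second_fundamental_form A B F DM DF"

definition \<sigma> :: "'p \<Rightarrow> 'e \<Rightarrow> 'e \<Rightarrow> 'f" where
  "\<sigma> p u v = sff (ext p u) (ext p v) p"

lemma sff_sym:
  assumes W: "open W" "p \<in> W" and X: "smooth_field A W X" and Y: "smooth_field A W Y"
  shows "sff X Y p = sff Y X p"
  using DF_torsion_free[OF W X Y] M.torsion_free[OF W Y X, symmetric]
  by (simp add: second_fundamental_form_def L_simps algebra_simps)

text \<open>Symmetry turns tensoriality in the first argument into tensoriality in the second.\<close>

lemma sff_eq:
  assumes W: "open W" "p \<in> W" and X: "smooth_field A W X" and Y: "smooth_field A W Y"
  shows "sff X Y p = \<sigma> p (X p) (Y p)"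
proof -
  let ?W = "W \<inter> chart_dom p"
  have W': "open ?W" "p \<in> ?W" using W chart_dom by auto
  have e: "smooth_field A ?W (ext p v)" for v by (rule M.smooth_field_subset[OF M.smooth_extension]) auto
  have Y': "smooth_field A ?W Y" by (rule M.smooth_field_subset[OF Y]) auto
  have "sff X Y p = sff (ext p (X p)) Y p" by (simp add: second_fundamental_form_def)
  also have "\<dots> = sff Y (ext p (X p)) p" by (rule sff_sym[OF W' e Y'])
  also have "\<dots> = sff (ext p (Y p)) (ext p (X p)) p" by (simp add: second_fundamental_form_def)
  also have "\<dots> = \<sigma> p (X p) (Y p)" unfolding \<sigma>_def by (rule sff_sym[OF W' e e])
  finally show ?thesis .
qed

lemma \<sigma>_sym: "\<sigma> p u v = \<sigma> p v u"
  unfolding \<sigma>_def by (rule sff_sym[OF chart_dom M.smooth_extension M.smooth_extension])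

lemma linear_\<sigma>: "linear (\<lambda>u. \<sigma> p u v)" "linear (\<sigma> p u)"
proof -
  have 1: "linear (\<lambda>u. DF p u (\<lambda>q. L q (ext p v q)))" for v
    by (rule linear_D[OF chart_dom smooth_tangent_map[OF chart_dom(1) M.smooth_extension]])
  have 2: "linear (\<lambda>u. DM p u (ext p v))" for v
    by (rule M.linear_nabla[OF chart_dom M.smooth_extension])
  show l: "linear (\<lambda>u. \<sigma> p u v)" for v
    unfolding \<sigma>_def second_fundamental_form_def M.extension_self
    by (rule linear_compose_sub[OF 1 linear_compose[OF 2 linear_tangent_map, unfolded o_def]])
  have "\<sigma> p u = (\<lambda>v. \<sigma> p v u)" by (rule HOL.ext) (rule \<sigma>_sym)
  with l[of u] show "linear (\<sigma> p u)" by simp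
qed

lemmas \<sigma>_simps = linear_add[OF linear_\<sigma>(1)] linear_add[OF linear_\<sigma>(2)] linear_0[OF linear_\<sigma>(1)]
  linear_0[OF linear_\<sigma>(2)]

text \<open>For horizontal fields g_M(Y, Z) = g_N(dF Y, dF Z) as functions. Differentiating both
  sides along X with the two metric connections and subtracting leaves the second fundamental
  form.\<close>

lemma sff_skew:
  assumes W: "open W" "p \<in> W" and Y: "smooth_field A W Y" and Z: "smooth_field A W Z"
    and hor: "\<And>q. q \<in> W \<Longrightarrow> H q (Y q) = Y q" "\<And>q. q \<in> W \<Longrightarrow> H q (Z q) = Z q"
  shows "gN (F p) (sff X Y p) (L p (Z p)) = - gN (F p) (sff X Z p) (L p (Y p))"
proof -
  note LY = smooth_tangent_map[OF W(1) Y] and LZ = smooth_tangent_map[OF W(1) Z]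
  have "dir_deriv A (\<lambda>q. gM q (Y q) (Z q)) p (X p) = dir_deriv A (\<lambda>q. gN (F q) (L q (Y q)) (L q (Z q))) p (X p)"
    by (rule M.dir_deriv_cong[OF W]) (simp add: isometry_horizontal hor)
  then have "gM p (DM p (X p) Y) (Z p) + gM p (Y p) (DM p (X p) Z) =
      gN (F p) (DF p (X p) (\<lambda>q. L q (Y q))) (L p (Z p)) + gN (F p) (L p (Y p)) (DF p (X p) (\<lambda>q. L q (Z q)))"
    by (simp add: M.metric_connection[OF W Z Y] DF_metric[OF W LY LZ])
  moreover have "gN (F p) (L p u) (L p (Z p)) = gM p u (Z p)" "gN (F p) (L p u) (L p (Y p)) = gM p (Y p) u" for u
    using hor W by (simp_all add: isometry_horizontal H_adjoint M.g.sym[of p u "Y p"])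
  ultimately show ?thesis
    by (simp add: second_fundamental_form_def N.g.form_simps N.g.sym[of "F p" "L p (Y p)"])
qed

lemma \<sigma>_horizontal: "\<sigma> p (H p u) (H p v) = 0"
proof -
  define t where "t u v w = gN (F p) (\<sigma> p (H p u) (H p v)) (L p w)" for u v w
  have skew: "t u v w = - t u w v" for u v w
  proof -
    let ?h = "\<lambda>v q. H q (ext p v q)"
    note s = smooth_proj_ext(2)
    have "gN (F p) (sff (?h u) (?h v) p) (L p (?h w p)) = - gN (F p) (sff (?h u) (?h w) p) (L p (?h v p))"
      by (rule sff_skew[OF chart_dom s s]) simp_all
    then show ?thesis by (simp add: sff_eq[OF chart_dom s s] t_def)
  qed
  have sym: "t u v w = t v u w" for u v w by (simp add: t_def \<sigma>_sym)
  \<comment> \<open>Alternating the two rules six times passes through all orders of the arguments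
    and returns to t u v w with the opposite sign.\<close>
  have t0: "t u v w = 0" for w
    using skew[of u v w] sym[of u w v] skew[of w u v] sym[of w v u] skew[of v w u] sym[of v u w] by linarith
  \<comment> \<open>Surjectivity of the differential allows the form to be tested against its own
    value.\<close>
  obtain w where "L p w = \<sigma> p (H p u) (H p v)"
    using submersion unfolding riemannian_submersion_def by (metis surjD)
  then have "gN (F p) (\<sigma> p (H p u) (H p v)) (\<sigma> p (H p u) (H p v)) = 0"
    using t0[of w] by (simp add: t_def)
  then show ?thesis by (simp add: N.g.form_eq_0)
qed

text \<open>O'Neill's tensor \<open>\<T>\<^sub>u v\<close> on the vertical parts of \<open>u\<close> and \<open>v\<close>.\<close>

definition II :: "'p \<Rightarrow> 'e \<Rightarrow> 'e \<Rightarrow> 'e" where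
  "II p u v = H p (DM p (P p u) (\<lambda>q. P q (ext p v q)))"

text \<open>The differential of F annihilates a vertical field identically, so the pullback term is
  the derivative of the zero section.\<close>

lemma \<sigma>_vertical: "\<sigma> p (P p u) (P p v) = - L p (II p u v)"
proof -
  have "\<sigma> p (P p u) (P p v) = sff (\<lambda>q. P q (ext p u q)) (\<lambda>q. P q (ext p v q)) p"
    by (simp add: sff_eq[OF chart_dom smooth_proj_ext(1) smooth_proj_ext(1)])
  then show ?thesis by (simp add: second_fundamental_form_def II_def D_zero[OF open_UNIV])
qed

lemma H_II [simp]: "H p (II p u v) = II p u v" by (simp add: II_def)

lemma eq_0_horizontal: "H p w = w \<Longrightarrow> L p w = 0 \<Longrightarrow> w = 0"
  by (metis H_P P_vertical)

text \<open>Inherited from the symmetry of \<sigma>, because the differential is injective on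
  horizontal vectors; integrability of the vertical distribution is not invoked.\<close>

lemma II_sym: "II p u v = II p v u"
proof -
  have "L p (II p u v - II p v u) = 0"
    using \<sigma>_vertical[of p u v] \<sigma>_vertical[of p v u] \<sigma>_sym[of p "P p u"] by (simp add: L_simps)
  then have "II p u v - II p v u = 0" by (intro eq_0_horizontal) (simp_all add: proj_simps)
  then show ?thesis by simp
qed

lemma linear_II: "linear (\<lambda>u. II p u v)" "linear (II p u)"
proof -
  show l: "linear (\<lambda>u. II p u v)" for v
    unfolding II_def
    using linear_compose[OF linear_compose[OF linear_P M.linear_nabla[OF chart_dom smooth_proj_ext(1)]] linear_H]
    by (simp add: o_def)
  have "II p u = (\<lambda>v. II p v u)" by (rule HOL.ext) (rule II_sym)
  with l[of u] show "linear (II p u)" by simp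
qed

lemma II_P: "II p (P p u) v = II p u v" "II p u (P p v) = II p u v"
proof -
  show l: "II p (P p u) v = II p u v" for u v by (simp add: II_def)
  then show "II p u (P p v) = II p u v" using II_sym by metis
qed

text \<open>Literally the choice made in \<open>metric_trace\<close>, so sums over this set are the
  trace in the definition of harmonicity.\<close>

definition orthonormal :: "'p \<Rightarrow> 'e set" where
  "orthonormal p = (SOME S. orthonormal_basis (gM p) S)"

lemma orthonormal: "orthonormal_basis (gM p) (orthonormal p)"
  unfolding orthonormal_def using M.exists_orthonormal_basis by (rule someI_ex)

text \<open>The mean curvature vector h of the fibre, without normalisation. The sum may run over a
  basis of the whole tangent space because \<open>II\<close> ignores horizontal parts.\<close>

definition mean :: "'p \<Rightarrow> 'e" where
  "mean p = (\<Sum>e\<in>orthonormal p. II p e e)"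

lemma H_mean: "H p (mean p) = mean p"
  by (simp add: mean_def linear_sum[OF linear_H])

lemma trace_\<sigma>: "metric_trace (gM p) (\<sigma> p) = - L p (mean p)"
proof -
  \<comment> \<open>The basis is not adapted to the splitting, so single mixed terms need not
    vanish. Moving the self-adjoint \<open>H\<close> to the other slot produces \<open>P\<close>
    after \<open>H\<close>, which is 0.\<close>
  have mixed: "(\<Sum>e\<in>orthonormal p. \<sigma> p (P p e) (H p e)) = 0"
  proof -
    have "(\<Sum>e\<in>orthonormal p. \<sigma> p (P p e) (H p e)) = (\<Sum>e\<in>orthonormal p. \<sigma> p (P p (H p e)) e)"
      by (rule M.g.adjoint_transfer[OF orthonormal _ linear_\<sigma>(2) H_adjoint])
        (rule linear_compose[OF linear_P linear_\<sigma>(1), unfolded o_def])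
    then show ?thesis by (simp add: \<sigma>_simps)
  qed
  have "\<sigma> p e e = \<sigma> p (P p e) (P p e) + 2 *\<^sub>R \<sigma> p (P p e) (H p e)" for e
  proof -
    have "\<sigma> p e e = \<sigma> p (P p e + H p e) (P p e + H p e)" by (simp only: P_plus_H)
    also have "\<dots> = \<sigma> p (P p e) (P p e) + \<sigma> p (P p e) (H p e) + (\<sigma> p (H p e) (P p e) + \<sigma> p (H p e) (H p e))"
      by (simp only: \<sigma>_simps add_ac)
    finally show ?thesis by (simp add: \<sigma>_horizontal \<sigma>_sym[of p "H p e"] scaleR_2)
  qed
  then have "metric_trace (gM p) (\<sigma> p) = (\<Sum>e\<in>orthonormal p. - L p (II p e e))"
    using mixed
    by (simp add: metric_trace_def \<sigma>_vertical sum_subtractf sum_negf flip: orthonormal_def scaleR_sum_right)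
  also have "\<dots> = - L p (mean p)"
    by (simp add: mean_def sum_negf linear_sum[OF linear_tangent_map])
  finally show ?thesis .
qed

lemma harmonic_iff: "harmonic A gM B F DM DF \<longleftrightarrow> (\<forall>p. mean p = 0)"
proof -
  have "L p (mean p) = 0 \<longleftrightarrow> mean p = 0" for p
    using eq_0_horizontal[OF H_mean] by (auto simp: L_simps)
  moreover have "metric_trace (gM p) (\<lambda>u v. sff (ext p u) (ext p v) p) = - L p (mean p)" for p
    using trace_\<sigma>[of p] by (simp add: \<sigma>_def[abs_def])
  ultimately show ?thesis by (simp add: harmonic_def)
qed

text \<open>The extension of \<open>v\<close> is projected before it is cut off, since away from
  \<open>p\<close> it need not be vertical; multiplication by the bump function preserves
  verticality.\<close>

lemma exists_vertical_field:
  assumes "L p v = 0"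
  shows "\<exists>V\<in>vertical_fields A B F. V p = v"
proof -
  obtain \<beta> K where \<beta>: "smooth_fun A UNIV \<beta>" "\<beta> p = 1" "closed K" "K \<subseteq> chart_dom p" "\<And>q. q \<notin> K \<Longrightarrow> \<beta> q = (0::real)"
    using M.exists_bump[of p] by metis
  define V where "V q = \<beta> q *\<^sub>R P q (ext p v q)" for q
  have 1: "smooth_field A (chart_dom p) V"
    unfolding V_def by (intro M.smooth_field_scaleR chart_dom smooth_proj_ext M.smooth_fun_subset[OF \<beta>(1)]) auto
  have 2: "smooth_field A (- K) V"
    by (rule M.smooth_field_cong[THEN iffD1, rotated 2, OF M.smooth_field_zero])
      (use \<beta> in \<open>auto simp: V_def\<close>)
  have "smooth_field A UNIV V"
  proof (rule M.smooth_field_local)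
    fix q
    show "\<exists>W'. open W' \<and> q \<in> W' \<and> smooth_field A W' V"
      using 1 2 \<beta>(3,4) chart_dom(1)[of p] by (cases "q \<in> K") auto
  qed
  moreover have "V q \<in> vertical A B F q" for q by (simp add: V_def vertical_def L_simps)
  moreover have "V p = v" using \<beta>(2) P_vertical[OF assms] by (simp add: V_def)
  ultimately show ?thesis by (auto simp: vertical_fields_def)
qed

text \<open>\<open>trace_phi_T\<close> evaluates O'Neill's tensor on extensions of vectors;
  linearity in the vector is what allows its trace to be computed in an orthonormal basis.\<close>

lemma linear_nabla_proj:
  "linear (\<lambda>e. DM p v (\<lambda>q. P q (ext p e q)))" "linear (\<lambda>e. DM p v (\<lambda>q. H q (ext p e q)))"
proof -
  note sP = smooth_proj_ext(1) and sH = smooth_proj_ext(2)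
  note aP = M.smooth_field_add[OF chart_dom(1) sP sP] and aH = M.smooth_field_add[OF chart_dom(1) sH sH]
  note cP = M.smooth_field_scaleR[OF chart_dom(1) M.smooth_fun_const sP] and cH = M.smooth_field_scaleR[OF chart_dom(1) M.smooth_fun_const sH]
  show "linear (\<lambda>e. DM p v (\<lambda>q. P q (ext p e q)))"
  proof (rule linearI)
    fix a b :: 'e and c :: real
    have "DM p v (\<lambda>q. P q (ext p (a + b) q)) = DM p v (\<lambda>q. P q (ext p a q) + P q (ext p b q))"
      by (rule M.nabla_cong[OF chart_dom aP]) (simp add: linear_add[OF M.linear_extension] proj_simps)
    then show "DM p v (\<lambda>q. P q (ext p (a + b) q)) = DM p v (\<lambda>q. P q (ext p a q)) + DM p v (\<lambda>q. P q (ext p b q))"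
      by (simp add: M.nabla_add[OF chart_dom sP sP])
    have "DM p v (\<lambda>q. P q (ext p (c *\<^sub>R a) q)) = DM p v (\<lambda>q. c *\<^sub>R P q (ext p a q))"
      by (rule M.nabla_cong[OF chart_dom cP]) (simp add: linear_scale[OF M.linear_extension] proj_simps)
    then show "DM p v (\<lambda>q. P q (ext p (c *\<^sub>R a) q)) = c *\<^sub>R DM p v (\<lambda>q. P q (ext p a q))"
      by (simp add: M.nabla_scale[OF chart_dom sP])
  qed
  show "linear (\<lambda>e. DM p v (\<lambda>q. H q (ext p e q)))"
  proof (rule linearI)
    fix a b :: 'e and c :: real
    have "DM p v (\<lambda>q. H q (ext p (a + b) q)) = DM p v (\<lambda>q. H q (ext p a q) + H q (ext p b q))"
      by (rule M.nabla_cong[OF chart_dom aH]) (simp add: linear_add[OF M.linear_extension] proj_simps)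
    then show "DM p v (\<lambda>q. H q (ext p (a + b) q)) = DM p v (\<lambda>q. H q (ext p a q)) + DM p v (\<lambda>q. H q (ext p b q))"
      by (simp add: M.nabla_add[OF chart_dom sH sH])
    have "DM p v (\<lambda>q. H q (ext p (c *\<^sub>R a) q)) = DM p v (\<lambda>q. c *\<^sub>R H q (ext p a q))"
      by (rule M.nabla_cong[OF chart_dom cH]) (simp add: linear_scale[OF M.linear_extension] proj_simps)
    then show "DM p v (\<lambda>q. H q (ext p (c *\<^sub>R a) q)) = c *\<^sub>R DM p v (\<lambda>q. H q (ext p a q))"
      by (simp add: M.nabla_scale[OF chart_dom sH])
  qed
qed

text \<open>Skewness of \<open>\<T>\<^sub>U\<close>, from differentiating g(HX, PY) = 0 along a
  vertical vector: the horizontal-to-vertical half is minus the adjoint of the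
  vertical-to-horizontal half.\<close>

lemma nabla_H_adjoint_II:
  "gM p (P p (DM p (P p u) (\<lambda>q. H q (ext p v q)))) w = - gM p v (II p u w)"
proof -
  have "dir_deriv A (\<lambda>q. gM q (H q (ext p v q)) (P q (ext p w q))) p (P p u) = 0"
    by (simp add: H_adjoint M.g.form_simps M.dir_deriv_const)
  then have "gM p (DM p (P p u) (\<lambda>q. H q (ext p v q))) (P p w) + gM p (H p v) (DM p (P p u) (\<lambda>q. P q (ext p w q))) = 0"
    by (simp add: M.metric_connection[OF chart_dom smooth_proj_ext(1) smooth_proj_ext(2)])
  then show ?thesis by (simp add: II_def P_adjoint H_adjoint)
qed

end

section \<open>Anti-invariant submersions from cosymplectic manifolds\<close>

locale anti_invariant_submersion = riemannian_submersion_setting A gM DM B F DF gN DN +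
  M: cosymplectic_manifold A gM DM \<phi> \<xi> \<eta>
  for A :: "('p::{t2_space,second_countable_topology}, 'e::euclidean_space) chart set"
    and gM :: "'p \<Rightarrow> 'e \<Rightarrow> 'e \<Rightarrow> real" and DM :: "'p \<Rightarrow> 'e \<Rightarrow> ('p \<Rightarrow> 'e) \<Rightarrow> 'e"
    and B :: "('q::{t2_space,second_countable_topology}, 'f::euclidean_space) chart set"
    and F :: "'p \<Rightarrow> 'q" and DF :: "'p \<Rightarrow> 'e \<Rightarrow> ('p \<Rightarrow> 'f) \<Rightarrow> 'f"
    and gN :: "'q \<Rightarrow> 'f \<Rightarrow> 'f \<Rightarrow> real" and DN :: "'q \<Rightarrow> 'f \<Rightarrow> ('q \<Rightarrow> 'f) \<Rightarrow> 'f"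
    and \<phi> :: "'p \<Rightarrow> 'e \<Rightarrow> 'e" and \<xi> :: "'p \<Rightarrow> 'e" and \<eta> :: "'p \<Rightarrow> 'e \<Rightarrow> real" +
  assumes anti_invariant: "anti_invariant A \<phi> gM B F"
    and direct_sum: "\<And>p. is_direct_sum (horizontal A gM B F p) (\<phi> p ` vertical A B F p) (span {\<xi> p})"
begin

lemma H_phi_P [simp]: "H p (\<phi> p (P p v)) = \<phi> p (P p v)"
proof -
  have "P p v \<in> vertical A B F p" by (simp add: vertical_def)
  then have "\<phi> p (P p v) \<in> horizontal A gM B F p"
    using anti_invariant unfolding anti_invariant_def by blast
  then show ?thesis by (simp add: horizontal_iff H_eq)
qed

text \<open>Since 0 = \<phi> 0 lies in the first summand of the horizontal space, the second summand
  is itself horizontal.\<close>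

lemma P_xi [simp]: "P p (\<xi> p) = 0"
proof -
  have "0 \<in> \<phi> p ` vertical A B F p"
    using subspace_0[OF subspace_vertical, of p] M.phi_simps(5)[of p] by (metis imageI)
  then have "0 + \<xi> p \<in> horizontal A gM B F p"
    using direct_sum[of p] span_base[of "\<xi> p" "{\<xi> p}"] unfolding is_direct_sum_def by blast
  then show ?thesis by (simp add: horizontal_iff)
qed

lemma H_xi [simp]: "H p (\<xi> p) = \<xi> p" by (simp add: H_eq)

text \<open>Anti-invariance makes g(\<phi>V, W) vanish for vertical V and W. Differentiating along U
  with \<nabla>\<phi> = 0 gives g(\<nabla>_U V, \<phi>W) = g(\<nabla>_U W, \<phi>V), and \<phi>W,
  \<phi>V see only horizontal parts. Together with \<open>II_sym\<close> this is total
  symmetry.\<close>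

lemma II_phi_sym: "gM p (II p u v) (\<phi> p (P p w)) = gM p (II p u w) (\<phi> p (P p v))"
proof -
  let ?V = "\<lambda>v q. P q (ext p v q)"
  note s = smooth_proj_ext(1)
  have "gM q (\<phi> q (?V v q)) (?V w q) = 0" for q
    using H_adjoint[of q "\<phi> q (?V v q)" "?V w q"] by (simp add: M.g.form_simps)
  then have "dir_deriv A (\<lambda>q. gM q (\<phi> q (?V v q)) (?V w q)) p (P p u) = 0"
    by (simp add: M.dir_deriv_const)
  then have "gM p (\<phi> p (DM p (P p u) (?V v))) (P p w) + gM p (\<phi> p (P p v)) (DM p (P p u) (?V w)) = 0"
    by (simp add: M.metric_connection[OF chart_dom s M.smooth_phi[OF chart_dom(1) s]] M.nabla_phi_eq[OF chart_dom s])
  moreover have "gM p (II p u z) (\<phi> p (P p x)) = gM p (DM p (P p u) (?V z)) (\<phi> p (P p x))" for x z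
    by (simp add: II_def H_adjoint)
  ultimately show ?thesis
    by (simp add: M.phi_skew[of p "DM p (P p u) (?V v)"] M.g.sym[of p "\<phi> p (P p v)"])
qed

text \<open>Differentiate g(V, \<xi>) = 0 for vertical V, using \<nabla>\<xi> = 0.\<close>

lemma mean_xi: "gM p (mean p) (\<xi> p) = 0"
proof -
  have "gM p (II p u v) (\<xi> p) = 0" for u v
  proof -
    have "gM q (P q (ext p v q)) (\<xi> q) = 0" for q by (simp add: P_adjoint M.g.form_simps)
    then have "dir_deriv A (\<lambda>q. gM q (P q (ext p v q)) (\<xi> q)) p (P p u) = 0"
      by (simp add: M.dir_deriv_const)
    then have "gM p (DM p (P p u) (\<lambda>q. P q (ext p v q))) (\<xi> p) = 0"
      by (simp add: M.metric_connection[OF chart_dom M.smooth_xi smooth_proj_ext(1)] M.nabla_xi_eq M.g.form_simps)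
    then show ?thesis by (simp add: II_def H_adjoint)
  qed
  then show ?thesis by (simp add: mean_def M.g.form_sum)
qed

lemma trace_phi_T_eq:
  assumes V: "V \<in> vertical_fields A B F"
  shows "trace_phi_T A \<phi> gM B F DM V p = - 2 * gM p (mean p) (\<phi> p (V p))"
proof -
  define v where "v = V p"
  have v: "P p v = v" using V by (intro P_vertical) (simp add: v_def vertical_fields_def vertical_def)
  \<comment> \<open>The value of O'Neill's tensor on the horizontal part of \<open>e\<close>;
    \<open>II p v e\<close> is its value on the vertical part.\<close>
  define Q where "Q e = P p (DM p v (\<lambda>q. H q (ext p e q)))" for e
  have lin: "linear (\<lambda>e. \<phi> p (II p v e + Q e))"
    unfolding Q_def
    by (intro linear_compose[OF _ M.linear_phi, unfolded o_def] linear_compose_add linear_II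
        linear_compose[OF _ linear_P, unfolded o_def] linear_nabla_proj)
  let ?S = "orthonormal p"
  have "trace_phi_T A \<phi> gM B F DM V p = endo_trace (\<lambda>e. \<phi> p (II p v e + Q e))"
    by (simp add: trace_phi_T_def oneill_T_def II_def Q_def v flip: v_def)
  also have "\<dots> = (\<Sum>e\<in>?S. gM p (\<phi> p (II p v e + Q e)) e)"
    by (rule M.g.endo_trace_orthonormal[OF orthonormal lin])
  also have "\<dots> = - (\<Sum>e\<in>?S. gM p (II p v e) (\<phi> p e)) + (\<Sum>e\<in>?S. gM p e (II p v (\<phi> p e)))"
  proof -
    have "gM p (Q e) w = - gM p e (II p v w)" for e w
      using nabla_H_adjoint_II[of p v e w] by (simp add: Q_def v)
    then show ?thesis by (simp add: M.phi_skew M.g.form_simps sum_subtractf)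
  qed
  \<comment> \<open>The adjoint of \<phi> is -\<phi>: moved across, the horizontal-to-vertical half
    becomes a second copy of the other half, whence the factor 2.\<close>
  also have "(\<Sum>e\<in>?S. gM p e (II p v (\<phi> p e))) = (\<Sum>e\<in>?S. gM p (- \<phi> p e) (II p v e))"
    by (rule M.g.adjoint_transfer[OF orthonormal])
      (auto intro: M.g.linear_form linear_compose[OF linear_II(2) M.g.linear_form(1), unfolded o_def]
        simp: M.phi_skew M.g.form_simps)
  also have "\<dots> = - (\<Sum>e\<in>?S. gM p (II p v e) (\<phi> p e))"
    by (simp add: M.g.form_simps sum_negf M.g.sym)
  finally have "trace_phi_T A \<phi> gM B F DM V p = - 2 * (\<Sum>e\<in>?S. gM p (II p v e) (\<phi> p e))" by simp
  also have "(\<Sum>e\<in>?S. gM p (II p v e) (\<phi> p e)) = (\<Sum>e\<in>?S. gM p (II p v (P p e)) (\<phi> p e))"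
    by (simp add: II_P)
  \<comment> \<open>The projection is moved from \<open>II\<close> onto the argument of \<phi>,
    because \<open>II_phi_sym\<close> needs vertical vectors there; the total symmetry then puts
    both copies of \<open>e\<close> into \<open>II\<close>.\<close>
  also have "\<dots> = (\<Sum>e\<in>?S. gM p (II p v e) (\<phi> p (P p e)))"
    by (rule M.g.adjoint_transfer[OF orthonormal _ _ P_adjoint, where \<beta> = "\<lambda>u w. gM p (II p v w) (\<phi> p u)"])
      (auto intro: linear_compose[OF M.linear_phi M.g.linear_form(1), unfolded o_def]
        linear_compose[OF linear_II(2) M.g.linear_form(2), unfolded o_def])
  also have "\<dots> = (\<Sum>e\<in>?S. gM p (II p e e) (\<phi> p (P p v)))"
    by (rule sum.cong[OF refl]) (subst II_sym, rule II_phi_sym)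
  also have "\<dots> = gM p (mean p) (\<phi> p v)" by (simp add: mean_def M.g.form_sum v)
  finally show ?thesis by (simp add: v_def)
qed

lemma harmonic_iff_trace:
  "harmonic A gM B F DM DF \<longleftrightarrow> (\<forall>V\<in>vertical_fields A B F. \<forall>p. trace_phi_T A \<phi> gM B F DM V p = 0)"
proof
  assume "harmonic A gM B F DM DF"
  then show "\<forall>V\<in>vertical_fields A B F. \<forall>p. trace_phi_T A \<phi> gM B F DM V p = 0"
    by (simp add: harmonic_iff trace_phi_T_eq M.g.form_simps)
next
  assume tr: "\<forall>V\<in>vertical_fields A B F. \<forall>p. trace_phi_T A \<phi> gM B F DM V p = 0"
  have "mean p = 0" for p
  proof -
    have "mean p \<in> horizontal A gM B F p"
      using H_mean[of p] by (simp add: horizontal_iff H_eq)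
    then obtain w z where "w \<in> vertical A B F p" "z \<in> span {\<xi> p}" and m: "mean p = \<phi> p w + z"
      using direct_sum[of p] unfolding is_direct_sum_def by blast
    then obtain c where z: "z = c *\<^sub>R \<xi> p" by (auto simp: span_singleton)
    obtain V where "V \<in> vertical_fields A B F" "V p = w"
      using exists_vertical_field \<open>w \<in> vertical A B F p\<close> by (auto simp: vertical_def)
    then have "gM p (mean p) (\<phi> p w) = 0" using tr trace_phi_T_eq[of V p] by auto
    \<comment> \<open>The second argument is \<open>mean p\<close> itself, so its length is
      0.\<close>
    then have "gM p (mean p) (\<phi> p w + z) = 0" by (simp add: z M.g.form_simps mean_xi)
    then show ?thesis using m M.g.form_eq_0 by simp
  qed
  then show "harmonic A gM B F DM DF" by (simp add: harmonic_iff)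
qed

end

theorem theorem16:
  fixes AM :: "('p::{t2_space,second_countable_topology}, 'e::euclidean_space) chart set"
    and AN :: "('q::{t2_space,second_countable_topology}, 'f::euclidean_space) chart set"
    and \<phi> :: "'p \<Rightarrow> 'e \<Rightarrow> 'e" and \<xi> :: "'p \<Rightarrow> 'e" and \<eta> :: "'p \<Rightarrow> 'e \<Rightarrow> real"
    and gM :: "'p \<Rightarrow> 'e \<Rightarrow> 'e \<Rightarrow> real" and gN :: "'q \<Rightarrow> 'f \<Rightarrow> 'f \<Rightarrow> real"
    and F :: "'p \<Rightarrow> 'q"
    and nablaM :: "'p \<Rightarrow> 'e \<Rightarrow> ('p \<Rightarrow> 'e) \<Rightarrow> 'e"
    and nablaN :: "'q \<Rightarrow> 'f \<Rightarrow> ('q \<Rightarrow> 'f) \<Rightarrow> 'f"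
    and nablaF :: "'p \<Rightarrow> 'e \<Rightarrow> ('p \<Rightarrow> 'f) \<Rightarrow> 'f"
    and m :: nat
  assumes "smooth_atlas AM" and "DIM('e) = 2 * m + 1"
    and "cosymplectic AM \<phi> \<xi> \<eta> gM"
    and "smooth_atlas AN" and "riemannian_metric AN gN"
    and "levi_civita AM gM nablaM" and "levi_civita AN gN nablaN"
    and "riemannian_submersion AM gM AN gN F"
    and "pullback_connection AM AN F nablaN nablaF"
    and "anti_invariant AM \<phi> gM AN F"
    and "\<And>p. is_direct_sum (horizontal AM gM AN F p) (\<phi> p ` vertical AM AN F p) (span {\<xi> p})"
  shows "harmonic AM gM AN F nablaM nablaF \<longleftrightarrow>
    (\<forall>V\<in>vertical_fields AM AN F. \<forall>p. trace_phi_T AM \<phi> gM AN F nablaM V p = 0)"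
proof -
  interpret anti_invariant_submersion AM gM nablaM AN F nablaF gN nablaN \<phi> \<xi> \<eta>
    using assms
    by unfold_locales
      (auto simp: riemannian_submersion_def pullback_connection_def cosymplectic_def almost_contact_metric_def)
  show ?thesis by (rule harmonic_iff_trace)
qed

end
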